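(* The $\mathsf{MSL}(\omega)$ provability problem and the HORS cotrivial automaton model checking problem are interreducible: there is a computable many-one reduction from each of the two problems to the other.
   Context: **$\mathsf{MSL}(\omega)$ provability.** Constructor types $\gamma ::= \iota\mid\gamma\to\gamma$. $\Sigma$: finite set of function symbols of constructor types; $\Pi$: finite set of predicate symbols of type $\iota\to o$. Goal formulas $G ::= P\,s\mid G\wedge G\mid\exists x{:}\gamma.\,G\mid\mathsf{true}$ with $s:\iota$ a simply typed applicative term over variables and $\Sigma$. Definite formulas: finite sets (conjunctions) of clauses $\forall y{:}\iota.\,G\Rightarrow P\,y$ or $\forall\overline{y{:}\gamma}.\,G\Rightarrow P\,(c\,\overline y)$, where $\overline y$ are distinct variables. $D\vdash G$ is the least relation with: $D\vdash\mathsf{true}$; $D\vdash G\wedge H$ if $D\vdash G$ and $D\vdash H$; $D\vdash\exists x.\,G$ if $D\vdash G[t/x]$ for some closed term $t$ of the type of $x$; $D\vdash A[\overline s/\overline y]$ if $(\forall\overline y.\,G\Rightarrow A)\in D$ and $D\vdash G[\overline s/\overline y]$. Problem: given $\Sigma,\Pi$ and closed $D,G$, decide whether $D\vdash G$. **HORS.** A (deterministic) higher-order recursion scheme $\mathcal G=\langle\mathcal N,\Sigma_{\mathsf{con}},\mathcal R,S\rangle$ consists of a finite set $\mathcal N$ of simply typed (over the base type $\iota$) nonterminals with start symbol $S:\iota$, a finite ranked alphabet $\Sigma_{\mathsf{con}}$ of constants $a:\iota\to\dots\to\iota\to\iota$, and for each $f\in\mathcal N$ one well-typed definition $f\,\overline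 y=t$, with $\overline y$ distinct variables and $t:\iota$ an applicative term over $\overline y$, $\mathcal N$ and $\Sigma_{\mathsf{con}}$. Its value tree $[\![\mathcal G]\!]$ is the (possibly infinite) tree over $\Sigma_{\mathsf{con}}\cup\{\bot\}$ obtained by rewriting from $S$ ad infinitum using the definitions as left-to-right rules, where $\bot$ labels positions at which no constant is ever produced. **Cotrivial automaton model checking.** An alternating tree automaton over $\Sigma_{\mathsf{con}}$ has a finite state set, an initial state, and for each state $q$ and each constant $a$ of arity $m$ a positive boolean formula over pairs $(i,q')$, $1\le i\le m$; there is no transition on $\bot$ (its transition formula is false). With the cotrivial acceptance condition, a tree is accepted iff there is a run-tree from the initial state at the root, obeying all transition formulas, with no infinite branch. (Cotrivial automata are the duals of alternating trivial automata, in which all infinite branches are accepting and $\bot$ is accepted from every state.) Problem: given a HORS $\mathcal G$ and an alternating cotrivial automaton, decide whether the automaton accepts $[\![\mathcal G]\!]$. *)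

theory Defs
  imports Main "HOL-Library.Nat_Bijection"
begin

section \<open>Computability\<close>

text \<open>
  The total recursive functions, by Kleene's closure conditions. A function of arity \<open>n\<close> takes a
  list; only its values on lists of length \<open>n\<close> are meaningful. Minimisation is restricted to
  regular functions, so that all functions in the class are total.
\<close>

inductive recursive :: "nat \<Rightarrow> (nat list \<Rightarrow> nat) \<Rightarrow> bool" where
  zero: "recursive n (\<lambda>xs. 0)"
| succ: "recursive 1 (\<lambda>xs. Suc (xs ! 0))"
| proj: "i < n \<Longrightarrow> recursive n (\<lambda>xs. xs ! i)"
| comp: "\<lbrakk>recursive (length gs) f; \<And>g. g \<in> set gs \<Longrightarrow> recursive n g\<rbrakk>
         \<Longrightarrow> recursive n (\<lambda>xs. f (map (\<lambda>g. g xs) gs))"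
| prim_rec: "\<lbrakk>recursive n f; recursive (Suc (Suc n)) g\<rbrakk>
         \<Longrightarrow> recursive (Suc n)
               (\<lambda>xs. rec_nat (f (tl xs)) (\<lambda>k v. g (k # v # tl xs)) (hd xs))"
| minim: "\<lbrakk>recursive (Suc n) f; \<And>xs. length xs = n \<Longrightarrow> \<exists>y. f (y # xs) = 0\<rbrakk>
         \<Longrightarrow> recursive n (\<lambda>xs. LEAST y. f (y # xs) = 0)"

definition computable :: "(nat \<Rightarrow> nat) \<Rightarrow> bool" where
  "computable f \<longleftrightarrow> (\<exists>F. recursive 1 F \<and> (\<forall>n. F [n] = f n))"

text \<open>
  A decision problem consists of the set of codes of its instances and the subset of codes of its
  positive instances. A reduction maps instances to instances; its behaviour on numbers that are
  not codes of instances is irrelevant.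
\<close>

datatype problem = Problem (instances: "nat set") (positives: "nat set")

definition many_one_reducible :: "problem \<Rightarrow> problem \<Rightarrow> bool" (infix "\<le>\<^sub>m" 50) where
  "A \<le>\<^sub>m B \<longleftrightarrow> (\<exists>f. computable f \<and>
     (\<forall>n \<in> instances A. f n \<in> instances B \<and> (n \<in> positives A \<longleftrightarrow> f n \<in> positives B)))"


section \<open>Simply typed applicative terms\<close>

datatype ctype = Iota | Arrow ctype ctype

definition arrows :: "ctype list \<Rightarrow> ctype \<Rightarrow> ctype" where
  "arrows \<gamma>s \<gamma> = foldr Arrow \<gamma>s \<gamma>"

datatype 'f tm = Var nat | Sym 'f | App "'f tm" "'f tm"

definition apps :: "'f tm \<Rightarrow> 'f tm list \<Rightarrow> 'f tm" where
  "apps t ts = foldl App t ts"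

inductive has_type ::
  "('f \<rightharpoonup> ctype) \<Rightarrow> (nat \<rightharpoonup> ctype) \<Rightarrow> 'f tm \<Rightarrow> ctype \<Rightarrow> bool"
  for \<Sigma> \<Gamma> where
  "\<Gamma> x = Some \<gamma> \<Longrightarrow> has_type \<Sigma> \<Gamma> (Var x) \<gamma>"
| "\<Sigma> f = Some \<gamma> \<Longrightarrow> has_type \<Sigma> \<Gamma> (Sym f) \<gamma>"
| "\<lbrakk>has_type \<Sigma> \<Gamma> s (Arrow \<gamma> \<delta>); has_type \<Sigma> \<Gamma> t \<gamma>\<rbrakk> \<Longrightarrow> has_type \<Sigma> \<Gamma> (App s t) \<delta>"

abbreviation closed_term :: "('f \<rightharpoonup> ctype) \<Rightarrow> 'f tm \<Rightarrow> ctype \<Rightarrow> bool" where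
  "closed_term \<Sigma> \<equiv> has_type \<Sigma> Map.empty"

fun subst :: "(nat \<rightharpoonup> 'f tm) \<Rightarrow> 'f tm \<Rightarrow> 'f tm" where
  "subst \<sigma> (Var x) = (case \<sigma> x of None \<Rightarrow> Var x | Some t \<Rightarrow> t)"
| "subst \<sigma> (Sym f) = Sym f"
| "subst \<sigma> (App s t) = App (subst \<sigma> s) (subst \<sigma> t)"


section \<open>Provability in MSL(\<open>\<omega>\<close>)\<close>

datatype goal =
    GTrue
  | GAtom nat "nat tm"
  | GAnd goal goal
  | GEx nat ctype goal

text \<open>Only closed terms are ever substituted into goals, so capture cannot occur.\<close>

fun subst_goal :: "(nat \<rightharpoonup> nat tm) \<Rightarrow> goal \<Rightarrow> goal" where
  "subst_goal \<sigma> GTrue = GTrue"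
| "subst_goal \<sigma> (GAtom P s) = GAtom P (subst \<sigma> s)"
| "subst_goal \<sigma> (GAnd G H) = GAnd (subst_goal \<sigma> G) (subst_goal \<sigma> H)"
| "subst_goal \<sigma> (GEx x \<gamma> G) = GEx x \<gamma> (subst_goal (\<sigma>(x := None)) G)"

fun wf_goal :: "(nat \<rightharpoonup> ctype) \<Rightarrow> nat set \<Rightarrow> (nat \<rightharpoonup> ctype) \<Rightarrow> goal \<Rightarrow> bool" where
  "wf_goal \<Sigma> \<Pi> \<Gamma> GTrue \<longleftrightarrow> True"
| "wf_goal \<Sigma> \<Pi> \<Gamma> (GAtom P s) \<longleftrightarrow> P \<in> \<Pi> \<and> has_type \<Sigma> \<Gamma> s Iota"
| "wf_goal \<Sigma> \<Pi> \<Gamma> (GAnd G H) \<longleftrightarrow> wf_goal \<Sigma> \<Pi> \<Gamma> G \<and> wf_goal \<Sigma> \<Pi> \<Gamma> H"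
| "wf_goal \<Sigma> \<Pi> \<Gamma> (GEx x \<gamma> G) \<longleftrightarrow> wf_goal \<Sigma> \<Pi> (\<Gamma>(x \<mapsto> \<gamma>)) G"

text \<open>
  \<open>VarClause y G P\<close> is \<open>\<forall>y:\<iota>. G \<Rightarrow> P y\<close>, and \<open>ConClause c [(y\<^sub>1,\<gamma>\<^sub>1),\<dots>,(y\<^sub>n,\<gamma>\<^sub>n)] G P\<close> is
  \<open>\<forall>y\<^sub>1:\<gamma>\<^sub>1 \<dots> y\<^sub>n:\<gamma>\<^sub>n. G \<Rightarrow> P (c y\<^sub>1 \<dots> y\<^sub>n)\<close>.
\<close>

datatype clause =
    VarClause nat goal nat
  | ConClause nat "(nat \<times> ctype) list" goal nat

fun binders :: "clause \<Rightarrow> (nat \<times> ctype) list" where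
  "binders (VarClause y G P) = [(y, Iota)]"
| "binders (ConClause c ys G P) = ys"

fun body :: "clause \<Rightarrow> goal" where
  "body (VarClause y G P) = G"
| "body (ConClause c ys G P) = G"

fun head :: "clause \<Rightarrow> goal" where
  "head (VarClause y G P) = GAtom P (Var y)"
| "head (ConClause c ys G P) = GAtom P (apps (Sym c) (map (Var \<circ> fst) ys))"

definition wf_clause :: "(nat \<rightharpoonup> ctype) \<Rightarrow> nat set \<Rightarrow> clause \<Rightarrow> bool" where
  "wf_clause \<Sigma> \<Pi> C \<longleftrightarrow> distinct (map fst (binders C)) \<and>
     wf_goal \<Sigma> \<Pi> (map_of (binders C)) (body C) \<and>
     wf_goal \<Sigma> \<Pi> (map_of (binders C)) (head C)"

inductive provable :: "(nat \<rightharpoonup> ctype) \<Rightarrow> clause set \<Rightarrow> goal \<Rightarrow> bool"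
  for \<Sigma> D where
  "provable \<Sigma> D GTrue"
| "\<lbrakk>provable \<Sigma> D G; provable \<Sigma> D H\<rbrakk> \<Longrightarrow> provable \<Sigma> D (GAnd G H)"
| "\<lbrakk>closed_term \<Sigma> t \<gamma>; provable \<Sigma> D (subst_goal [x \<mapsto> t] G)\<rbrakk> \<Longrightarrow> provable \<Sigma> D (GEx x \<gamma> G)"
| "\<lbrakk>C \<in> D; list_all2 (closed_term \<Sigma>) ss (map snd (binders C));
    \<sigma> = map_of (zip (map fst (binders C)) ss); provable \<Sigma> D (subst_goal \<sigma> (body C))\<rbrakk>
   \<Longrightarrow> provable \<Sigma> D (subst_goal \<sigma> (head C))"

text \<open>Finite sets and finite maps in instances are given by lists and association lists.\<close>

datatype msl_instance =
  MSL (signature: "(nat \<times> ctype) list") (predicates: "nat list")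
      (definite: "clause list") (query: goal)

definition wf_msl :: "msl_instance \<Rightarrow> bool" where
  "wf_msl I \<longleftrightarrow>
     distinct (map fst (signature I)) \<and> distinct (predicates I) \<and>
     (\<forall>C \<in> set (definite I). wf_clause (map_of (signature I)) (set (predicates I)) C) \<and>
     wf_goal (map_of (signature I)) (set (predicates I)) Map.empty (query I)"

definition msl_provable :: "msl_instance \<Rightarrow> bool" where
  "msl_provable I \<longleftrightarrow> provable (map_of (signature I)) (set (definite I)) (query I)"


section \<open>Higher-order recursion schemes\<close>

datatype hsym = NT nat | Con nat

text \<open>A rule \<open>(f, ys, t)\<close> is the definition \<open>f ys = t\<close>; constants are listed with their arities.\<close>

datatype hors =
  HORS (nonterminals: "(nat \<times> ctype) list") (constants: "(nat \<times> nat) list")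
       (rules: "(nat \<times> nat list \<times> hsym tm) list") (start: nat)

fun hsig :: "hors \<Rightarrow> hsym \<rightharpoonup> ctype" where
  "hsig \<G> (NT f) = map_of (nonterminals \<G>) f"
| "hsig \<G> (Con a) = map_option (\<lambda>m. arrows (replicate m Iota) Iota) (map_of (constants \<G>) a)"

definition wf_hors :: "hors \<Rightarrow> bool" where
  "wf_hors \<G> \<longleftrightarrow>
     distinct (map fst (nonterminals \<G>)) \<and> distinct (map fst (constants \<G>)) \<and>
     distinct (map fst (rules \<G>)) \<and>
     fst ` set (rules \<G>) = fst ` set (nonterminals \<G>) \<and>
     (\<forall>(f, ys, t) \<in> set (rules \<G>). distinct ys \<and>
        (\<exists>\<gamma>s. length \<gamma>s = length ys \<and> hsig \<G> (NT f) = Some (arrows \<gamma>s Iota) \<and>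
              has_type (hsig \<G>) (map_of (zip ys \<gamma>s)) t Iota)) \<and>
     hsig \<G> (NT (start \<G>)) = Some Iota"

inductive rewrite :: "hors \<Rightarrow> hsym tm \<Rightarrow> hsym tm \<Rightarrow> bool" for \<G> where
  "\<lbrakk>(f, ys, t) \<in> set (rules \<G>); length ss = length ys\<rbrakk>
   \<Longrightarrow> rewrite \<G> (apps (Sym (NT f)) ss) (subst (map_of (zip ys ss)) t)"
| "rewrite \<G> s s' \<Longrightarrow> rewrite \<G> (App s t) (App s' t)"
| "rewrite \<G> t t' \<Longrightarrow> rewrite \<G> (App s t) (App s t')"

text \<open>
  \<open>label_at t p a\<close>: the constant \<open>a\<close> is at position \<open>p\<close> of \<open>t\<close>, and only constants occur above it.
  Directions are numbered from 1.
\<close>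

inductive label_at :: "hsym tm \<Rightarrow> nat list \<Rightarrow> nat \<Rightarrow> bool" where
  "label_at (apps (Sym (Con a)) ts) [] a"
| "\<lbrakk>1 \<le> i; i \<le> length ts; label_at (ts ! (i - 1)) p b\<rbrakk>
   \<Longrightarrow> label_at (apps (Sym (Con a)) ts) (i # p) b"

definition produces :: "hors \<Rightarrow> nat list \<Rightarrow> nat \<Rightarrow> bool" where
  "produces \<G> p a \<longleftrightarrow> (\<exists>t. (rewrite \<G>)\<^sup>*\<^sup>* (Sym (NT (start \<G>))) t \<and> label_at t p a)"

datatype label = Bot | Const nat

type_synonym ltree = "nat list \<rightharpoonup> label"

text \<open>
  The rewrite rules are orthogonal, hence confluent, so at most one constant is ever produced at a
  given position. The domain consists of the root and the children of positions where a constant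
  is produced.
\<close>

definition value_tree :: "hors \<Rightarrow> ltree" where
  "value_tree \<G> p =
     (if \<exists>a. produces \<G> p a then Some (Const (THE a. produces \<G> p a))
      else if p = [] \<or> (\<exists>q i a m. p = q @ [i] \<and> produces \<G> q a \<and>
                          map_of (constants \<G>) a = Some m \<and> 1 \<le> i \<and> i \<le> m)
      then Some Bot else None)"


section \<open>Alternating cotrivial tree automata\<close>

datatype pbf = PTrue | PFalse | PAtom nat nat | PAnd pbf pbf | POr pbf pbf

fun sat :: "(nat \<times> nat) set \<Rightarrow> pbf \<Rightarrow> bool" where
  "sat Y PTrue \<longleftrightarrow> True"
| "sat Y PFalse \<longleftrightarrow> False"
| "sat Y (PAtom i q) \<longleftrightarrow> (i, q) \<in> Y"
| "sat Y (PAnd \<phi> \<psi>) \<longleftrightarrow> sat Y \<phi> \<and> sat Y \<psi>"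
| "sat Y (POr \<phi> \<psi>) \<longleftrightarrow> sat Y \<phi> \<or> sat Y \<psi>"

fun atoms :: "pbf \<Rightarrow> (nat \<times> nat) set" where
  "atoms PTrue = {}"
| "atoms PFalse = {}"
| "atoms (PAtom i q) = {(i, q)}"
| "atoms (PAnd \<phi> \<psi>) = atoms \<phi> \<union> atoms \<psi>"
| "atoms (POr \<phi> \<psi>) = atoms \<phi> \<union> atoms \<psi>"

datatype automaton =
  Automaton (states: "nat list") (initial: nat) (transitions: "((nat \<times> nat) \<times> pbf) list")

definition wf_automaton :: "(nat \<times> nat) list \<Rightarrow> automaton \<Rightarrow> bool" where
  "wf_automaton cs A \<longleftrightarrow>
     distinct (states A) \<and> initial A \<in> set (states A) \<and>
     distinct (map fst (transitions A)) \<and>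
     fst ` set (transitions A) = set (states A) \<times> fst ` set cs \<and>
     (\<forall>((q, a), \<phi>) \<in> set (transitions A). \<forall>m. map_of cs a = Some m \<longrightarrow>
        atoms \<phi> \<subseteq> {1..m} \<times> set (states A))"

fun transition :: "automaton \<Rightarrow> nat \<Rightarrow> label \<Rightarrow> pbf" where
  "transition A q Bot = PFalse"
| "transition A q (Const a) = the (map_of (transitions A) (q, a))"

text \<open>
  A run-tree has a prefix-closed set \<open>T\<close> of nodes; its labelling \<open>r\<close> assigns to each node a position
  of the input tree and a state.
\<close>

definition run_tree ::
  "automaton \<Rightarrow> ltree \<Rightarrow> nat list set \<Rightarrow> (nat list \<Rightarrow> nat list \<times> nat) \<Rightarrow> bool" where
  "run_tree A \<T> T r \<longleftrightarrow>
     [] \<in> T \<and> (\<forall>x k. x @ [k] \<in> T \<longrightarrow> x \<in> T) \<and> r [] = ([], initial A) \<and>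
     (\<forall>x \<in> T. \<forall>p q. r x = (p, q) \<longrightarrow>
        q \<in> set (states A) \<and>
        (\<forall>k. x @ [k] \<in> T \<longrightarrow> (\<exists>i q'. r (x @ [k]) = (p @ [i], q'))) \<and>
        (\<exists>l. \<T> p = Some l \<and>
             sat {(i, q'). \<exists>k. x @ [k] \<in> T \<and> r (x @ [k]) = (p @ [i], q')} (transition A q l)))"

definition infinite_branch :: "nat list set \<Rightarrow> (nat \<Rightarrow> nat) \<Rightarrow> bool" where
  "infinite_branch T b \<longleftrightarrow> (\<forall>n. map b [0..<n] \<in> T)"

definition cotrivially_accepts :: "automaton \<Rightarrow> ltree \<Rightarrow> bool" where
  "cotrivially_accepts A \<T> \<longleftrightarrow> (\<exists>T r. run_tree A \<T> T r \<and> (\<nexists>b. infinite_branch T b))"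


section \<open>The two decision problems\<close>

definition enc_pair :: "('a \<Rightarrow> nat) \<Rightarrow> ('b \<Rightarrow> nat) \<Rightarrow> 'a \<times> 'b \<Rightarrow> nat" where
  "enc_pair e e' p = prod_encode (e (fst p), e' (snd p))"

definition enc_list :: "('a \<Rightarrow> nat) \<Rightarrow> 'a list \<Rightarrow> nat" where
  "enc_list e xs = list_encode (map e xs)"

definition enc_nat :: "nat \<Rightarrow> nat" where
  "enc_nat n = n"

fun enc_ctype :: "ctype \<Rightarrow> nat" where
  "enc_ctype Iota = 0"
| "enc_ctype (Arrow \<gamma> \<delta>) = Suc (prod_encode (enc_ctype \<gamma>, enc_ctype \<delta>))"

fun enc_tm :: "('f \<Rightarrow> nat) \<Rightarrow> 'f tm \<Rightarrow> nat" where
  "enc_tm e (Var x) = list_encode [0, x]"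
| "enc_tm e (Sym f) = list_encode [1, e f]"
| "enc_tm e (App s t) = list_encode [2, enc_tm e s, enc_tm e t]"

fun enc_goal :: "goal \<Rightarrow> nat" where
  "enc_goal GTrue = list_encode [0]"
| "enc_goal (GAtom P s) = list_encode [1, P, enc_tm enc_nat s]"
| "enc_goal (GAnd G H) = list_encode [2, enc_goal G, enc_goal H]"
| "enc_goal (GEx x \<gamma> G) = list_encode [3, x, enc_ctype \<gamma>, enc_goal G]"

fun enc_clause :: "clause \<Rightarrow> nat" where
  "enc_clause (VarClause y G P) = list_encode [0, y, enc_goal G, P]"
| "enc_clause (ConClause c ys G P) =
     list_encode [1, c, enc_list (enc_pair enc_nat enc_ctype) ys, enc_goal G, P]"

fun enc_msl :: "msl_instance \<Rightarrow> nat" where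
  "enc_msl (MSL \<Sigma> \<Pi> D G) = list_encode
     [enc_list (enc_pair enc_nat enc_ctype) \<Sigma>, enc_list enc_nat \<Pi>, enc_list enc_clause D,
      enc_goal G]"

fun enc_hsym :: "hsym \<Rightarrow> nat" where
  "enc_hsym (NT f) = list_encode [0, f]"
| "enc_hsym (Con a) = list_encode [1, a]"

fun enc_hors :: "hors \<Rightarrow> nat" where
  "enc_hors (HORS N C R S) = list_encode
     [enc_list (enc_pair enc_nat enc_ctype) N, enc_list (enc_pair enc_nat enc_nat) C,
      enc_list (enc_pair enc_nat (enc_pair (enc_list enc_nat) (enc_tm enc_hsym))) R, S]"

fun enc_pbf :: "pbf \<Rightarrow> nat" where
  "enc_pbf PTrue = list_encode [0]"
| "enc_pbf PFalse = list_encode [1]"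
| "enc_pbf (PAtom i q) = list_encode [2, i, q]"
| "enc_pbf (PAnd \<phi> \<psi>) = list_encode [3, enc_pbf \<phi>, enc_pbf \<psi>]"
| "enc_pbf (POr \<phi> \<psi>) = list_encode [4, enc_pbf \<phi>, enc_pbf \<psi>]"

fun enc_automaton :: "automaton \<Rightarrow> nat" where
  "enc_automaton (Automaton Q q0 \<delta>) = list_encode
     [enc_list enc_nat Q, q0, enc_list (enc_pair (enc_pair enc_nat enc_nat) enc_pbf) \<delta>]"

definition msl_omega_provability :: problem where
  "msl_omega_provability = Problem
     {enc_msl I | I. wf_msl I}
     {enc_msl I | I. wf_msl I \<and> msl_provable I}"

definition hors_cotrivial_model_checking :: problem where
  "hors_cotrivial_model_checking = Problem
     {enc_pair enc_hors enc_automaton (\<G>, A) | \<G> A.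
        wf_hors \<G> \<and> wf_automaton (constants \<G>) A}
     {enc_pair enc_hors enc_automaton (\<G>, A) | \<G> A.
        wf_hors \<G> \<and> wf_automaton (constants \<G>) A \<and> cotrivially_accepts A (value_tree \<G>)}"


subsection \<open>The encodings are injective\<close>

lemma inj_enc_nat: "inj enc_nat"
  by (simp add: inj_def enc_nat_def)

lemma inj_enc_pair: "\<lbrakk>inj e; inj e'\<rbrakk> \<Longrightarrow> inj (enc_pair e e')"
  by (auto simp: inj_def enc_pair_def)

lemma inj_enc_list: "inj e \<Longrightarrow> inj (enc_list e)"
  by (rule injI) (simp add: enc_list_def list_encode_eq inj_map_eq_map)

lemma inj_enc_ctype: "inj enc_ctype"
proof (rule injI)
  show "enc_ctype x = enc_ctype y \<Longrightarrow> x = y" for x y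
    by (induction x arbitrary: y; case_tac y) auto
qed

lemma inj_enc_tm:
  assumes "inj e" shows "inj (enc_tm e)"
proof (rule injI)
  show "enc_tm e x = enc_tm e y \<Longrightarrow> x = y" for x y
    using assms by (induction x arbitrary: y; case_tac y)
      (auto simp del: list_encode.simps simp: list_encode_eq inj_eq)
qed

lemma inj_enc_goal: "inj enc_goal"
proof (rule injI)
  show "enc_goal x = enc_goal y \<Longrightarrow> x = y" for x y
    by (induction x arbitrary: y; case_tac y)
      (auto simp del: list_encode.simps
            simp: list_encode_eq inj_eq[OF inj_enc_ctype] inj_eq[OF inj_enc_tm[OF inj_enc_nat]])
qed

lemma inj_enc_clause: "inj enc_clause"
proof (rule injI)
  show "enc_clause x = enc_clause y \<Longrightarrow> x = y" for x y
    by (cases x; cases y)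
      (auto simp del: list_encode.simps
            simp: list_encode_eq inj_eq[OF inj_enc_goal]
              inj_eq[OF inj_enc_list[OF inj_enc_pair[OF inj_enc_nat inj_enc_ctype]]])
qed

lemma inj_enc_msl: "inj enc_msl"
proof (rule injI)
  show "enc_msl x = enc_msl y \<Longrightarrow> x = y" for x y
    by (cases x; cases y)
      (auto simp del: list_encode.simps
            simp: list_encode_eq inj_eq[OF inj_enc_goal] inj_eq[OF inj_enc_list[OF inj_enc_nat]]
              inj_eq[OF inj_enc_list[OF inj_enc_clause]]
              inj_eq[OF inj_enc_list[OF inj_enc_pair[OF inj_enc_nat inj_enc_ctype]]])
qed

lemma inj_enc_hsym: "inj enc_hsym"
proof (rule injI)
  show "enc_hsym x = enc_hsym y \<Longrightarrow> x = y" for x y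
    by (cases x; cases y) (auto simp del: list_encode.simps simp: list_encode_eq)
qed

lemma inj_enc_hors: "inj enc_hors"
proof (rule injI)
  show "enc_hors x = enc_hors y \<Longrightarrow> x = y" for x y
    by (cases x; cases y)
      (auto simp del: list_encode.simps
            simp: list_encode_eq
              inj_eq[OF inj_enc_list[OF inj_enc_pair[OF inj_enc_nat inj_enc_ctype]]]
              inj_eq[OF inj_enc_list[OF inj_enc_pair[OF inj_enc_nat inj_enc_nat]]]
              inj_eq[OF inj_enc_list[OF inj_enc_pair[OF inj_enc_nat
                inj_enc_pair[OF inj_enc_list[OF inj_enc_nat] inj_enc_tm[OF inj_enc_hsym]]]]])
qed

lemma inj_enc_pbf: "inj enc_pbf"
proof (rule injI)
  show "enc_pbf x = enc_pbf y \<Longrightarrow> x = y" for x y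
    by (induction x arbitrary: y; case_tac y)
      (auto simp del: list_encode.simps simp: list_encode_eq)
qed

lemma inj_enc_automaton: "inj enc_automaton"
proof (rule injI)
  show "enc_automaton x = enc_automaton y \<Longrightarrow> x = y" for x y
    by (cases x; cases y)
      (auto simp del: list_encode.simps
            simp: list_encode_eq inj_eq[OF inj_enc_list[OF inj_enc_nat]]
              inj_eq[OF inj_enc_list[OF inj_enc_pair[OF
                inj_enc_pair[OF inj_enc_nat inj_enc_nat] inj_enc_pbf]]])
qed

end

theory Submission
  imports Defs
begin

text \<open>
  Both reductions go through the head reduction of the recursion scheme. Acceptance of the value tree
  is a least fixed point over head reductions: a term is accepted from state \<open>q\<close> if its head reduct
  is, or if it is headed by a constant \<open>a\<close> and the accepted arguments satisfy \<open>\<delta> q a\<close>. A proof by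
  standardisation connects this with the rewriting that defines the value tree.

  From schemes to MSL(\<open>\<omega>\<close>), nonterminals and constants become function symbols, and a state \<open>q\<close> becomes
  the predicate of the terms accepted from \<open>q\<close>; a definition \<open>f ys = t\<close> yields the clauses
  \<open>P\<^sub>q t \<Rightarrow> P\<^sub>q (f ys)\<close>, and transition formulas are evaluated by one predicate per subformula.

  From MSL(\<open>\<omega>\<close>) to schemes, a goal becomes an and-or tree and a term \<open>s : \<iota>\<close> becomes the list of all
  clause bodies that apply to it, each tagged with the predicate of its clause; the state \<open>P\<close> selects
  the bodies tagged \<open>P\<close>. An existential quantifier over \<open>\<gamma>\<close> is an infinite disjunction over the closed
  terms of type \<open>\<gamma>\<close>, enumerated in continuation-passing style: \<open>E\<^sub>\<gamma> F\<close> tries \<open>F c\<close> for the symbols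
  \<open>c : \<gamma>\<close> and, for each type \<open>\<delta> \<rightarrow> \<gamma>\<close>, tries
  \<open>E\<^bsub>\<delta> \<rightarrow> \<gamma>\<^esub> (\<lambda>s. E\<^sub>\<delta> (\<lambda>t. F (s t)))\<close>. Only subtypes of the types in the instance are needed,
  so lambda lifting gives finitely many nonterminals.
\<close>

section \<open>Recursive functions\<close>

text \<open>The two sides fit because provability and cotrivial acceptance are both least fixed
  points: a derivation is finite, a run-tree has no infinite branch, and a divergent subterm is
  labelled \<open>Bot\<close>, on which the transition formula is false. A search for an existential
  witness that does not exist can only continue forever or end in a rejected leaf.

  Much of the development is due to the demand that the reductions be recursive functions on codes.
  Recursion over syntax trees is laborious there, so the translations are shaped to avoid it:
  predicates and nonterminals carry in their names the code of the formula, goal or type that they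
  stand for; families of subexpressions arise from iterating a one-level expansion a bounded number
  of times; each member is then translated by a single case distinction. The renaming of symbols
  inside terms is the one translation step that recurses over a tree, by course-of-values recursion
  on its code.\<close>

text \<open>\<open>recursive\<close> up to the values on lists of the wrong length, so that it can be used extensionally.\<close>

definition rec_fun :: "nat \<Rightarrow> (nat list \<Rightarrow> nat) \<Rightarrow> bool" where
  "rec_fun n f \<longleftrightarrow> (\<exists>F. recursive n F \<and> (\<forall>xs. length xs = n \<longrightarrow> F xs = f xs))"

lemma rec_fun_cong:
  assumes "rec_fun n f" "\<And>xs. length xs = n \<Longrightarrow> f xs = g xs"
  shows "rec_fun n g"
  using assms unfolding rec_fun_def by metis

lemma rec_fun_proj: "i < n \<Longrightarrow> rec_fun n (\<lambda>xs. xs ! i)"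
  unfolding rec_fun_def using recursive.proj by blast

lemma rec_fun_comp:
  assumes "rec_fun (length gs) f" "\<And>g. g \<in> set gs \<Longrightarrow> rec_fun n g"
  shows "rec_fun n (\<lambda>xs. f (map (\<lambda>g. g xs) gs))"
proof -
  obtain F where F: "recursive (length gs) F" "\<And>xs. length xs = length gs \<Longrightarrow> F xs = f xs"
    using assms(1) unfolding rec_fun_def by blast
  obtain H where H: "\<And>g. g \<in> set gs \<Longrightarrow> recursive n (H g) \<and> (\<forall>xs. length xs = n \<longrightarrow> H g xs = g xs)"
    using assms(2) unfolding rec_fun_def by metis
  have "recursive n (\<lambda>xs. F (map (\<lambda>g. g xs) (map H gs)))"
    by (rule recursive.comp) (use F H in auto)
  moreover have "F (map (\<lambda>g. g xs) (map H gs)) = f (map (\<lambda>g. g xs) gs)" if "length xs = n" for xs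
  proof -
    have "map (\<lambda>g. g xs) (map H gs) = map (\<lambda>g. g xs) gs"
      using H that by simp
    then show ?thesis
      using F(2)[of "map (\<lambda>g. g xs) gs"] by (simp only: length_map)
  qed
  ultimately show ?thesis
    unfolding rec_fun_def by (intro exI conjI allI impI)
qed

lemma rec_fun_prim_rec:
  assumes "rec_fun n f" "rec_fun (Suc (Suc n)) g"
  shows "rec_fun (Suc n) (\<lambda>xs. rec_nat (f (tl xs)) (\<lambda>k v. g (k # v # tl xs)) (hd xs))"
proof -
  obtain F where F: "recursive n F" "\<And>xs. length xs = n \<Longrightarrow> F xs = f xs"
    using assms(1) unfolding rec_fun_def by blast
  obtain H where H: "recursive (Suc (Suc n)) H" "\<And>xs. length xs = Suc (Suc n) \<Longrightarrow> H xs = g xs"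
    using assms(2) unfolding rec_fun_def by blast
  have "rec_nat (F (tl xs)) (\<lambda>k v. H (k # v # tl xs)) (hd xs)
      = rec_nat (f (tl xs)) (\<lambda>k v. g (k # v # tl xs)) (hd xs)" if "length xs = Suc n" for xs
  proof -
    have "rec_nat (F (tl xs)) (\<lambda>k v. H (k # v # tl xs)) m
        = rec_nat (f (tl xs)) (\<lambda>k v. g (k # v # tl xs)) m" for m
      by (induction m) (use F(2) H(2) that in auto)
    then show ?thesis .
  qed
  with recursive.prim_rec[OF F(1) H(1)] show ?thesis
    unfolding rec_fun_def by (intro exI conjI allI impI)
qed

lemma computable_iff_rec_fun: "computable f \<longleftrightarrow> rec_fun 1 (\<lambda>xs. f (xs ! 0))"
proof
  assume "computable f"
  then obtain F where F: "recursive 1 F" "\<And>n. F [n] = f n"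
    unfolding computable_def by blast
  have "F xs = f (xs ! 0)" if "length xs = 1" for xs
    using F(2) that by (cases xs) auto
  with F(1) show "rec_fun 1 (\<lambda>xs. f (xs ! 0))"
    unfolding rec_fun_def by blast
next
  assume "rec_fun 1 (\<lambda>xs. f (xs ! 0))"
  then show "computable f"
    unfolding rec_fun_def computable_def by fastforce
qed

definition computable2 :: "(nat \<Rightarrow> nat \<Rightarrow> nat) \<Rightarrow> bool" where
  "computable2 h \<longleftrightarrow> rec_fun 2 (\<lambda>xs. h (xs ! 0) (xs ! 1))"

lemma rec_fun_computable:
  assumes "computable h" "rec_fun n f"
  shows "rec_fun n (\<lambda>xs. h (f xs))"
  using rec_fun_comp[of "[f]" "\<lambda>xs. h (xs ! 0)" n] assms by (simp add: computable_iff_rec_fun)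

lemma rec_fun_computable2:
  assumes "computable2 h" "rec_fun n f" "rec_fun n g"
  shows "rec_fun n (\<lambda>xs. h (f xs) (g xs))"
  using rec_fun_comp[of "[f, g]" "\<lambda>xs. h (xs ! 0) (xs ! 1)" n] assms
  by (auto simp: computable2_def numeral_2_eq_2)

lemma computable_id: "computable (\<lambda>e. e)"
  using rec_fun_proj[of 0 1] by (simp add: computable_iff_rec_fun)

lemma computable_comp: "computable h \<Longrightarrow> computable f \<Longrightarrow> computable (\<lambda>e. h (f e))"
  using rec_fun_computable[of h 1 "\<lambda>xs. f (xs ! 0)"] by (simp add: computable_iff_rec_fun)

lemma computable_comp2:
  "computable2 h \<Longrightarrow> computable f \<Longrightarrow> computable g \<Longrightarrow> computable (\<lambda>e. h (f e) (g e))"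
  using rec_fun_computable2[of h 1 "\<lambda>xs. f (xs ! 0)" "\<lambda>xs. g (xs ! 0)"]
  by (simp add: computable_iff_rec_fun)

lemma computable_Suc: "computable Suc"
  unfolding computable_def using recursive.succ by auto

lemma rec_fun_const: "rec_fun n (\<lambda>xs. c)"
proof (induction c)
  case 0
  show ?case unfolding rec_fun_def using recursive.zero by blast
next
  case (Suc c)
  then show ?case using rec_fun_computable[OF computable_Suc] by simp
qed

lemma computable_const: "computable (\<lambda>e. c)"
  by (simp add: computable_iff_rec_fun rec_fun_const)

lemma computable2_rec:
  assumes "computable f" "rec_fun 3 (\<lambda>xs. g (xs ! 0) (xs ! 1) (xs ! 2))"
  shows "computable2 (\<lambda>n x. rec_nat (f x) (\<lambda>k v. g k v x) n)"
proof -
  have "rec_fun (Suc 1) (\<lambda>xs. rec_nat (f (tl xs ! 0))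
      (\<lambda>k v. g ((k # v # tl xs) ! 0) ((k # v # tl xs) ! 1) ((k # v # tl xs) ! 2)) (hd xs))"
    by (rule rec_fun_prim_rec) (use assms in \<open>simp_all add: computable_iff_rec_fun numeral_3_eq_3\<close>)
  then have "rec_fun 2 (\<lambda>xs. rec_nat (f (tl xs ! 0))
      (\<lambda>k v. g ((k # v # tl xs) ! 0) ((k # v # tl xs) ! 1) ((k # v # tl xs) ! 2)) (hd xs))"
    by (simp add: numeral_2_eq_2)
  then show ?thesis
    unfolding computable2_def
    by (rule rec_fun_cong) (auto simp: numeral_2_eq_2 length_Suc_conv)
qed

lemma computable2_swap: "computable2 h \<Longrightarrow> computable2 (\<lambda>x y. h y x)"
  using rec_fun_computable2[of h 2 "\<lambda>xs. xs ! 1" "\<lambda>xs. xs ! 0"] rec_fun_proj[of 0 2] rec_fun_proj[of 1 2]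
  by (simp add: computable2_def)

section \<open>Arithmetic and the inverse of Cantor pairing\<close>

lemma computable2_add: "computable2 (+)"
proof -
  have "computable2 (\<lambda>n x. rec_nat x (\<lambda>k v. Suc v) n)"
    by (intro computable2_rec computable_id rec_fun_computable[OF computable_Suc] rec_fun_proj) simp
  moreover have "rec_nat x (\<lambda>k v. Suc v) n = n + x" for n x :: nat
    by (induction n) auto
  ultimately show ?thesis by simp
qed

lemma computable_pred: "computable (\<lambda>n. n - 1)"
proof -
  have "computable2 (\<lambda>n x. rec_nat 0 (\<lambda>k v. k) n)"
    by (rule computable2_rec) (auto intro: computable_const rec_fun_proj)
  then have "computable (\<lambda>n. rec_nat 0 (\<lambda>k v. k) n)"
    by (rule computable_comp2) (rule computable_id)+
  moreover have "rec_nat 0 (\<lambda>k v. k) n = n - 1" for n :: nat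
    by (cases n) auto
  ultimately show ?thesis by simp
qed

lemma computable2_diff: "computable2 (-)"
proof -
  have "computable2 (\<lambda>n x. rec_nat x (\<lambda>k v. v - 1) n)"
    by (intro computable2_rec computable_id rec_fun_computable[OF computable_pred] rec_fun_proj) simp
  then have "computable2 (\<lambda>x n. rec_nat x (\<lambda>k v. v - 1) n)"
    by (rule computable2_swap)
  moreover have "rec_nat x (\<lambda>k v. v - 1) n = x - n" for n x :: nat
    by (induction n) auto
  ultimately show ?thesis by simp
qed

lemma computable_triangle: "computable triangle"
proof -
  have "computable2 (\<lambda>n x. rec_nat 0 (\<lambda>k v. v + Suc k) n)"
    by (rule computable2_rec) (auto intro!: computable_const rec_fun_proj
        rec_fun_computable2[OF computable2_add] rec_fun_computable[OF computable_Suc])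
  then have "computable (\<lambda>n. rec_nat 0 (\<lambda>k v. v + Suc k) n)"
    by (rule computable_comp2) (rule computable_id)+
  moreover have "rec_nat 0 (\<lambda>k v. v + Suc k) n = triangle n" for n :: nat
    by (induction n) auto
  ultimately show ?thesis by simp
qed

lemma computable2_prod_encode: "computable2 (\<lambda>x y. prod_encode (x, y))"
proof -
  have "rec_fun 2 (\<lambda>xs. triangle (xs ! 0 + xs ! 1) + xs ! 0)"
    by (intro rec_fun_computable2[OF computable2_add] rec_fun_computable[OF computable_triangle] rec_fun_proj) auto
  then show ?thesis
    by (simp add: computable2_def prod_encode_def)
qed

text \<open>Cantor pairing maps \<open>(a, b)\<close> to \<open>triangle (a + b) + a\<close>. With
  truncated subtraction the condition says \<open>n < triangle (Suc k)\<close>, so the least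
  \<open>k\<close> is the antidiagonal \<open>a + b\<close> on which the pair lies, and subtracting
  its triangle number leaves \<open>a\<close>. This is the only use of minimisation.\<close>

definition antidiagonal :: "nat \<Rightarrow> nat" where
  "antidiagonal n = (LEAST k. Suc n - triangle (Suc k) = 0)"

lemma triangle_mono: "m \<le> n \<Longrightarrow> triangle m \<le> triangle n"
  by (induction n) (auto simp: le_Suc_eq)

lemma antidiagonal_prod_encode: "antidiagonal (prod_encode (a, b)) = a + b"
  unfolding antidiagonal_def
proof (rule Least_equality)
  show "Suc (prod_encode (a, b)) - triangle (Suc (a + b)) = 0"
    by (simp add: prod_encode_def)
next
  fix k assume k: "Suc (prod_encode (a, b)) - triangle (Suc k) = 0"
  show "a + b \<le> k"
  proof (rule ccontr)
    assume "\<not> a + b \<le> k"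
    then have "triangle (Suc k) \<le> triangle (a + b)"
      by (intro triangle_mono) auto
    then show False
      using k by (simp add: prod_encode_def)
  qed
qed

lemma computable_antidiagonal: "computable antidiagonal"
proof -
  have "rec_fun (Suc 1) (\<lambda>xs. Suc (xs ! 1) - triangle (Suc (xs ! 0)))"
    by (intro rec_fun_computable2[OF computable2_diff] rec_fun_computable[OF computable_triangle]
        rec_fun_computable[OF computable_Suc] rec_fun_proj) auto
  then obtain F where F: "recursive (Suc 1) F"
    "\<And>xs. length xs = Suc 1 \<Longrightarrow> F xs = Suc (xs ! 1) - triangle (Suc (xs ! 0))"
    unfolding rec_fun_def by blast
  have *: "F (y # xs) = Suc (xs ! 0) - triangle (Suc y)" if "length xs = 1" for xs y
    using F(2) that by simp
  have "\<exists>y. F (y # xs) = 0" if "length xs = 1" for xs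
  proof -
    \<comment> \<open>Regularity: the input itself is always a root, though rarely the
      least.\<close>
    have "n < triangle (Suc n)" for n
      by (induction n) auto
    with that show ?thesis
      by (intro exI[of _ "xs ! 0"]) (simp add: * Suc_le_eq del: triangle_Suc)
  qed
  with F(1) have "recursive 1 (\<lambda>xs. LEAST y. F (y # xs) = 0)"
    by (rule recursive.minim)
  then show ?thesis
    unfolding computable_def antidiagonal_def using * by (intro exI[of _ "\<lambda>xs. LEAST y. F (y # xs) = 0"]) simp
qed

definition code_fst :: "nat \<Rightarrow> nat" where "code_fst n = n - triangle (antidiagonal n)"
definition code_snd :: "nat \<Rightarrow> nat" where "code_snd n = antidiagonal n - code_fst n"

lemma code_fst_prod_encode [simp]: "code_fst (prod_encode (a, b)) = a"
  unfolding code_fst_def antidiagonal_prod_encode by (simp add: prod_encode_def)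

lemma code_snd_prod_encode [simp]: "code_snd (prod_encode (a, b)) = b"
  by (simp add: code_snd_def antidiagonal_prod_encode)

lemma computable_code_fst: "computable code_fst"
  unfolding code_fst_def
  by (intro computable_comp2[OF computable2_diff] computable_id
      computable_comp[OF computable_triangle] computable_antidiagonal)

lemma computable_code_snd: "computable code_snd"
  unfolding code_snd_def
  by (intro computable_comp2[OF computable2_diff] computable_antidiagonal computable_code_fst)

definition code_hd :: "nat \<Rightarrow> nat" where "code_hd n = code_fst (n - 1)"
definition code_tl :: "nat \<Rightarrow> nat" where "code_tl n = code_snd (n - 1)"

lemma code_hd_Suc [simp]: "code_hd (Suc (prod_encode (a, b))) = a"
  by (simp add: code_hd_def)

lemma code_tl_Suc [simp]: "code_tl (Suc (prod_encode (a, b))) = b"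
  by (simp add: code_tl_def)

lemma computable_code_hd: "computable code_hd"
  unfolding code_hd_def by (intro computable_comp[OF computable_code_fst] computable_pred)

lemma computable_code_tl: "computable code_tl"
  unfolding code_tl_def by (intro computable_comp[OF computable_code_snd] computable_pred)

text \<open>The step is a unary function of the packed triple of parameter, counter and accumulator.
  Recursion thus stays within unary functions, and the step can still inspect the whole input
  \<open>e\<close>.\<close>

lemma computable_rec_nat:
  assumes "computable s" "computable a" "computable n"
  shows "computable (\<lambda>e. rec_nat (a e) (\<lambda>k v. s (prod_encode (e, prod_encode (k, v)))) (n e))"
proof (rule computable_comp2[OF _ assms(3) computable_id])
  show "computable2 (\<lambda>n e. rec_nat (a e) (\<lambda>k v. s (prod_encode (e, prod_encode (k, v)))) n)"
    by (intro computable2_rec assms(2) rec_fun_computable[OF assms(1)] rec_fun_proj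
        rec_fun_computable2[OF computable2_prod_encode]) auto
qed

lemma computable_if:
  assumes "computable c" "computable a" "computable b"
  shows "computable (\<lambda>e. if c e = 0 then a e else b e)"
proof -
  \<comment> \<open>A branch is a recursion whose step forgets counter and accumulator:
    \<open>code_fst\<close> recovers \<open>e\<close>, so any positive number of rounds yields
    \<open>b e\<close>.\<close>
  have "computable (\<lambda>e. rec_nat (a e) (\<lambda>k v. b (code_fst (prod_encode (e, prod_encode (k, v))))) (c e))"
    by (rule computable_rec_nat) (intro computable_comp[OF assms(3)] computable_code_fst assms)+
  moreover have "rec_nat (a e) (\<lambda>k v. b (code_fst (prod_encode (e, prod_encode (k, v))))) (c e)
      = (if c e = 0 then a e else b e)" for e
    by (cases "c e") auto
  ultimately show ?thesis by simp
qed

lemma computable_eq_if: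
  assumes "computable c" "computable d" "computable a" "computable b"
  shows "computable (\<lambda>e. if c e = d e then a e else b e)"
proof -
  \<comment> \<open>Both truncated differences vanish exactly when the two values agree.\<close>
  have "computable (\<lambda>e. if (c e - d e) + (d e - c e) = 0 then a e else b e)"
    by (intro computable_if computable_comp2[OF computable2_add] computable_comp2[OF computable2_diff] assms)
  moreover have "(c e - d e) + (d e - c e) = 0 \<longleftrightarrow> c e = d e" for e
    by auto
  ultimately show ?thesis by simp
qed

lemma computable_Suc_prod_encode:
  "computable a \<Longrightarrow> computable b \<Longrightarrow> computable (\<lambda>e. Suc (prod_encode (a e, b e)))"
  by (intro computable_comp[OF computable_Suc] computable_comp2[OF computable2_prod_encode])

lemmas computable_intros =
  computable_const computable_id
  computable_comp[OF computable_code_fst] computable_comp[OF computable_code_snd]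
  computable_comp[OF computable_code_hd] computable_comp[OF computable_code_tl]
  computable_comp2[OF computable2_prod_encode] computable_Suc_prod_encode

section \<open>List access and course-of-values recursion on codes\<close>

definition code_nth :: "nat \<Rightarrow> nat \<Rightarrow> nat" where
  "code_nth v i = code_hd ((code_tl ^^ i) v)"

lemma code_nth_list_encode [simp]: "i < length xs \<Longrightarrow> code_nth (list_encode xs) i = xs ! i"
proof (induction xs arbitrary: i)
  case (Cons x xs)
  then show ?case
    by (cases i) (auto simp: code_nth_def funpow_Suc_right simp del: funpow.simps)
qed simp

lemma computable_code_nth:
  assumes "computable v" "computable i"
  shows "computable (\<lambda>e. code_nth (v e) (i e))"
proof -
  have "computable (\<lambda>e. rec_nat (v e)
      (\<lambda>k v. code_tl (code_snd (code_snd (prod_encode (e, prod_encode (k, v)))))) (i e))"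
    by (intro computable_rec_nat computable_comp[OF computable_code_tl] computable_intros assms)
  moreover have "rec_nat v (\<lambda>k v. code_tl (code_snd (code_snd (prod_encode (e, prod_encode (k, v)))))) m
      = (code_tl ^^ m) v" for e m v
    by (induction m) auto
  ultimately show ?thesis
    unfolding code_nth_def by (simp add: computable_comp[OF computable_code_hd])
qed

text \<open>Course-of-values recursion: \<open>s\<close> is applied to the pair of \<open>n\<close> and the code of the list of
  the values at \<open>n - 1, \<dots>, 0\<close>.\<close>

fun history :: "(nat \<Rightarrow> nat) \<Rightarrow> nat \<Rightarrow> nat list" where
  "history s 0 = []"
| "history s (Suc n) = s (prod_encode (n, list_encode (history s n))) # history s n"

definition course_rec :: "(nat \<Rightarrow> nat) \<Rightarrow> nat \<Rightarrow> nat" where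
  "course_rec s n = s (prod_encode (n, list_encode (history s n)))"

lemma length_history [simp]: "length (history s n) = n"
  by (induction n) auto

lemma history_nth: "j < n \<Longrightarrow> history s n ! (n - Suc j) = course_rec s j"
proof (induction n)
  case (Suc n)
  then show ?case
    by (cases "j = n") (auto simp: course_rec_def Suc_diff_Suc nth_Cons' not_less_less_Suc_eq)
qed simp

lemma computable_course_rec:
  assumes "computable s"
  shows "computable (course_rec s)"
proof -
  \<comment> \<open>\<open>code_snd z\<close> is the pair of the counter and the history so far,
    which is just the argument that \<open>s\<close> expects; its second component is the history,
    to which the new value is prepended.\<close>
  define t where "t = (\<lambda>z. Suc (prod_encode (s (code_snd z), code_snd (code_snd z))))"
  have "computable (\<lambda>n. rec_nat 0 (\<lambda>k v. t (prod_encode (n, prod_encode (k, v)))) n)"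
    unfolding t_def
    by (rule computable_rec_nat) (intro computable_comp[OF assms(1)] computable_intros)+
  moreover have "rec_nat 0 (\<lambda>k v. t (prod_encode (e, prod_encode (k, v)))) n
      = list_encode (history s n)" for e n
    by (induction n) (simp_all add: t_def)
  ultimately have "computable (\<lambda>n. list_encode (history s n))" by simp
  then show ?thesis
    unfolding course_rec_def by (intro computable_comp[OF assms(1)] computable_intros)
qed

section \<open>Computable functions between encoded types\<close>

text \<open>The class collects the encodings fixed in the problem definitions, so that closure under
  composition, pairing and list operations is proved once for all types. Injectivity turns an
  equality test on codes into one on values.\<close>

class encodable =
  fixes encode :: "'a \<Rightarrow> nat"
  assumes inj_encode: "inj encode"

lemma encode_eq_iff [simp]: "encode x = encode y \<longleftrightarrow> x = y"
  by (rule inj_eq[OF inj_encode])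

instantiation nat :: encodable begin
definition "encode = enc_nat"
instance by standard (simp add: encode_nat_def inj_enc_nat)
end

instantiation bool :: encodable begin
definition "encode b = (if b then 1 else 0 :: nat)"
instance by standard (auto simp: encode_bool_def inj_def split: if_splits)
end

instantiation prod :: (encodable, encodable) encodable begin
definition "encode = enc_pair encode encode"
instance by standard (simp add: encode_prod_def inj_enc_pair inj_encode)
end

instantiation list :: (encodable) encodable begin
definition "encode = enc_list encode"
instance by standard (simp add: encode_list_def inj_enc_list inj_encode)
end

instantiation ctype :: encodable begin
definition "encode = enc_ctype"
instance by standard (simp add: encode_ctype_def inj_enc_ctype)
end

instantiation tm :: (encodable) encodable begin
definition "encode = enc_tm encode"
instance by standard (simp add: encode_tm_def inj_enc_tm inj_encode)
end

instantiation goal :: encodable begin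
definition "encode = enc_goal"
instance by standard (simp add: encode_goal_def inj_enc_goal)
end

instantiation clause :: encodable begin
definition "encode = enc_clause"
instance by standard (simp add: encode_clause_def inj_enc_clause)
end

instantiation msl_instance :: encodable begin
definition "encode = enc_msl"
instance by standard (simp add: encode_msl_instance_def inj_enc_msl)
end

instantiation hsym :: encodable begin
definition "encode = enc_hsym"
instance by standard (simp add: encode_hsym_def inj_enc_hsym)
end

instantiation hors :: encodable begin
definition "encode = enc_hors"
instance by standard (simp add: encode_hors_def inj_enc_hors)
end

instantiation pbf :: encodable begin
definition "encode = enc_pbf"
instance by standard (simp add: encode_pbf_def inj_enc_pbf)
end

instantiation automaton :: encodable begin
definition "encode = enc_automaton"
instance by standard (simp add: encode_automaton_def inj_enc_automaton)
end

lemma encode_nat [simp]: "encode (n :: nat) = n"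
  by (simp add: encode_nat_def enc_nat_def)

lemma encode_Pair [simp]: "encode (x, y) = prod_encode (encode x, encode y)"
  by (simp add: encode_prod_def enc_pair_def)

lemma encode_Nil [simp]: "encode ([] :: 'a :: encodable list) = 0"
  by (simp add: encode_list_def enc_list_def)

lemma encode_Cons [simp]:
  "encode (x # xs :: 'a :: encodable list) = Suc (prod_encode (encode x, encode xs))"
  by (simp add: encode_list_def enc_list_def)

lemma encode_ctype [simp]:
  "encode Iota = 0" "encode (Arrow \<gamma> \<delta>) = Suc (prod_encode (encode \<gamma>, encode \<delta>))"
  by (simp_all add: encode_ctype_def)

lemma encode_tm [simp]:
  "encode (Var x :: 'f :: encodable tm) = list_encode [0, x]"
  "encode (Sym f :: 'f :: encodable tm) = list_encode [1, encode f]"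
  "encode (App s t :: 'f :: encodable tm) = list_encode [2, encode s, encode t]"
  by (simp_all add: encode_tm_def)

lemma encode_goal [simp]:
  "encode GTrue = list_encode [0]"
  "encode (GAtom P s) = list_encode [1, P, encode s]"
  "encode (GAnd G H) = list_encode [2, encode G, encode H]"
  "encode (GEx x \<gamma> G) = list_encode [3, x, encode \<gamma>, encode G]"
  by (simp_all add: encode_goal_def encode_tm_def encode_nat_def encode_ctype_def)

lemma encode_clause [simp]:
  "encode (VarClause y G P) = list_encode [0, y, encode G, P]"
  "encode (ConClause c ys G P) = list_encode [1, c, encode ys, encode G, P]"
  by (simp_all add: encode_clause_def encode_list_def encode_goal_def encode_prod_def
      encode_nat_def encode_ctype_def)

lemma encode_msl [simp]:
  "encode (MSL \<Sigma> \<Pi> D G) = list_encode [encode \<Sigma>, encode \<Pi>, encode D, encode G]"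
  by (simp add: encode_msl_instance_def encode_list_def encode_prod_def encode_goal_def
      encode_nat_def encode_ctype_def encode_clause_def)

lemma encode_hsym [simp]: "encode (NT f) = list_encode [0, f]" "encode (Con a) = list_encode [1, a]"
  by (simp_all add: encode_hsym_def)

lemma encode_hors [simp]:
  "encode (HORS N C R S) = list_encode [encode N, encode C, encode R, S]"
  by (simp add: encode_hors_def encode_list_def encode_prod_def encode_tm_def
      encode_nat_def encode_ctype_def encode_hsym_def)

lemma encode_pbf [simp]:
  "encode PTrue = list_encode [0]"
  "encode PFalse = list_encode [1]"
  "encode (PAtom i q) = list_encode [2, i, q]"
  "encode (PAnd \<phi> \<psi>) = list_encode [3, encode \<phi>, encode \<psi>]"
  "encode (POr \<phi> \<psi>) = list_encode [4, encode \<phi>, encode \<psi>]"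
  by (simp_all add: encode_pbf_def)

lemma encode_automaton [simp]:
  "encode (Automaton Q q \<delta>) = list_encode [encode Q, q, encode \<delta>]"
  by (simp add: encode_automaton_def encode_list_def encode_prod_def encode_pbf_def encode_nat_def)

section \<open>Closure properties of computable functions on encoded data\<close>

definition cfun :: "('a :: encodable \<Rightarrow> 'b :: encodable) \<Rightarrow> bool" where
  "cfun f \<longleftrightarrow> (\<exists>F. computable F \<and> (\<forall>x. F (encode x) = encode (f x)))"

lemma cfunI: "computable F \<Longrightarrow> (\<And>x. F (encode x) = encode (f x)) \<Longrightarrow> cfun f"
  unfolding cfun_def by blast

text \<open>A chosen realizer turns the existential statement \<open>cfun f\<close> into a term,
  from which the realizers of compound functions are written down directly.\<close>

definition realizer :: "('a :: encodable \<Rightarrow> 'b :: encodable) \<Rightarrow> nat \<Rightarrow> nat" where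
  "realizer f = (SOME F. computable F \<and> (\<forall>x. F (encode x) = encode (f x)))"

lemma realizer:
  assumes "cfun f"
  shows computable_realizer: "computable (realizer f)"
    and realizer_encode: "realizer f (encode x) = encode (f x)"
  using someI_ex[OF assms[unfolded cfun_def]] unfolding realizer_def by blast+

lemma cfun_id: "cfun (\<lambda>x. x)"
  by (rule cfunI[OF computable_id]) simp

lemma cfun_const: "cfun (\<lambda>x. c)"
  by (rule cfunI[OF computable_const]) simp

lemma cfun_comp: "cfun f \<Longrightarrow> cfun g \<Longrightarrow> cfun (\<lambda>x. f (g x))"
  by (rule cfunI[OF computable_comp[OF realizer(1)[of f] realizer(1)[of g]]])
    (simp_all add: realizer(2))

lemma cfun_Pair: "cfun f \<Longrightarrow> cfun g \<Longrightarrow> cfun (\<lambda>x. (f x, g x))"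
  by (rule cfunI[OF computable_comp2[OF computable2_prod_encode realizer(1)[of f] realizer(1)[of g]]])
    (simp_all add: realizer(2))

lemma cfun_comp2:
  assumes "cfun (\<lambda>p. h (fst p) (snd p))" "cfun f" "cfun g"
  shows "cfun (\<lambda>x. h (f x) (g x))"
  using cfun_comp[OF assms(1) cfun_Pair[OF assms(2,3)]] by simp

lemma cfun_code:
  assumes "computable F" "\<And>x. F (encode x) = encode (f x)" "cfun g"
  shows "cfun (\<lambda>x. f (g x))"
  by (rule cfun_comp[OF cfunI[OF assms(1,2)] assms(3)])

lemma cfun_fst: "cfun f \<Longrightarrow> cfun (\<lambda>x. fst (f x))"
  by (rule cfun_code[OF computable_code_fst]) (auto simp: split_paired_all)

lemma cfun_snd: "cfun f \<Longrightarrow> cfun (\<lambda>x. snd (f x))"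
  by (rule cfun_code[OF computable_code_snd]) (auto simp: split_paired_all)

text \<open>A body with bound variables is uncurried over its context, with nested
  \<open>fst\<close> and \<open>snd\<close> in place of patterns. The premise is then again a
  composition of projections and basic operations, which rules of the same kind take apart.\<close>

lemma cfun_case_prod:
  "cfun g \<Longrightarrow> cfun (\<lambda>p. f (fst p) (fst (snd p)) (snd (snd p))) \<Longrightarrow>
    cfun (\<lambda>x. case g x of (a, b) \<Rightarrow> f x a b)"
  using cfun_comp2[of "\<lambda>x y. f x (fst y) (snd y)" "\<lambda>x. x" g] cfun_id
  by (simp add: case_prod_beta)

lemma cfun_encode: "cfun f \<Longrightarrow> cfun (\<lambda>x. encode (f x))"
  by (rule cfun_code[OF computable_id]) simp_all

lemma cfun_prod_encode: "cfun f \<Longrightarrow> cfun g \<Longrightarrow> cfun (\<lambda>x. prod_encode (f x, g x))"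
  using cfun_encode[OF cfun_Pair[of f g]] by simp

lemma encode_nat_pair: "encode (p :: nat \<times> nat) = prod_encode p"
  by (cases p) simp

text \<open>A pair of numbers is encoded by \<open>prod_encode\<close> itself, so decoding does not
  change the code and is realized by the identity.\<close>

lemma cfun_prod_decode: "cfun f \<Longrightarrow> cfun (\<lambda>x. prod_decode (f x))"
  by (rule cfun_code[OF computable_id]) (simp_all add: encode_nat_pair)

lemma cfun_Suc: "cfun f \<Longrightarrow> cfun (\<lambda>x. Suc (f x))"
  by (rule cfun_code[OF computable_Suc]) simp_all

lemma cfun_diff: "cfun f \<Longrightarrow> cfun g \<Longrightarrow> cfun (\<lambda>x. f x - g x :: nat)"
  by (rule cfunI[OF computable_comp2[OF computable2_diff realizer(1)[of f] realizer(1)[of g]]])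
    (simp_all add: realizer(2))

lemma cfun_if: "cfun P \<Longrightarrow> cfun a \<Longrightarrow> cfun b \<Longrightarrow> cfun (\<lambda>x. if P x then a x else b x)"
  by (rule cfunI[OF computable_if[OF realizer(1)[of P] realizer(1)[of b] realizer(1)[of a]]])
    (simp_all add: realizer(2) encode_bool_def)

lemma cfun_eq: "cfun f \<Longrightarrow> cfun g \<Longrightarrow> cfun (\<lambda>x. f x = g x)"
  by (rule cfunI[OF computable_eq_if[OF realizer(1)[of f] realizer(1)[of g]
        computable_const[of 1] computable_const[of 0]]])
    (simp_all add: realizer(2) encode_bool_def)

lemma cfun_conj: "cfun P \<Longrightarrow> cfun Q \<Longrightarrow> cfun (\<lambda>x. P x \<and> Q x)"
proof -
  assume "cfun P" "cfun Q"
  then have "cfun (\<lambda>x. if P x then Q x else False)"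
    by (intro cfun_if cfun_const)
  moreover have "(if P x then Q x else False) = (P x \<and> Q x)" for x
    by simp
  ultimately show ?thesis by simp
qed

lemma cfun_not: "cfun P \<Longrightarrow> cfun (\<lambda>x. \<not> P x)"
  using cfun_eq[of P "\<lambda>x. False"] by (simp add: cfun_const)

lemma cfun_le: "cfun f \<Longrightarrow> cfun g \<Longrightarrow> cfun (\<lambda>x. f x \<le> (g x :: nat))"
  using cfun_eq[OF cfun_diff[of f g] cfun_const[of 0]] by simp

lemma cfun_rec_nat:
  assumes "cfun (\<lambda>p. s (fst p) (fst (snd p)) (snd (snd p)))" (is "cfun ?s") "cfun a" "cfun n"
  shows "cfun (\<lambda>x. rec_nat (a x) (s x) (n x))"
proof (rule cfunI[OF computable_rec_nat[OF realizer(1)[OF assms(1)] realizer(1)[OF assms(2)]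
      realizer(1)[OF assms(3)]]])
  have step: "realizer ?s (prod_encode (encode x, prod_encode (k, encode v))) = encode (s x k v)" for x k v
    using realizer(2)[OF assms(1), of "(x, k, v)"] by simp
  have "rec_nat (encode (a x)) (\<lambda>k v. realizer ?s (prod_encode (encode x, prod_encode (k, v)))) m
      = encode (rec_nat (a x) (s x) m)" for x m
    by (induction m) (simp_all add: step)
  then show "rec_nat (realizer a (encode x))
      (\<lambda>k v. realizer ?s (prod_encode (encode x, prod_encode (k, v)))) (realizer n (encode x))
      = encode (rec_nat (a x) (s x) (n x))" for x
    by (simp add: realizer(2) assms)
qed

lemma cfun_funpow:
  fixes s :: "'a :: encodable \<Rightarrow> 'b :: encodable \<Rightarrow> 'b"
  assumes "cfun (\<lambda>p. s (fst p) (snd p))" "cfun a" "cfun n"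
  shows "cfun (\<lambda>x. (s x ^^ n x) (a x))"
proof -
  have "rec_nat a (\<lambda>k v. s v) m = (s ^^ m) a" for a and s :: "'b \<Rightarrow> 'b" and m
    by (induction m) auto
  moreover have "cfun (\<lambda>x. rec_nat (a x) (\<lambda>k v. s x v) (n x))"
    by (intro cfun_rec_nat assms cfun_comp2[of s, OF assms(1)] cfun_fst cfun_snd cfun_id)
  ultimately show ?thesis by simp
qed

section \<open>List operations\<close>

lemma cfun_Cons: "cfun f \<Longrightarrow> cfun g \<Longrightarrow> cfun (\<lambda>x. f x # g x)"
  by (rule cfunI[OF computable_Suc_prod_encode[OF realizer(1)[of f] realizer(1)[of g]]])
    (simp_all add: realizer(2))

lemma length_le_encode: "length xs \<le> encode xs"
  by (induction xs) (auto intro: order_trans[OF _ le_prod_encode_2])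

text \<open>A loop on the pair of remaining list and accumulator. It runs for as many rounds as the
  code of the list, a number that bounds the length and is at hand; surplus rounds find an empty
  list and change nothing.\<close>

lemma cfun_foldl:
  assumes "cfun (\<lambda>p. h (fst p) (fst (snd p)) (snd (snd p)))" (is "cfun ?h") "cfun a" "cfun g"
  shows "cfun (\<lambda>x. foldl (h x) (a x) (g x))"
proof -
  have h: "realizer ?h (prod_encode (encode x, prod_encode (encode k, encode v))) = encode (h x k v)" for x k v
    using realizer(2)[OF assms(1), of "(x, k, v)"] by simp
  define s where "s = (\<lambda>z. if code_fst (code_snd (code_snd z)) = 0 then code_snd (code_snd z)
    else prod_encode (code_tl (code_fst (code_snd (code_snd z))),
      realizer ?h (prod_encode (code_fst z, prod_encode (code_snd (code_snd (code_snd z)),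
        code_hd (code_fst (code_snd (code_snd z))))))))"
  have s: "computable s"
    unfolding s_def
    by (intro computable_if computable_comp[OF realizer(1)[OF assms(1)]] computable_intros)
  have step: "s (prod_encode (encode x, prod_encode (k, prod_encode (encode xs, encode acc))))
    = (case xs of [] \<Rightarrow> prod_encode (0, encode acc)
       | y # ys \<Rightarrow> prod_encode (encode ys, encode (h x acc y)))" for x k xs acc
    by (cases xs) (simp_all add: s_def h)
  have loop: "rec_nat (prod_encode (encode xs, encode acc))
        (\<lambda>k v. s (prod_encode (encode x, prod_encode (k, v)))) m
      = prod_encode (encode (drop m xs), encode (foldl (h x) acc (take m xs)))" for m x xs acc
  proof (induction m)
    case (Suc m)
    show ?case
    proof (cases "m < length xs")
      case True
      then have "drop m xs = xs ! m # drop (Suc m) xs" "take (Suc m) xs = take m xs @ [xs ! m]"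
        by (simp_all add: Cons_nth_drop_Suc take_Suc_conv_app_nth)
      with Suc step[of x m "drop m xs" "foldl (h x) acc (take m xs)"] show ?thesis by simp
    qed (use Suc step[of x m "[]"] in simp)
  qed simp
  show ?thesis
  proof (rule cfunI)
    show "computable (\<lambda>e. code_snd (rec_nat (prod_encode (realizer g e, realizer a e))
        (\<lambda>k v. s (prod_encode (e, prod_encode (k, v)))) (realizer g e)))"
      by (intro computable_rec_nat computable_intros s realizer(1) assms)
    show "code_snd (rec_nat (prod_encode (realizer g (encode x), realizer a (encode x)))
        (\<lambda>k v. s (prod_encode (encode x, prod_encode (k, v)))) (realizer g (encode x)))
      = encode (foldl (h x) (a x) (g x))" for x
      by (simp add: realizer(2) assms loop length_le_encode)
  qed
qed

lemma cfun_rev: "cfun g \<Longrightarrow> cfun (\<lambda>x. rev (g x))"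
proof -
  assume "cfun g"
  then have "cfun (\<lambda>x. foldl (\<lambda>acc y. y # acc) [] (g x))"
    by (intro cfun_foldl cfun_Cons cfun_fst cfun_snd cfun_id cfun_const)
  moreover have "foldl (\<lambda>acc y. y # acc) acc ys = rev ys @ acc" for acc ys :: "'b list"
    by (induction ys arbitrary: acc) auto
  ultimately show ?thesis by simp
qed

lemma cfun_foldr:
  assumes "cfun (\<lambda>p. h (fst p) (fst (snd p)) (snd (snd p)))" "cfun a" "cfun g"
  shows "cfun (\<lambda>x. foldr (h x) (g x) (a x))"
proof -
  have "cfun (\<lambda>x. foldl (\<lambda>acc y. h x y acc) (a x) (rev (g x)))"
    using cfun_comp[OF assms(1), of "\<lambda>p. (fst p, snd (snd p), fst (snd p))"]
    by (intro cfun_foldl cfun_rev assms) (simp add: cfun_Pair cfun_fst cfun_snd cfun_id)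
  then show ?thesis by (simp add: foldl_conv_foldr)
qed

lemma cfun_append: "cfun f \<Longrightarrow> cfun g \<Longrightarrow> cfun (\<lambda>x. f x @ g x)"
proof -
  assume "cfun f" "cfun g"
  then have "cfun (\<lambda>x. foldr (#) (f x) (g x))"
    by (intro cfun_foldr cfun_Cons cfun_fst cfun_snd cfun_id)
  moreover have "foldr (#) xs ys = xs @ ys" for xs ys :: "'b list"
    by (induction xs) auto
  ultimately show ?thesis by simp
qed

lemma cfun_map:
  assumes "cfun (\<lambda>p. f (fst p) (snd p))" "cfun g"
  shows "cfun (\<lambda>x. map (f x) (g x))"
proof -
  have "cfun (\<lambda>x. foldr (\<lambda>y acc. f x y # acc) (g x) [])"
    by (intro cfun_foldr cfun_Cons cfun_comp2[of f, OF assms(1)] cfun_fst cfun_snd cfun_id cfun_const assms)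
  moreover have "foldr (\<lambda>y acc. f x y # acc) ys [] = map (f x) ys" for x ys
    by (induction ys) auto
  ultimately show ?thesis by simp
qed

lemma cfun_concat: "cfun f \<Longrightarrow> cfun (\<lambda>x. concat (f x))"
  unfolding concat_conv_foldr by (intro cfun_foldr cfun_append cfun_fst cfun_snd cfun_id cfun_const)

lemma cfun_filter:
  assumes "cfun (\<lambda>p. P (fst p) (snd p))" "cfun g"
  shows "cfun (\<lambda>x. filter (P x) (g x))"
proof -
  have "cfun (\<lambda>x. foldr (\<lambda>y acc. if P x y then y # acc else acc) (g x) [])"
    by (intro cfun_foldr cfun_if cfun_Cons cfun_comp2[of P, OF assms(1)] cfun_fst cfun_snd cfun_id
        cfun_const assms)
  moreover have "foldr (\<lambda>y acc. if P x y then y # acc else acc) ys [] = filter (P x) ys" for x ys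
    by (induction ys) auto
  ultimately show ?thesis by simp
qed

lemma cfun_member: "cfun f \<Longrightarrow> cfun g \<Longrightarrow> cfun (\<lambda>x. f x \<in> set (g x))"
proof -
  assume f: "cfun f" and "cfun g"
  then have "cfun (\<lambda>x. foldr (\<lambda>y b. if y = f x then True else b) (g x) False)"
    by (intro cfun_foldr cfun_if cfun_eq cfun_comp[OF f] cfun_fst cfun_snd cfun_id cfun_const)
  moreover have "foldr (\<lambda>y b. if y = a then True else b) ys False \<longleftrightarrow> a \<in> set ys" for a and ys :: "'b list"
    by (induction ys) auto
  ultimately show ?thesis by simp
qed

lemma cfun_remdups: "cfun f \<Longrightarrow> cfun (\<lambda>x. remdups (f x))"
proof -
  assume "cfun f"
  then have "cfun (\<lambda>x. foldr (\<lambda>y acc. if y \<in> set acc then acc else y # acc) (f x) [])"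
    by (intro cfun_foldr cfun_if cfun_member cfun_Cons cfun_fst cfun_snd cfun_id cfun_const)
  moreover have "foldr (\<lambda>y acc. if y \<in> set acc then acc else y # acc) ys [] = remdups ys" for ys :: "'b list"
    by (induction ys) auto
  ultimately show ?thesis by simp
qed

lemma cfun_upt: "cfun f \<Longrightarrow> cfun (\<lambda>x. [0..<f x])"
proof -
  assume "cfun f"
  then have "cfun (\<lambda>x. rec_nat [] (\<lambda>k acc. acc @ [k]) (f x))"
    by (intro cfun_rec_nat cfun_append cfun_Cons cfun_fst cfun_snd cfun_id cfun_const)
  moreover have "rec_nat [] (\<lambda>k acc. acc @ [k]) n = [0..<n]" for n
    by (induction n) auto
  ultimately show ?thesis by simp
qed

section \<open>Constructors, selectors and case distinctions of the syntax\<close>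

lemma cfun_case_ctype:
  assumes "cfun g" "cfun a" "cfun (\<lambda>p. b (fst p) (fst (snd p)) (snd (snd p)))" (is "cfun ?b")
  shows "cfun (\<lambda>x. case g x of Iota \<Rightarrow> a x | Arrow \<gamma> \<delta> \<Rightarrow> b x \<gamma> \<delta>)"
proof (rule cfunI)
  show "computable (\<lambda>e. if realizer g e = 0 then realizer a e
      else realizer ?b (prod_encode (e, prod_encode (code_hd (realizer g e), code_tl (realizer g e)))))"
    by (intro computable_if computable_comp[OF realizer(1)[OF assms(3)]] computable_intros
        realizer(1) assms(1,2))
  show "(if realizer g (encode x) = 0 then realizer a (encode x)
      else realizer ?b (prod_encode (encode x,
        prod_encode (code_hd (realizer g (encode x)), code_tl (realizer g (encode x))))))
    = encode (case g x of Iota \<Rightarrow> a x | Arrow \<gamma> \<delta> \<Rightarrow> b x \<gamma> \<delta>)" for x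
    using realizer(2)[OF assms(3), of "(x, \<gamma>, \<delta>)" for \<gamma> \<delta>]
    by (auto simp: realizer(2) assms split: ctype.split)
qed

lemma cfun_field:
  assumes "\<And>x. encode (h x) = code_nth (encode x) i" "cfun f"
  shows "cfun (\<lambda>x. h (f x))"
  by (rule cfun_code[OF computable_code_nth[OF computable_id computable_const, of i] assms(1)[symmetric] assms(2)])

text \<open>Outside \<open>ctype\<close>, a constructor application is encoded as the list of its
  tag and the codes of its arguments, or of the codes alone for the instance records. Computability
  of the constructor is therefore that of a list of numbers.\<close>

lemma cfun_same_code: "cfun k \<Longrightarrow> (\<And>x. encode (h x) = encode (k x)) \<Longrightarrow> cfun h"
  unfolding cfun_def by simp

lemma cfun_Arrow: "cfun f \<Longrightarrow> cfun g \<Longrightarrow> cfun (\<lambda>x. Arrow (f x) (g x))"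
proof (rule cfun_same_code)
  assume "cfun f" "cfun g"
  then show "cfun (\<lambda>x. Suc (encode (f x, g x)))"
    by (intro cfun_Suc cfun_encode cfun_Pair)
qed simp

lemma cfun_Var: "cfun i \<Longrightarrow> cfun (\<lambda>x. Var (i x) :: 'f :: encodable tm)"
  by (rule cfun_same_code[of "\<lambda>x. [0, i x]"]) (auto intro!: cfun_Cons cfun_const)

lemma cfun_Sym: "cfun c \<Longrightarrow> cfun (\<lambda>x. Sym (c x))"
  by (rule cfun_same_code[of "\<lambda>x. [1, encode (c x)]"])
    (auto intro!: cfun_encode cfun_Cons cfun_const)

lemma cfun_App: "cfun s \<Longrightarrow> cfun t \<Longrightarrow> cfun (\<lambda>x. App (s x) (t x))"
  by (rule cfun_same_code[of "\<lambda>x. [2, encode (s x), encode (t x)]"])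
    (auto intro!: cfun_encode cfun_Cons cfun_const)

lemma cfun_NT: "cfun f \<Longrightarrow> cfun (\<lambda>x. NT (f x))"
  by (rule cfun_same_code[of "\<lambda>x. [0, f x]"]) (auto intro!: cfun_Cons cfun_const)

lemma cfun_Con: "cfun f \<Longrightarrow> cfun (\<lambda>x. Con (f x))"
  by (rule cfun_same_code[of "\<lambda>x. [1, f x]"]) (auto intro!: cfun_Cons cfun_const)

lemma cfun_GAtom: "cfun P \<Longrightarrow> cfun s \<Longrightarrow> cfun (\<lambda>x. GAtom (P x) (s x))"
  by (rule cfun_same_code[of "\<lambda>x. [1, P x, encode (s x)]"])
    (auto intro!: cfun_encode cfun_Cons cfun_const)

lemma cfun_GAnd: "cfun G \<Longrightarrow> cfun H \<Longrightarrow> cfun (\<lambda>x. GAnd (G x) (H x))"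
  by (rule cfun_same_code[of "\<lambda>x. [2, encode (G x), encode (H x)]"])
    (auto intro!: cfun_encode cfun_Cons cfun_const)

lemma cfun_ConClause:
  "cfun c \<Longrightarrow> cfun ys \<Longrightarrow> cfun G \<Longrightarrow> cfun P \<Longrightarrow> cfun (\<lambda>x. ConClause (c x) (ys x) (G x) (P x))"
  by (rule cfun_same_code[of "\<lambda>x. [1, c x, encode (ys x), encode (G x), P x]"])
    (auto intro!: cfun_encode cfun_Cons cfun_const)

lemma cfun_PAtom: "cfun i \<Longrightarrow> cfun q \<Longrightarrow> cfun (\<lambda>x. PAtom (i x) (q x))"
  by (rule cfun_same_code[of "\<lambda>x. [2, i x, q x]"]) (auto intro!: cfun_Cons cfun_const)

lemma cfun_PAnd: "cfun G \<Longrightarrow> cfun H \<Longrightarrow> cfun (\<lambda>x. PAnd (G x) (H x))"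
  by (rule cfun_same_code[of "\<lambda>x. [3, encode (G x), encode (H x)]"])
    (auto intro!: cfun_encode cfun_Cons cfun_const)

lemma cfun_POr: "cfun G \<Longrightarrow> cfun H \<Longrightarrow> cfun (\<lambda>x. POr (G x) (H x))"
  by (rule cfun_same_code[of "\<lambda>x. [4, encode (G x), encode (H x)]"])
    (auto intro!: cfun_encode cfun_Cons cfun_const)

lemma cfun_MSL:
  "cfun f \<Longrightarrow> cfun g \<Longrightarrow> cfun h \<Longrightarrow> cfun k \<Longrightarrow> cfun (\<lambda>x. MSL (f x) (g x) (h x) (k x))"
  by (rule cfun_same_code[of "\<lambda>x. [encode (f x), encode (g x), encode (h x), encode (k x)]"])
    (auto intro!: cfun_encode cfun_Cons cfun_const)

lemma cfun_HORS:
  "cfun f \<Longrightarrow> cfun g \<Longrightarrow> cfun h \<Longrightarrow> cfun k \<Longrightarrow> cfun (\<lambda>x. HORS (f x) (g x) (h x) (k x))"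
  by (rule cfun_same_code[of "\<lambda>x. [encode (f x), encode (g x), encode (h x), k x]"])
    (auto intro!: cfun_encode cfun_Cons cfun_const)

lemma cfun_Automaton:
  "cfun f \<Longrightarrow> cfun g \<Longrightarrow> cfun h \<Longrightarrow> cfun (\<lambda>x. Automaton (f x) (g x) (h x))"
  by (rule cfun_same_code[of "\<lambda>x. [encode (f x), g x, encode (h x)]"])
    (auto intro!: cfun_encode cfun_Cons cfun_const)

lemma cfun_msl_select:
  assumes "cfun f"
  shows "cfun (\<lambda>x. signature (f x))" "cfun (\<lambda>x. predicates (f x))" "cfun (\<lambda>x. definite (f x))"
    "cfun (\<lambda>x. query (f x))"
proof -
  have "encode (signature I) = code_nth (encode I) 0" "encode (predicates I) = code_nth (encode I) 1"
    "encode (definite I) = code_nth (encode I) 2" "encode (query I) = code_nth (encode I) 3" for I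
    by (cases I; simp del: list_encode.simps)+
  from this[THEN cfun_field, OF assms]
  show "cfun (\<lambda>x. signature (f x))" "cfun (\<lambda>x. predicates (f x))" "cfun (\<lambda>x. definite (f x))"
    "cfun (\<lambda>x. query (f x))" .
qed

lemma cfun_hors_select:
  assumes "cfun f"
  shows "cfun (\<lambda>x. nonterminals (f x))" "cfun (\<lambda>x. constants (f x))" "cfun (\<lambda>x. rules (f x))"
    "cfun (\<lambda>x. start (f x))"
proof -
  have "encode (nonterminals I) = code_nth (encode I) 0" "encode (constants I) = code_nth (encode I) 1"
    "encode (rules I) = code_nth (encode I) 2" "encode (start I) = code_nth (encode I) 3" for I
    by (cases I; simp del: list_encode.simps)+
  from this[THEN cfun_field, OF assms]
  show "cfun (\<lambda>x. nonterminals (f x))" "cfun (\<lambda>x. constants (f x))" "cfun (\<lambda>x. rules (f x))"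
    "cfun (\<lambda>x. start (f x))" .
qed

lemma cfun_automaton_select:
  assumes "cfun f"
  shows "cfun (\<lambda>x. states (f x))" "cfun (\<lambda>x. initial (f x))" "cfun (\<lambda>x. transitions (f x))"
proof -
  have "encode (states I) = code_nth (encode I) 0" "encode (initial I) = code_nth (encode I) 1"
    "encode (transitions I) = code_nth (encode I) 2" for I
    by (cases I; simp del: list_encode.simps)+
  from this[THEN cfun_field, OF assms]
  show "cfun (\<lambda>x. states (f x))" "cfun (\<lambda>x. initial (f x))" "cfun (\<lambda>x. transitions (f x))" .
qed

lemma cfun_case_goal:
  assumes "cfun g" "cfun a"
    "cfun (\<lambda>p. b (fst p) (fst (snd p)) (snd (snd p)))" (is "cfun ?b")
    "cfun (\<lambda>p. c (fst p) (fst (snd p)) (snd (snd p)))" (is "cfun ?c")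
    "cfun (\<lambda>p. d (fst p) (fst (snd p)) (fst (snd (snd p))) (snd (snd (snd p))))" (is "cfun ?d")
  shows "cfun (\<lambda>x. case g x of GTrue \<Rightarrow> a x | GAtom P s \<Rightarrow> b x P s | GAnd G H \<Rightarrow> c x G H
    | GEx y \<gamma> G \<Rightarrow> d x y \<gamma> G)" (is "cfun ?h")
proof (rule cfunI)
  let ?F = "\<lambda>e. if code_nth (realizer g e) 0 = 0 then realizer a e
    else if code_nth (realizer g e) 0 = 1 then
      realizer ?b (prod_encode (e, prod_encode (code_nth (realizer g e) 1, code_nth (realizer g e) 2)))
    else if code_nth (realizer g e) 0 = 2 then
      realizer ?c (prod_encode (e, prod_encode (code_nth (realizer g e) 1, code_nth (realizer g e) 2)))
    else realizer ?d (prod_encode (e, prod_encode (code_nth (realizer g e) 1,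
      prod_encode (code_nth (realizer g e) 2, code_nth (realizer g e) 3))))"
  show "computable ?F"
    by (intro computable_eq_if computable_comp[OF realizer(1)[OF assms(3)]]
        computable_comp[OF realizer(1)[OF assms(4)]] computable_comp[OF realizer(1)[OF assms(5)]]
        computable_intros computable_code_nth realizer(1) assms(1,2))
  show "?F (encode x) = encode (?h x)" for x
    using realizer(2)[OF assms(3), of "(x, P, s)" for P s]
      realizer(2)[OF assms(4), of "(x, G, H)" for G H]
      realizer(2)[OF assms(5), of "(x, y, \<gamma>, G)" for y \<gamma> G]
    by (auto simp: realizer(2) assms simp del: list_encode.simps split: goal.split)
qed

lemma cfun_case_clause:
  assumes "cfun g"
    "cfun (\<lambda>p. b (fst p) (fst (snd p)) (fst (snd (snd p))) (snd (snd (snd p))))" (is "cfun ?b")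
    "cfun (\<lambda>p. c (fst p) (fst (snd p)) (fst (snd (snd p))) (fst (snd (snd (snd p))))
      (snd (snd (snd (snd p)))))" (is "cfun ?c")
  shows "cfun (\<lambda>x. case g x of VarClause y G P \<Rightarrow> b x y G P | ConClause f ys G P \<Rightarrow> c x f ys G P)"
    (is "cfun ?h")
proof (rule cfunI)
  let ?F = "\<lambda>e. if code_nth (realizer g e) 0 = 0 then
      realizer ?b (prod_encode (e, prod_encode (code_nth (realizer g e) 1,
        prod_encode (code_nth (realizer g e) 2, code_nth (realizer g e) 3))))
    else realizer ?c (prod_encode (e, prod_encode (code_nth (realizer g e) 1,
      prod_encode (code_nth (realizer g e) 2, prod_encode (code_nth (realizer g e) 3, code_nth (realizer g e) 4)))))"
  show "computable ?F"
    by (intro computable_eq_if computable_comp[OF realizer(1)[OF assms(2)]]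
        computable_comp[OF realizer(1)[OF assms(3)]]
        computable_intros computable_code_nth realizer(1) assms(1))
  show "?F (encode x) = encode (?h x)" for x
    using realizer(2)[OF assms(2), of "(x, y, G, P)" for y G P]
      realizer(2)[OF assms(3), of "(x, f, ys, G, P)" for f ys G P]
    by (auto simp: realizer(2) assms simp del: list_encode.simps split: clause.split)
qed

lemma cfun_case_pbf:
  assumes "cfun g" "cfun a" "cfun a'"
    "cfun (\<lambda>p. b (fst p) (fst (snd p)) (snd (snd p)))" (is "cfun ?b")
    "cfun (\<lambda>p. c (fst p) (fst (snd p)) (snd (snd p)))" (is "cfun ?c")
    "cfun (\<lambda>p. d (fst p) (fst (snd p)) (snd (snd p)))" (is "cfun ?d")
  shows "cfun (\<lambda>x. case g x of PTrue \<Rightarrow> a x | PFalse \<Rightarrow> a' x | PAtom i q \<Rightarrow> b x i q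
    | PAnd \<phi> \<psi> \<Rightarrow> c x \<phi> \<psi> | POr \<phi> \<psi> \<Rightarrow> d x \<phi> \<psi>)" (is "cfun ?h")
proof (rule cfunI)
  let ?F = "\<lambda>e. if code_nth (realizer g e) 0 = 0 then realizer a e
    else if code_nth (realizer g e) 0 = 1 then realizer a' e
    else if code_nth (realizer g e) 0 = 2 then
      realizer ?b (prod_encode (e, prod_encode (code_nth (realizer g e) 1, code_nth (realizer g e) 2)))
    else if code_nth (realizer g e) 0 = 3 then
      realizer ?c (prod_encode (e, prod_encode (code_nth (realizer g e) 1, code_nth (realizer g e) 2)))
    else
      realizer ?d (prod_encode (e, prod_encode (code_nth (realizer g e) 1, code_nth (realizer g e) 2)))"
  show "computable ?F"
    by (intro computable_eq_if computable_comp[OF realizer(1)[OF assms(4)]]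
        computable_comp[OF realizer(1)[OF assms(5)]] computable_comp[OF realizer(1)[OF assms(6)]]
        computable_intros computable_code_nth realizer(1) assms(1-3))
  show "?F (encode x) = encode (?h x)" for x
    using realizer(2)[OF assms(4), of "(x, i, q)" for i q]
      realizer(2)[OF assms(5), of "(x, \<phi>, \<psi>)" for \<phi> \<psi>]
      realizer(2)[OF assms(6), of "(x, \<phi>, \<psi>)" for \<phi> \<psi>]
    by (auto simp: realizer(2) assms simp del: list_encode.simps split: pbf.split)
qed

section \<open>Recursion over terms and closure under subexpressions\<close>

lemma encode_App_gt: "encode s < encode (App s t)" "encode t < encode (App s t)"
proof -
  have "n < Suc (prod_encode (m, k))" if "n \<le> k" for n m k
    using that le_prod_encode_2[of k m] by simp
  moreover have "n < Suc (prod_encode (n, k))" for n k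
    using le_prod_encode_1[of n k] by simp
  ultimately show "encode s < encode (App s t)" "encode t < encode (App s t)"
    by (metis encode_tm(3) less_imp_le_nat list_encode.simps(2))+
qed

text \<open>Both immediate subterms of an application have smaller codes, so their values stand in
  the history of a course-of-values recursion. \<open>?rec i\<close> looks up the value at the code
  in field \<open>i\<close>; the history lists the latest value first, whence the subtraction.
  Variables keep their code, which does not depend on the type of symbols.\<close>

lemma cfun_map_tm:
  assumes "cfun f" "cfun g"
  shows "cfun (\<lambda>x. map_tm f (g x))"
proof (rule cfun_code[OF computable_course_rec _ assms(2)])
  let ?rec = "\<lambda>i z. code_nth (code_snd z) (code_fst z - Suc (code_nth (code_fst z) i))"
  let ?s = "\<lambda>z. if code_nth (code_fst z) 0 = 0 then code_fst z
    else if code_nth (code_fst z) 0 = 1 then list_encode [1, realizer f (code_nth (code_fst z) 1)]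
    else list_encode [2, ?rec 1 z, ?rec 2 z]"
  show "computable ?s"
    unfolding list_encode.simps
    by (intro computable_eq_if computable_code_nth computable_intros computable_comp2[OF computable2_diff]
        computable_comp[OF computable_Suc] computable_comp[OF realizer(1)[OF assms(1)]])
  show "course_rec ?s (encode t) = encode (map_tm f t)" for t
  proof (induction t)
    case (App t u)
    have "?rec 1 (prod_encode (encode (App t u), list_encode (history ?s (encode (App t u)))))
        = encode (map_tm f t)"
      using history_nth[OF encode_App_gt(1)[of t u], of ?s] App encode_App_gt(1)[of t u]
      by (simp del: list_encode.simps history.simps)
    moreover have "?rec 2 (prod_encode (encode (App t u), list_encode (history ?s (encode (App t u)))))
        = encode (map_tm f u)"
      using history_nth[OF encode_App_gt(2)[of u t], of ?s] App encode_App_gt(2)[of u t]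
      by (simp del: list_encode.simps history.simps)
    ultimately show ?case
      by (simp add: course_rec_def del: list_encode.simps history.simps)
  qed (simp_all add: course_rec_def realizer(2) assms del: list_encode.simps)
qed

text \<open>
  If \<open>f\<close> decreases a rank that is bounded by the code, then \<open>Suc (encode x)\<close> rounds reach all
  descendants of \<open>x\<close>.
\<close>

definition saturate :: "('a :: encodable \<Rightarrow> 'a list) \<Rightarrow> 'a \<Rightarrow> 'a list" where
  "saturate f x = ((\<lambda>ys. ys @ concat (map f ys)) ^^ Suc (encode x)) [x]"

lemma cfun_saturate: "cfun f \<Longrightarrow> cfun g \<Longrightarrow> cfun (\<lambda>x. saturate f (g x))"
  unfolding saturate_def
  by (intro cfun_funpow cfun_append cfun_concat cfun_map cfun_Suc cfun_encode cfun_Cons cfun_const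
      cfun_comp[of f "\<lambda>p. snd p"] cfun_snd cfun_id)

lemma saturate_self: "x \<in> set (saturate f x)"
proof -
  have "x \<in> set (((\<lambda>ys. ys @ concat (map f ys)) ^^ n) [x])" for n
    by (induction n) auto
  then show ?thesis by (simp add: saturate_def)
qed

text \<open>After \<open>n\<close> rounds, an element whose children are still missing has rank at
  most \<open>encode x - n\<close>: such an element entered in the latest round as a child of one
  whose children were missing before, and the rank drops from parent to child. After
  \<open>Suc (encode x)\<close> rounds no such element is left.\<close>

lemma saturate_step:
  assumes rank: "\<And>y z. z \<in> set (f y) \<Longrightarrow> rank z < (rank y :: nat)" "rank x \<le> encode x"
    and "y \<in> set (saturate f x)" "z \<in> set (f y)"
  shows "z \<in> set (saturate f x)"
proof -
  define L where "L n = ((\<lambda>ys. ys @ concat (map f ys)) ^^ n) [x]" for n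
  have L_Suc: "set (L (Suc n)) = set (L n) \<union> (\<Union>y \<in> set (L n). set (f y))" for n
    by (simp add: L_def)
  have "\<forall>y \<in> set (L n). set (f y) \<subseteq> set (L n) \<or> rank y + n \<le> encode x" for n
  proof (induction n)
    case 0
    then show ?case using rank(2) by (simp add: L_def)
  next
    case (Suc n)
    show ?case
    proof
      fix y assume "y \<in> set (L (Suc n))"
      then consider "y \<in> set (L n)" | z where "z \<in> set (L n)" "y \<in> set (f z)" "y \<notin> set (L n)"
        by (auto simp: L_Suc)
      then show "set (f y) \<subseteq> set (L (Suc n)) \<or> rank y + Suc n \<le> encode x"
      proof cases
        case 2
        with Suc have "rank z + n \<le> encode x" by blast
        with rank(1)[OF 2(2)] show ?thesis by simp
      qed (auto simp: L_Suc)
    qed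
  qed
  from this[of "Suc (encode x)"] assms(3,4) show ?thesis
    by (auto simp: saturate_def L_def)
qed

lemma saturate_induct [consumes 1, case_names base step]:
  assumes "y \<in> set (saturate f x)" "P x" "\<And>y z. P y \<Longrightarrow> z \<in> set (f y) \<Longrightarrow> P z"
  shows "P y"
proof -
  have "\<forall>y \<in> set (((\<lambda>ys. ys @ concat (map f ys)) ^^ n) [x]). P y" for n
    by (induction n) (use assms(2,3) in auto)
  with assms(1) show ?thesis unfolding saturate_def by blast
qed

lemmas cfun_intros =
  cfun_id cfun_const cfun_fst cfun_snd cfun_Pair cfun_case_prod cfun_Suc cfun_encode
  cfun_prod_encode cfun_prod_decode cfun_if cfun_eq cfun_conj cfun_not cfun_le
  cfun_Cons cfun_rev cfun_append cfun_map cfun_concat cfun_filter cfun_member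
  cfun_remdups cfun_upt cfun_foldr cfun_foldl
  cfun_Arrow cfun_Var cfun_Sym cfun_App cfun_NT cfun_Con cfun_GAtom cfun_GAnd cfun_ConClause cfun_PAtom cfun_PAnd cfun_POr
  cfun_MSL cfun_HORS cfun_Automaton cfun_msl_select cfun_hors_select cfun_automaton_select
  cfun_case_ctype cfun_case_goal cfun_case_clause cfun_case_pbf

section \<open>Head reduction and acceptance\<close>

lemma apps_Nil [simp]: "apps t [] = t"
  by (simp add: apps_def)

lemma apps_snoc [simp]: "apps t (ts @ [u]) = App (apps t ts) u"
  by (simp add: apps_def)

lemma apps_append: "apps t (ts @ us) = apps (apps t ts) us"
  by (simp add: apps_def)

lemma apps_Cons: "apps t (u # us) = apps (App t u) us"
  by (simp add: apps_def)

lemma apps_Sym_eq_iff [simp]: "apps (Sym f) ts = apps (Sym g) us \<longleftrightarrow> f = g \<and> ts = us"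
proof (induction ts arbitrary: us rule: rev_induct)
  case Nil
  then show ?case by (cases us rule: rev_cases) auto
next
  case (snoc t ts)
  then show ?case by (cases us rule: rev_cases) auto
qed

lemma subst_apps [simp]: "subst \<sigma> (apps t ts) = apps (subst \<sigma> t) (map (subst \<sigma>) ts)"
  by (induction ts rule: rev_induct) auto

inductive head_step :: "hors \<Rightarrow> hsym tm \<Rightarrow> hsym tm \<Rightarrow> bool" for \<G> where
  unfold: "\<lbrakk>(f, ys, b) \<in> set (rules \<G>); length ss = length ys\<rbrakk>
     \<Longrightarrow> head_step \<G> (apps (Sym (NT f)) ss) (subst (map_of (zip ys ss)) b)"
| App: "head_step \<G> s s' \<Longrightarrow> head_step \<G> (App s t) (App s' t)"

lemma head_step_rewrite: "head_step \<G> s t \<Longrightarrow> rewrite \<G> s t"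
  by (induction rule: head_step.induct) (auto intro: rewrite.intros)

lemma head_step_apps: "head_step \<G> s s' \<Longrightarrow> head_step \<G> (apps s ts) (apps s' ts)"
  by (induction ts rule: rev_induct) (auto intro: head_step.App)

lemma head_step_iff:
  "head_step \<G> t t' \<longleftrightarrow> (\<exists>f ys b ss us. (f, ys, b) \<in> set (rules \<G>) \<and> length ss = length ys \<and>
     t = apps (Sym (NT f)) (ss @ us) \<and> t' = apps (subst (map_of (zip ys ss)) b) us)"
proof
  assume "head_step \<G> t t'"
  then show "\<exists>f ys b ss us. (f, ys, b) \<in> set (rules \<G>) \<and> length ss = length ys \<and>
     t = apps (Sym (NT f)) (ss @ us) \<and> t' = apps (subst (map_of (zip ys ss)) b) us"
  proof (induction rule: head_step.induct)
    case (unfold f ys b ss)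
    then show ?case by (metis append_Nil2 apps_Nil)
  next
    case (App s s' t)
    then show ?case by (metis append_assoc apps_snoc)
  qed
qed (auto simp: apps_append intro: head_step_apps head_step.unfold)

lemma not_head_step_Con [simp]: "\<not> head_step \<G> (apps (Sym (Con a)) ts) t"
  by (auto simp: head_step_iff)

abbreviation head_steps :: "hors \<Rightarrow> hsym tm \<Rightarrow> hsym tm \<Rightarrow> bool" where
  "head_steps \<G> \<equiv> (head_step \<G>)\<^sup>*\<^sup>*"

lemma head_steps_App: "head_steps \<G> s s' \<Longrightarrow> head_steps \<G> (App s t) (App s' t)"
  by (induction rule: rtranclp_induct) (auto intro: head_step.App rtranclp.rtrancl_into_rtrancl)

text \<open>
  Standard reductions reduce the head first. They are closed under rewriting, so the constant at the
  head of any reachable term is already found by head reduction.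
\<close>

inductive std :: "hors \<Rightarrow> hsym tm \<Rightarrow> hsym tm \<Rightarrow> bool" for \<G> where
  Var: "head_steps \<G> t (Var x) \<Longrightarrow> std \<G> t (Var x)"
| Sym: "head_steps \<G> t (Sym h) \<Longrightarrow> std \<G> t (Sym h)"
| App: "\<lbrakk>head_steps \<G> t (App s u); std \<G> s s'; std \<G> u u'\<rbrakk> \<Longrightarrow> std \<G> t (App s' u')"

lemma std_refl: "std \<G> t t"
  by (induction t) (auto intro: std.intros)

lemma std_head_steps: "std \<G> u v \<Longrightarrow> head_steps \<G> t u \<Longrightarrow> std \<G> t v"
  by (cases rule: std.cases) (auto intro: std.intros rtranclp_trans)

lemma std_subst: "(\<And>x. rel_option (std \<G>) (\<sigma> x) (\<sigma>' x)) \<Longrightarrow> std \<G> (subst \<sigma> b) (subst \<sigma>' b)"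
proof (induction b)
  case (Var x)
  from Var[of x] show ?case by (auto elim: option.rel_cases simp: std_refl)
qed (auto intro: std.intros)

lemma rel_option_map_of_zip:
  "list_all2 R ss ts \<Longrightarrow> rel_option R (map_of (zip ys ss) x) (map_of (zip ys ts) x)"
proof (induction ss ts arbitrary: ys rule: list_all2_induct)
  case (Cons s ss t ts)
  then show ?case by (cases ys) auto
qed simp

lemma std_apps_SymD:
  "std \<G> t (apps (Sym h) ts') \<Longrightarrow> \<exists>ts. head_steps \<G> t (apps (Sym h) ts) \<and> list_all2 (std \<G>) ts ts'"
proof (induction ts' arbitrary: t rule: rev_induct)
  case Nil
  then show ?case by (auto elim: std.cases intro!: exI[of _ "[]"])
next
  case (snoc u' ts')
  from snoc.prems obtain s u where t: "head_steps \<G> t (App s u)" "std \<G> s (apps (Sym h) ts')" "std \<G> u u'"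
    by (auto elim: std.cases)
  with snoc.IH obtain ts where "head_steps \<G> s (apps (Sym h) ts)" "list_all2 (std \<G>) ts ts'"
    by blast
  with t head_steps_App[of \<G> s "apps (Sym h) ts" u] show ?case
    by (intro exI[of _ "ts @ [u]"]) (auto intro: list_all2_appendI)
qed

text \<open>In the case of a redex, head reduction has already exposed the same nonterminal with
  less reduced arguments \<open>ss\<close>. Unfolding it on \<open>ss\<close> is one more head step,
  and the reductions from \<open>ss\<close> to \<open>ss'\<close> are postponed into the body, where
  substitution copies or drops them. The other two cases rewrite inside a component that
  \<open>std\<close> already treats on its own.\<close>

lemma std_rewrite: "rewrite \<G> t' t'' \<Longrightarrow> std \<G> t t' \<Longrightarrow> std \<G> t t''"
proof (induction arbitrary: t rule: rewrite.induct)
  case (1 f ys b ss')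
  from std_apps_SymD[OF 1(3)] obtain ss where ss: "head_steps \<G> t (apps (Sym (NT f)) ss)"
    "list_all2 (std \<G>) ss ss'" by blast
  with 1 have "head_step \<G> (apps (Sym (NT f)) ss) (subst (map_of (zip ys ss)) b)"
    by (intro head_step.unfold) (auto dest: list_all2_lengthD)
  with ss(1) have "head_steps \<G> t (subst (map_of (zip ys ss)) b)"
    by (rule rtranclp.rtrancl_into_rtrancl)
  then show ?case
    by (rule std_head_steps[rotated]) (intro std_subst rel_option_map_of_zip ss)
next
  case (2 s s' u)
  from 2(3) show ?case by (cases rule: std.cases) (use 2(2) in \<open>auto intro: std.App\<close>)
next
  case (3 u u' s)
  from 3(3) show ?case by (cases rule: std.cases) (use 3(2) in \<open>auto intro: std.App\<close>)
qed

text \<open>The term at a position before its own head is reduced. Only the heads along the path are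
  unfolded, so determinism of head reduction makes this term unique; the subterms that arbitrary
  rewriting can place at the position are many.\<close>

inductive reaches :: "hors \<Rightarrow> hsym tm \<Rightarrow> nat list \<Rightarrow> hsym tm \<Rightarrow> bool" for \<G> where
  Nil: "reaches \<G> t [] t"
| Cons: "\<lbrakk>head_steps \<G> t (apps (Sym (Con a)) ts); 1 \<le> i; i \<le> length ts; reaches \<G> (ts ! (i - 1)) p u\<rbrakk>
   \<Longrightarrow> reaches \<G> t (i # p) u"

text \<open>\<open>reaches\<close> is defined from the root, whereas run-trees extend positions at
  the end.\<close>

lemma reaches_snoc:
  "reaches \<G> t p s \<Longrightarrow> head_steps \<G> s (apps (Sym (Con a)) ts) \<Longrightarrow> 1 \<le> i \<Longrightarrow> i \<le> length ts \<Longrightarrow>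
    reaches \<G> t (p @ [i]) (ts ! (i - 1))"
proof (induction rule: reaches.induct)
  case (Nil t)
  then show ?case using reaches.Cons[OF _ _ _ reaches.Nil] by simp
next
  case (Cons t b us j p u)
  then show ?case using reaches.Cons[OF Cons(1-3)] by simp
qed

lemma reaches_snocD:
  "reaches \<G> t (p @ [i]) u \<Longrightarrow> \<exists>s a ts. reaches \<G> t p s \<and> head_steps \<G> s (apps (Sym (Con a)) ts) \<and>
    1 \<le> i \<and> i \<le> length ts \<and> u = ts ! (i - 1)"
proof (induction p arbitrary: t)
  case Nil
  then have "reaches \<G> t [i] u" by simp
  then show ?case
  proof (cases rule: reaches.cases)
    case (Cons a ts)
    then have "u = ts ! (i - 1)" by (auto elim: reaches.cases)
    with Cons show ?thesis using reaches.Nil by blast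
  qed
next
  case (Cons j p)
  from Cons.prems have "reaches \<G> t (j # p @ [i]) u" by simp
  then obtain b us where t: "head_steps \<G> t (apps (Sym (Con b)) us)" "1 \<le> j" "j \<le> length us"
    "reaches \<G> (us ! (j - 1)) (p @ [i]) u"
    by (cases rule: reaches.cases) blast
  from Cons.IH[OF t(4)] reaches.Cons[OF t(1-3)] show ?case by blast
qed

lemma label_at_std:
  "label_at t' p a \<Longrightarrow> std \<G> t t' \<Longrightarrow> \<exists>u ts. reaches \<G> t p u \<and> head_steps \<G> u (apps (Sym (Con a)) ts)"
proof (induction arbitrary: t rule: label_at.induct)
  case (1 a ts)
  then show ?case by (blast dest: std_apps_SymD intro: reaches.Nil)
next
  case (2 i ts p b a)
  from std_apps_SymD[OF 2(5)] obtain us where us: "head_steps \<G> t (apps (Sym (Con a)) us)"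
    "list_all2 (std \<G>) us ts" by blast
  with 2 have "std \<G> (us ! (i - 1)) (ts ! (i - 1))"
    by (auto simp: list_all2_conv_all_nth)
  with 2(4) us 2(1,2) show ?case
    by (metis reaches.Cons list_all2_lengthD)
qed

lemma rewrites_apps_arg:
  assumes "(rewrite \<G>)\<^sup>*\<^sup>* (ts ! i) u" "i < length ts"
  shows "(rewrite \<G>)\<^sup>*\<^sup>* (apps t ts) (apps t (ts[i := u]))"
  using assms(1)
proof (induction rule: rtranclp_induct)
  case (step u v)
  have left: "rewrite \<G> s s' \<Longrightarrow> rewrite \<G> (apps s us) (apps s' us)" for s s' us
    by (induction us rule: rev_induct) (auto intro: rewrite.intros)
  have "apps t (ts[i := w]) = apps (App (apps t (take i ts)) w) (drop (Suc i) ts)" for w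
    using assms(2) by (simp add: upd_conv_take_nth_drop apps_append apps_Cons)
  with step(2) have "rewrite \<G> (apps t (ts[i := u])) (apps t (ts[i := v]))"
    by (auto intro: left rewrite.intros)
  with step(3) show ?case by (rule rtranclp.rtrancl_into_rtrancl)
qed simp

lemma head_steps_rewrites: "head_steps \<G> s t \<Longrightarrow> (rewrite \<G>)\<^sup>*\<^sup>* s t"
  by (metis head_step_rewrite mono_rtranclp)

lemma reaches_label_at:
  "reaches \<G> t p u \<Longrightarrow> head_steps \<G> u (apps (Sym (Con a)) ts) \<Longrightarrow>
    \<exists>t'. (rewrite \<G>)\<^sup>*\<^sup>* t t' \<and> label_at t' p a"
proof (induction rule: reaches.induct)
  case (Nil t)
  then show ?case by (blast intro: head_steps_rewrites label_at.intros)
next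
  case (Cons t b us i p u)
  then obtain t' where t': "(rewrite \<G>)\<^sup>*\<^sup>* (us ! (i - 1)) t'" "label_at t' p a" by blast
  have "(rewrite \<G>)\<^sup>*\<^sup>* t (apps (Sym (Con b)) (us[i - 1 := t']))"
    using Cons(1-3) t'(1) by (intro rtranclp_trans[OF head_steps_rewrites rewrites_apps_arg]) auto
  moreover have "label_at (apps (Sym (Con b)) (us[i - 1 := t'])) (i # p) a"
    using Cons(2,3) t'(2) by (intro label_at.intros) auto
  ultimately show ?case by blast
qed

text \<open>Standardisation replaces arbitrary rewriting by head reduction along the path.
  Conversely, the reductions below a constant are replayed in the argument of the full term.\<close>

lemma produces_iff:
  "produces \<G> p a \<longleftrightarrow>
    (\<exists>u ts. reaches \<G> (Sym (NT (start \<G>))) p u \<and> head_steps \<G> u (apps (Sym (Con a)) ts))"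
proof
  assume "produces \<G> p a"
  then obtain t where t: "(rewrite \<G>)\<^sup>*\<^sup>* (Sym (NT (start \<G>))) t" "label_at t p a"
    unfolding produces_def by blast
  from t(1) have "std \<G> (Sym (NT (start \<G>))) t"
    by (induction rule: rtranclp_induct) (auto intro: std_refl std_rewrite)
  with t(2) show "\<exists>u ts. reaches \<G> (Sym (NT (start \<G>))) p u \<and> head_steps \<G> u (apps (Sym (Con a)) ts)"
    by (rule label_at_std)
qed (auto simp: produces_def dest: reaches_label_at)

section \<open>Determinism, and acceptance as a fixed point with height bounds\<close>

locale model_checking =
  fixes \<G> :: hors and A :: automaton
  assumes distinct_rules: "distinct (map fst (rules \<G>))"
begin

lemma head_step_deterministic:
  assumes "head_step \<G> t u" "head_step \<G> t v" shows "u = v"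
proof -
  obtain f ys b ss us f' ys' b' ss' us' where
    "(f, ys, b) \<in> set (rules \<G>)" "length ss = length ys" "t = apps (Sym (NT f)) (ss @ us)"
    "u = apps (subst (map_of (zip ys ss)) b) us"
    "(f', ys', b') \<in> set (rules \<G>)" "length ss' = length ys'" "t = apps (Sym (NT f')) (ss' @ us')"
    "v = apps (subst (map_of (zip ys' ss')) b') us'"
    using assms unfolding head_step_iff by blast
  moreover from this have "ys = ys' \<and> b = b'"
    using eq_key_imp_eq_value[OF distinct_rules] by fastforce
  ultimately show ?thesis by auto
qed

lemma head_steps_Con_unique:
  assumes "head_steps \<G> t (apps (Sym (Con a)) ts)" "head_steps \<G> t (apps (Sym (Con b)) us)"
  shows "a = b \<and> ts = us"
  using assms
proof (induction rule: converse_rtranclp_induct)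
  case base
  then show ?case by (cases rule: converse_rtranclpE) auto
next
  case (step t u)
  from step(4) show ?case
  proof (cases rule: converse_rtranclpE)
    case base
    with step(1) show ?thesis by simp
  next
    case (step v)
    with \<open>head_step \<G> t u\<close> head_step_deterministic have "u = v" by blast
    with step \<open>head_steps \<G> u _\<close> show ?thesis using \<open>_ \<Longrightarrow> a = b \<and> ts = us\<close> by blast
  qed
qed

lemma reaches_unique: "reaches \<G> t p u \<Longrightarrow> reaches \<G> t p v \<Longrightarrow> u = v"
proof (induction arbitrary: v rule: reaches.induct)
  case (Nil t)
  then show ?case by (auto elim: reaches.cases)
next
  case (Cons t a ts i p u)
  from Cons(6) show ?case
    by (cases rule: reaches.cases) (use Cons head_steps_Con_unique in blast)
qed

text \<open>Comes from determinism along the path, and gives the \<open>THE\<close> in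
  \<open>value_tree\<close> its meaning.\<close>

lemma produces_unique: "produces \<G> p a \<Longrightarrow> produces \<G> p b \<Longrightarrow> a = b"
  unfolding produces_iff using reaches_unique head_steps_Con_unique by blast

lemma value_tree_Const: "value_tree \<G> p = Some (Const a) \<longleftrightarrow> produces \<G> p a"
  by (auto simp: value_tree_def produces_unique the_equality split: if_splits)

abbreviation accepted_children :: "(nat \<Rightarrow> hsym tm \<Rightarrow> bool) \<Rightarrow> hsym tm list \<Rightarrow> (nat \<times> nat) set" where
  "accepted_children R ts \<equiv>
     {(i, q). 1 \<le> i \<and> i \<le> length ts \<and> q \<in> set (states A) \<and> R q (ts ! (i - 1))}"

text \<open>
  \<open>n\<close> bounds the height of the acceptance proof; the existential quantifiers of MSL need an induction
  on it, because the term that is searched for only shows up deep inside the search.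
\<close>

fun accepts :: "nat \<Rightarrow> nat \<Rightarrow> hsym tm \<Rightarrow> bool" where
  "accepts 0 q t \<longleftrightarrow> False"
| "accepts (Suc n) q t \<longleftrightarrow> (\<exists>t'. head_step \<G> t t' \<and> accepts n q t') \<or>
     (\<exists>a ts. t = apps (Sym (Con a)) ts \<and>
        sat (accepted_children (accepts n) ts) (transition A q (Const a)))"

end

lemma sat_mono: "sat Y \<phi> \<Longrightarrow> Y \<subseteq> Z \<Longrightarrow> sat Z \<phi>"
  by (induction \<phi>) auto

context model_checking
begin

lemma accepts_Suc: "accepts n q t \<Longrightarrow> accepts (Suc n) q t"
proof (induction n arbitrary: q t)
  case (Suc n)
  from Suc.prems consider t' where "head_step \<G> t t'" "accepts n q t'"
    | a ts where "t = apps (Sym (Con a)) ts"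
      "sat (accepted_children (accepts n) ts) (transition A q (Const a))"
    by auto
  then show ?case
  proof cases
    case 1
    with Suc.IH show ?thesis by (subst accepts.simps(2)) blast
  next
    case 2
    have "sat (accepted_children (accepts (Suc n)) ts) (transition A q (Const a))"
      using 2(2) by (rule sat_mono) (use Suc.IH in auto)
    with 2(1) show ?thesis by (subst accepts.simps(2)) blast
  qed
qed simp

lemma accepts_mono: "accepts n q t \<Longrightarrow> n \<le> m \<Longrightarrow> accepts m q t"
  by (induction m) (auto simp: le_Suc_eq intro: accepts_Suc simp del: accepts.simps)

definition accepted :: "nat \<Rightarrow> hsym tm \<Rightarrow> bool" where
  "accepted q t \<longleftrightarrow> (\<exists>n. accepts n q t)"

text \<open>A positive formula has finitely many atoms, so the heights at which they hold have a
  common bound. Hence natural numbers suffice as heights, although a node of a run-tree may have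
  infinitely many children.\<close>

lemma sat_accepted:
  "sat {(i, q'). R i q' \<and> accepted q' (u i)} \<phi> \<Longrightarrow> \<exists>n. sat {(i, q'). R i q' \<and> accepts n q' (u i)} \<phi>"
proof (induction \<phi>)
  case (PAnd \<phi> \<psi>)
  then obtain n m where "sat {(i, q'). R i q' \<and> accepts n q' (u i)} \<phi>"
    "sat {(i, q'). R i q' \<and> accepts m q' (u i)} \<psi>" by auto
  then have "sat {(i, q'). R i q' \<and> accepts (max n m) q' (u i)} \<phi>"
    "sat {(i, q'). R i q' \<and> accepts (max n m) q' (u i)} \<psi>"
    by (auto elim!: sat_mono intro: accepts_mono)
  then show ?case by auto
qed (auto simp: accepted_def)

lemma accepted_step: "head_step \<G> t t' \<Longrightarrow> accepted q t' \<Longrightarrow> accepted q t"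
  unfolding accepted_def using accepts.simps(2) by blast

lemma accepted_head_steps: "head_steps \<G> t t' \<Longrightarrow> accepted q t' \<Longrightarrow> accepted q t"
  by (induction rule: converse_rtranclp_induct) (auto intro: accepted_step)

lemma accepted_Con:
  assumes "sat (accepted_children accepted ts) (transition A q (Const a))"
  shows "accepted q (apps (Sym (Con a)) ts)"
proof -
  have "\<exists>n. sat {(i, q'). (1 \<le> i \<and> i \<le> length ts \<and> q' \<in> set (states A)) \<and> accepts n q' (ts ! (i - 1))}
    (transition A q (Const a))"
    by (rule sat_accepted) (use assms in simp)
  then obtain n where "accepts (Suc n) q (apps (Sym (Con a)) ts)"
    by auto
  then show ?thesis unfolding accepted_def by blast
qed

section \<open>Run-trees compared with acceptance\<close>

definition run_node ::
  "nat list set \<Rightarrow> (nat list \<Rightarrow> nat list \<times> nat) \<Rightarrow> nat list \<Rightarrow> nat list \<Rightarrow> nat \<Rightarrow> bool" where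
  "run_node T r x p q \<longleftrightarrow> q \<in> set (states A) \<and>
      (\<forall>k. x @ [k] \<in> T \<longrightarrow> (\<exists>i q'. r (x @ [k]) = (p @ [i], q'))) \<and>
      (\<exists>l. value_tree \<G> p = Some l \<and>
           sat {(i, q'). \<exists>k. x @ [k] \<in> T \<and> r (x @ [k]) = (p @ [i], q')} (transition A q l))"

text \<open>A run-tree whose root may carry any position and state, as needed when run-trees are
  assembled from the run-trees of children.\<close>

definition run_from :: "nat list \<Rightarrow> nat \<Rightarrow> nat list set \<Rightarrow> (nat list \<Rightarrow> nat list \<times> nat) \<Rightarrow> bool" where
  "run_from p0 q0 T r \<longleftrightarrow>
     [] \<in> T \<and> (\<forall>x k. x @ [k] \<in> T \<longrightarrow> x \<in> T) \<and> r [] = (p0, q0) \<and>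
     (\<forall>x \<in> T. \<forall>p q. r x = (p, q) \<longrightarrow> run_node T r x p q)"

lemma run_fromD:
  assumes "run_from p0 q0 T r"
  shows "[] \<in> T" "x @ [k] \<in> T \<Longrightarrow> x \<in> T" "r [] = (p0, q0)"
    "x \<in> T \<Longrightarrow> r x = (p, q) \<Longrightarrow> run_node T r x p q"
  using assms unfolding run_from_def by blast+

lemma run_tree_iff: "run_tree A (value_tree \<G>) T r \<longleftrightarrow> run_from [] (initial A) T r"
  by (simp add: run_tree_def run_from_def run_node_def)

text \<open>The statement keeps apart the term \<open>u\<close> that is reached at \<open>p\<close>
  and its head reduct \<open>t\<close>: a head step advances \<open>t\<close> and leaves the
  position alone, and only a constant at the head leads on to the children of
  \<open>p\<close>.\<close>

lemma accepts_run_from: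
  assumes "accepts n q t" "q \<in> set (states A)" "reaches \<G> (Sym (NT (start \<G>))) p u" "head_steps \<G> u t"
  shows "\<exists>T r. run_from p q T r \<and> (\<nexists>b. infinite_branch T b)"
  using assms
proof (induction n arbitrary: q t p u)
  case (Suc n)
  from Suc.prems(1) consider t' where "head_step \<G> t t'" "accepts n q t'"
    | a ts where "t = apps (Sym (Con a)) ts"
      "sat (accepted_children (accepts n) ts) (transition A q (Const a))"
    by auto
  then show ?case
  proof cases
    case 1
    with Suc.prems show ?thesis by (metis Suc.IH rtranclp.rtrancl_into_rtrancl)
  next
    case 2
    define Y where "Y = accepted_children (accepts n) ts"
    have "\<exists>T r. run_from (p @ [fst z]) (snd z) T r \<and> (\<nexists>b. infinite_branch T b)" if "z \<in> Y" for z
      using that 2(1) Suc.prems by (intro Suc.IH[of "snd z" "ts ! (fst z - 1)" _ "ts ! (fst z - 1)"] reaches_snoc) (auto simp: Y_def)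
    then obtain TT rr where run: "\<And>z. z \<in> Y \<Longrightarrow> run_from (p @ [fst z]) (snd z) (TT z) (rr z)"
      and fin: "\<And>z b. z \<in> Y \<Longrightarrow> \<not> infinite_branch (TT z) b"
      by metis
    \<comment> \<open>The child of the root that serves the atom \<open>(i, q')\<close> is numbered
      by the code of that pair, so distinct atoms have disjoint subtrees.\<close>
    define T where "T = insert [] {k # x | k x. prod_decode k \<in> Y \<and> x \<in> TT (prod_decode k)}"
    define r where "r = (\<lambda>x. case x of [] \<Rightarrow> (p, q) | k # x \<Rightarrow> rr (prod_decode k) x)"
    have T_Cons: "k # x \<in> T \<longleftrightarrow> prod_decode k \<in> Y \<and> x \<in> TT (prod_decode k)" for k x
      by (auto simp: T_def)
    have r_simps: "r [] = (p, q)" "r (k # x) = rr (prod_decode k) x" for k x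
      by (simp_all add: r_def)
    have "produces \<G> p a"
      unfolding produces_iff using Suc.prems 2(1) by blast
    then have label: "value_tree \<G> p = Some (Const a)"
      by (simp add: value_tree_Const)
    have root: "r [k] = (p @ [fst (prod_decode k)], snd (prod_decode k))" "[k] \<in> T" if "prod_decode k \<in> Y" for k
      using run[OF that] that by (simp_all add: run_from_def r_simps T_Cons)
    have sat: "sat {(i, q'). \<exists>k. [k] \<in> T \<and> r [k] = (p @ [i], q')} (transition A q (Const a))"
      using 2(2)[folded Y_def]
    proof (rule sat_mono, clarify)
      fix i q' assume "(i, q') \<in> Y"
      with root[of "prod_encode (i, q')"] show "\<exists>k. [k] \<in> T \<and> r [k] = (p @ [i], q')" by auto
    qed
    have "run_from p q T r"
      unfolding run_from_def
    proof (intro conjI ballI allI impI)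
      show "x \<in> T" if "x @ [k] \<in> T" for x k
        using that by (cases x) (auto simp: T_Cons T_def intro: run_fromD(2)[OF run])
    next
      fix x p' q' assume x: "x \<in> T" "r x = (p', q')"
      show "run_node T r x p' q'"
      proof (cases x)
        case Nil
        with x sat label Suc.prems(2) root show ?thesis
          by (auto simp: run_node_def r_simps T_Cons)
      next
        case (Cons k y)
        with x have "prod_decode k \<in> Y" "y \<in> TT (prod_decode k)" "rr (prod_decode k) y = (p', q')"
          by (simp_all add: T_Cons r_simps)
        with run_fromD(4)[OF run[OF this(1)] this(2,3)] show ?thesis
          by (simp add: run_node_def Cons T_Cons r_simps)
      qed
    qed (simp_all add: T_def r_simps)
    moreover have "\<not> infinite_branch T b" for b
    proof
      assume b: "infinite_branch T b"
      \<comment> \<open>Dropping its first direction turns a branch of \<open>T\<close> into a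
        branch of the subtree selected by that direction.\<close>
      have Suc_b: "map b [0..<Suc m] = b 0 # map (\<lambda>i. b (Suc i)) [0..<m]" for m
        by (induction m) auto
      have "prod_decode (b 0) \<in> Y \<and> map (\<lambda>i. b (Suc i)) [0..<m] \<in> TT (prod_decode (b 0))" for m
        using b unfolding infinite_branch_def Suc_b[symmetric] T_Cons[symmetric] by blast
      with fin[of "prod_decode (b 0)" "\<lambda>i. b (Suc i)"] show False
        by (auto simp: infinite_branch_def)
    qed
    ultimately show ?thesis by blast
  qed
qed simp

text \<open>A node that is not \<open>good\<close> has a child that is not \<open>good\<close>: if
  all children were, the formula satisfied at the node would make the term there accepted. Starting
  from such a root, choosing such children forever yields an infinite branch.\<close>

lemma run_tree_accepted:
  assumes "run_from p0 q0 T r" "\<And>b. \<not> infinite_branch T b"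
  shows "\<forall>u. reaches \<G> (Sym (NT (start \<G>))) p0 u \<longrightarrow> accepted q0 u"
proof (rule ccontr)
  define good where "good x \<longleftrightarrow> (\<forall>u. reaches \<G> (Sym (NT (start \<G>))) (fst (r x)) u \<longrightarrow> accepted (snd (r x)) u)" for x
  have step: "good x" if x: "x \<in> T" and children: "\<And>k. x @ [k] \<in> T \<Longrightarrow> good (x @ [k])" for x
    unfolding good_def
  proof (intro allI impI)
    obtain p q where pq: "r x = (p, q)" by fastforce
    fix u assume "reaches \<G> (Sym (NT (start \<G>))) (fst (r x)) u"
    with pq have u: "reaches \<G> (Sym (NT (start \<G>))) p u" by simp
    from assms(1) x pq obtain l where l: "value_tree \<G> p = Some l"
      "sat {(i, q'). \<exists>k. x @ [k] \<in> T \<and> r (x @ [k]) = (p @ [i], q')} (transition A q l)"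
      unfolding run_from_def run_node_def by blast
    then obtain a where a: "l = Const a" by (cases l) auto
    with l(1) have "produces \<G> p a" by (simp add: value_tree_Const)
    with u obtain ts where ts: "head_steps \<G> u (apps (Sym (Con a)) ts)"
      unfolding produces_iff using reaches_unique by blast
    have "sat (accepted_children accepted ts) (transition A q (Const a))"
      using l(2)[unfolded a]
    proof (rule sat_mono, clarify)
      \<comment> \<open>The definition of a run-tree sets no bound on the direction
        \<open>i\<close>. The bound comes from the child itself: its formula is satisfied, so its
        label is not \<open>Bot\<close>, a constant is produced at \<open>p @ [i]\<close>, and
        therefore \<open>i\<close> is the direction of an actual argument of
        \<open>a\<close>.\<close>
      fix i q' k assume k: "x @ [k] \<in> T" "r (x @ [k]) = (p @ [i], q')"
      with assms(1) obtain l where l: "value_tree \<G> (p @ [i]) = Some l" "q' \<in> set (states A)"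
        "sat {(j, q''). \<exists>k'. (x @ [k]) @ [k'] \<in> T \<and> r ((x @ [k]) @ [k']) = ((p @ [i]) @ [j], q'')} (transition A q' l)"
        unfolding run_from_def run_node_def by blast
      then obtain b where "l = Const b" by (cases l) auto
      with l(1) have "produces \<G> (p @ [i]) b" by (simp add: value_tree_Const)
      then obtain v where v: "reaches \<G> (Sym (NT (start \<G>))) (p @ [i]) v"
        unfolding produces_iff by blast
      from reaches_snocD[OF this] u ts have "1 \<le> i" "i \<le> length ts" "v = ts ! (i - 1)"
        using reaches_unique head_steps_Con_unique by blast+
      moreover from children[OF k(1)] k(2) v have "accepted q' v" by (simp add: good_def)
      ultimately show "1 \<le> i \<and> i \<le> length ts \<and> q' \<in> set (states A) \<and> accepted q' (ts ! (i - 1))"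
        using l(2) by simp
    qed
    then have "accepted q (apps (Sym (Con a)) ts)" by (rule accepted_Con)
    with ts pq show "accepted (snd (r x)) u" by (simp add: accepted_head_steps)
  qed
  assume "\<not> (\<forall>u. reaches \<G> (Sym (NT (start \<G>))) p0 u \<longrightarrow> accepted q0 u)"
  with assms(1) have root: "[] \<in> T" "\<not> good []" by (simp_all add: run_from_def good_def)
  from step have bad: "\<exists>k. x @ [k] \<in> T \<and> \<not> good (x @ [k])" if "x \<in> T" "\<not> good x" for x
    using that by blast
  define step_to where "step_to x = (SOME k. x @ [k] \<in> T \<and> \<not> good (x @ [k]))" for x
  define path where "path = rec_nat [] (\<lambda>_ x. x @ [step_to x])"
  have "path n \<in> T \<and> \<not> good (path n)" for n
  proof (induction n)
    case (Suc n)
    with someI_ex[OF bad, of "path n"] show ?case by (simp add: path_def step_to_def)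
  qed (simp add: path_def root)
  moreover have "map (\<lambda>i. step_to (path i)) [0..<n] = path n" for n
    by (induction n) (simp_all add: path_def)
  ultimately have "infinite_branch T (\<lambda>i. step_to (path i))"
    by (simp add: infinite_branch_def)
  with assms(2) show False by blast
qed

theorem cotrivially_accepts_iff:
  assumes "initial A \<in> set (states A)"
  shows "cotrivially_accepts A (value_tree \<G>) \<longleftrightarrow> accepted (initial A) (Sym (NT (start \<G>)))"
  unfolding cotrivially_accepts_def run_tree_iff
  using run_tree_accepted[of "[]" "initial A"] accepts_run_from[OF _ assms reaches.Nil rtranclp.rtrancl_refl]
  by (metis accepted_def reaches.Nil)

end

section \<open>Typing of spines, substitutions and renamed symbols\<close>

lemma has_type_Var [simp]: "has_type \<Sigma> \<Gamma> (Var x) \<gamma> \<longleftrightarrow> \<Gamma> x = Some \<gamma>"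
  by (auto elim: has_type.cases intro: has_type.intros)

lemma has_type_Sym [simp]: "has_type \<Sigma> \<Gamma> (Sym f) \<gamma> \<longleftrightarrow> \<Sigma> f = Some \<gamma>"
  by (auto elim: has_type.cases intro: has_type.intros)

lemma has_type_App: "has_type \<Sigma> \<Gamma> (App s t) \<delta> \<longleftrightarrow> (\<exists>\<gamma>. has_type \<Sigma> \<Gamma> s (Arrow \<gamma> \<delta>) \<and> has_type \<Sigma> \<Gamma> t \<gamma>)"
  by (auto elim: has_type.cases intro: has_type.intros)

lemma arrows_Nil [simp]: "arrows [] \<gamma> = \<gamma>"
  by (simp add: arrows_def)

lemma arrows_Cons [simp]: "arrows (\<delta> # \<delta>s) \<gamma> = Arrow \<delta> (arrows \<delta>s \<gamma>)"
  by (simp add: arrows_def)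

lemma arrows_append: "arrows (\<delta>s @ \<delta>s') \<gamma> = arrows \<delta>s (arrows \<delta>s' \<gamma>)"
  by (simp add: arrows_def)

lemma arrows_Iota_eq_iff [simp]: "arrows \<gamma>s Iota = arrows \<delta>s Iota \<longleftrightarrow> \<gamma>s = \<delta>s"
proof (induction \<gamma>s arbitrary: \<delta>s)
  case Nil
  then show ?case by (cases \<delta>s) auto
next
  case (Cons \<gamma> \<gamma>s)
  then show ?case by (cases \<delta>s) auto
qed

lemma has_type_apps:
  "has_type \<Sigma> \<Gamma> (apps t ts) \<gamma> \<longleftrightarrow>
    (\<exists>\<gamma>s. has_type \<Sigma> \<Gamma> t (arrows \<gamma>s \<gamma>) \<and> list_all2 (has_type \<Sigma> \<Gamma>) ts \<gamma>s)"
proof (induction ts arbitrary: t)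
  case (Cons u ts)
  have "has_type \<Sigma> \<Gamma> (apps t (u # ts)) \<gamma> \<longleftrightarrow> (\<exists>\<gamma>s \<delta>. has_type \<Sigma> \<Gamma> t (arrows (\<delta> # \<gamma>s) \<gamma>) \<and>
      list_all2 (has_type \<Sigma> \<Gamma>) (u # ts) (\<delta> # \<gamma>s))"
    by (auto simp: apps_Cons Cons has_type_App)
  then show ?case
    by (metis list_all2_Cons1)
qed simp

lemma has_type_subst:
  assumes "has_type \<Sigma> \<Gamma> t \<gamma>" "\<And>x \<delta>. \<Gamma> x = Some \<delta> \<Longrightarrow> \<exists>s. \<sigma> x = Some s \<and> has_type \<Sigma> \<Gamma>' s \<delta>"
  shows "has_type \<Sigma> \<Gamma>' (subst \<sigma> t) \<gamma>"
  using assms(1) by induction (auto dest: assms(2) simp: has_type_App)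

lemma map_of_zip_list_all2:
  assumes "list_all2 R ss \<gamma>s" "map_of (zip ys \<gamma>s) x = Some \<gamma>"
  shows "\<exists>s. map_of (zip ys ss) x = Some s \<and> R s \<gamma>"
  using rel_option_map_of_zip[OF assms(1), of ys x] assms(2) by (auto elim: option.rel_cases)

lemma has_type_subst_zip:
  "has_type \<Sigma> (map_of (zip ys \<gamma>s)) t \<gamma> \<Longrightarrow> list_all2 (has_type \<Sigma> \<Gamma>) ss \<gamma>s \<Longrightarrow>
    has_type \<Sigma> \<Gamma> (subst (map_of (zip ys ss)) t) \<gamma>"
  by (erule has_type_subst) (rule map_of_zip_list_all2)

lemma subst_closed: "closed_term \<Sigma> t \<gamma> \<Longrightarrow> subst \<sigma> t = t"
  by (induction t arbitrary: \<gamma>) (auto simp: has_type_App)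

lemma map_subst_Var:
  "distinct ys \<Longrightarrow> length ss = length ys \<Longrightarrow> map (subst (map_of (zip ys ss)) \<circ> Var) ys = ss"
  by (rule nth_equalityI) (auto simp: map_of_zip_nth)

lemma map_subst_Var_fst:
  "distinct (map fst ys) \<Longrightarrow> length ss = length ys \<Longrightarrow>
    map (\<lambda>y. subst (map_of (zip (map fst ys) ss)) (Var (fst y))) ys = ss"
  using map_subst_Var[of "map fst ys" ss] by (simp add: comp_def)

lemma map_tm_apps [simp]: "map_tm f (apps t ts) = apps (map_tm f t) (map (map_tm f) ts)"
  by (induction ts rule: rev_induct) auto

lemma map_tm_subst: "map_tm f (subst \<sigma> t) = subst (map_option (map_tm f) \<circ> \<sigma>) (map_tm f t)"
  by (induction t) (auto split: option.split)

lemma map_of_zip_map: "map_option f \<circ> map_of (zip ys ss) = map_of (zip ys (map f ss))"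
proof
  show "(map_option f \<circ> map_of (zip ys ss)) x = map_of (zip ys (map f ss)) x" for x
    by (induction ys ss rule: list_induct2') auto
qed

lemma map_tm_subst_zip:
  "map_tm f (subst (map_of (zip ys ss)) t) = subst (map_of (zip ys (map (map_tm f) ss))) (map_tm f t)"
  by (simp add: map_tm_subst map_of_zip_map)

lemma map_tm_eq_apps_Sym:
  "map_tm f t = apps (Sym c) ss \<Longrightarrow> \<exists>h ts. t = apps (Sym h) ts \<and> f h = c \<and> map (map_tm f) ts = ss"
proof (induction ss arbitrary: t rule: rev_induct)
  case Nil
  then show ?case by (cases t) (auto intro: exI[of _ "[]"])
next
  case (snoc s ss)
  then obtain t1 t2 where t: "t = App t1 t2" "map_tm f t1 = apps (Sym c) ss" "map_tm f t2 = s"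
    by (cases t) auto
  with snoc.IH[OF t(2)] obtain h ts where "t1 = apps (Sym h) ts" "f h = c" "map (map_tm f) ts = ss"
    by blast
  with t show ?case by (intro exI[of _ h] exI[of _ "ts @ [t2]"]) simp
qed

lemma has_type_map_tm:
  "has_type \<Sigma> \<Gamma> t \<gamma> \<Longrightarrow> (\<And>f \<delta>. \<Sigma> f = Some \<delta> \<Longrightarrow> \<Sigma>' (g f) = Some \<delta>) \<Longrightarrow>
    has_type \<Sigma>' \<Gamma> (map_tm g t) \<gamma>"
  by (induction rule: has_type.induct) (auto simp: has_type_App)

lemma closed_term_headE:
  assumes "closed_term \<Sigma> t \<gamma>"
  obtains f ts where "t = apps (Sym f) ts"
proof -
  have "\<exists>f ts. t = apps (Sym f) ts"
    using assms
  proof (induction t arbitrary: \<gamma>)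
    case (Sym f)
    then show ?case by (metis apps_Nil)
  next
    case (App s t)
    then show ?case by (metis apps_snoc has_type_App)
  qed simp
  with that show ?thesis by blast
qed

lemma provable_ConClause:
  assumes "ConClause c ys G P \<in> D" "distinct (map fst ys)" "list_all2 (closed_term \<Sigma>) ss (map snd ys)"
    "provable \<Sigma> D (subst_goal (map_of (zip (map fst ys) ss)) G)"
  shows "provable \<Sigma> D (GAtom P (apps (Sym c) ss))"
proof -
  have "length ss = length ys"
    using assms(3) by (auto dest: list_all2_lengthD)
  with provable.intros(4)[OF assms(1), of \<Sigma> ss] assms(2-4) show ?thesis
    by (simp add: comp_def map_subst_Var_fst del: subst.simps(1))
qed

text \<open>A definition binds all arguments up to the base type. A term of type \<open>Iota\<close>
  with a nonterminal at its head therefore has no surplus arguments, and the head step unfolds the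
  whole term.\<close>

lemma (in model_checking) head_step_closed:
  assumes "wf_hors \<G>" "head_step \<G> t t'" "closed_term (hsig \<G>) t Iota"
  shows "\<exists>f ys b ss \<gamma>s. (f, ys, b) \<in> set (rules \<G>) \<and> t = apps (Sym (NT f)) ss \<and>
    t' = subst (map_of (zip ys ss)) b \<and> hsig \<G> (NT f) = Some (arrows \<gamma>s Iota) \<and>
    length \<gamma>s = length ys \<and> list_all2 (closed_term (hsig \<G>)) ss \<gamma>s \<and> closed_term (hsig \<G>) t' Iota"
proof -
  obtain f ys b ss us where r: "(f, ys, b) \<in> set (rules \<G>)" "length ss = length ys"
    "t = apps (Sym (NT f)) (ss @ us)" "t' = apps (subst (map_of (zip ys ss)) b) us"
    using assms(2) unfolding head_step_iff by blast
  from assms(1) r(1) obtain \<gamma>s where \<gamma>s: "length \<gamma>s = length ys" "hsig \<G> (NT f) = Some (arrows \<gamma>s Iota)"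
    "has_type (hsig \<G>) (map_of (zip ys \<gamma>s)) b Iota"
    unfolding wf_hors_def by fast
  from assms(3) r(3) \<gamma>s(2) have ty: "list_all2 (closed_term (hsig \<G>)) (ss @ us) \<gamma>s"
    by (auto simp: has_type_apps simp del: hsig.simps)
  then have "us = []"
    using r(2) \<gamma>s(1) by (auto dest: list_all2_lengthD)
  with r \<gamma>s ty show ?thesis
    by (intro exI[of _ f] exI[of _ ys] exI[of _ b] exI[of _ ss] exI[of _ \<gamma>s])
      (simp add: has_type_subst_zip del: hsig.simps)
qed

section \<open>From recursion schemes to MSL\<close>

definition symbol_code :: "hsym \<Rightarrow> nat" where "symbol_code h = encode h"
definition state_pred :: "nat \<Rightarrow> nat" where "state_pred q = prod_encode (0, q)"
definition formula_pred :: "pbf \<Rightarrow> nat" where "formula_pred \<phi> = prod_encode (1, encode \<phi>)"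

lemma symbol_code_eq_iff [simp]: "symbol_code h = symbol_code h' \<longleftrightarrow> h = h'"
  by (simp add: symbol_code_def)

lemma pred_eq_iff [simp]:
  "state_pred q = state_pred q' \<longleftrightarrow> q = q'"
  "formula_pred \<phi> = formula_pred \<psi> \<longleftrightarrow> \<phi> = \<psi>"
  "state_pred q \<noteq> formula_pred \<phi>" "formula_pred \<phi> \<noteq> state_pred q"
  by (auto simp: state_pred_def formula_pred_def)

definition con_params :: "nat \<Rightarrow> (nat \<times> ctype) list" where
  "con_params m = map (\<lambda>i. (i, Iota)) [0..<m]"

definition con_term :: "nat \<Rightarrow> nat \<Rightarrow> nat tm" where
  "con_term a m = apps (Sym (symbol_code (Con a))) (map Var [0..<m])"

definition con_clause :: "nat \<times> nat \<Rightarrow> goal \<Rightarrow> nat \<Rightarrow> clause" where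
  "con_clause c G P = ConClause (symbol_code (Con (fst c))) (con_params (snd c)) G P"

text \<open>Goals have no disjunction, so alternatives become separate clauses and falsity becomes
  none. A connective delegates to the predicates of its subformulas on the same term. Directions
  count from 1 but the parameters of a constant from 0, hence \<open>Var (i - 1)\<close>.\<close>

definition formula_bodies :: "nat \<times> nat \<Rightarrow> pbf \<Rightarrow> goal list" where
  "formula_bodies c \<phi> = (case \<phi> of
     PTrue \<Rightarrow> [GTrue]
   | PFalse \<Rightarrow> []
   | PAtom i q \<Rightarrow> if 1 \<le> i \<and> i \<le> snd c then [GAtom (state_pred q) (Var (i - 1))] else []
   | PAnd \<phi> \<psi> \<Rightarrow> [GAnd (GAtom (formula_pred \<phi>) (con_term (fst c) (snd c)))
                      (GAtom (formula_pred \<psi>) (con_term (fst c) (snd c)))]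
   | POr \<phi> \<psi> \<Rightarrow> [GAtom (formula_pred \<phi>) (con_term (fst c) (snd c)),
                 GAtom (formula_pred \<psi>) (con_term (fst c) (snd c))])"

definition pbf_children :: "pbf \<Rightarrow> pbf list" where
  "pbf_children \<phi> = (case \<phi> of PTrue \<Rightarrow> [] | PFalse \<Rightarrow> [] | PAtom i q \<Rightarrow> []
     | PAnd \<phi> \<psi> \<Rightarrow> [\<phi>, \<psi>] | POr \<phi> \<psi> \<Rightarrow> [\<phi>, \<psi>])"

definition formulas :: "automaton \<Rightarrow> pbf list" where
  "formulas A = concat (map (\<lambda>t. saturate pbf_children (snd t)) (transitions A))"

text \<open>Peels one argument type off \<open>\<gamma>\<close> per parameter. The branch for
  \<open>Iota\<close> is a default for types that are too short, which a well-formed scheme never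
  reaches.\<close>

definition typed_params :: "nat list \<Rightarrow> ctype \<Rightarrow> (nat \<times> ctype) list" where
  "typed_params ys \<gamma> = fst (foldl (\<lambda>acc y. case snd acc of Iota \<Rightarrow> (fst acc @ [(y, Iota)], Iota)
     | Arrow \<delta> \<delta>' \<Rightarrow> (fst acc @ [(y, \<delta>)], \<delta>')) ([], \<gamma>) ys)"

definition rule_clauses :: "hors \<Rightarrow> automaton \<Rightarrow> clause list" where
  "rule_clauses \<G> A = concat (map (\<lambda>n. concat (map (\<lambda>r. if fst n = fst r
     then map (\<lambda>q. ConClause (symbol_code (NT (fst n))) (typed_params (fst (snd r)) (snd n))
            (GAtom (state_pred q) (map_tm symbol_code (snd (snd r)))) (state_pred q)) (states A)
     else []) (rules \<G>))) (nonterminals \<G>))"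

definition transition_clauses :: "hors \<Rightarrow> automaton \<Rightarrow> clause list" where
  "transition_clauses \<G> A = concat (map (\<lambda>t. concat (map (\<lambda>c. if snd (fst t) = fst c
     then [con_clause c (GAtom (formula_pred (snd t)) (con_term (fst c) (snd c))) (state_pred (fst (fst t)))]
     else []) (constants \<G>))) (transitions A))"

definition formula_clauses :: "hors \<Rightarrow> automaton \<Rightarrow> clause list" where
  "formula_clauses \<G> A = concat (map (\<lambda>\<phi>. concat (map (\<lambda>c.
     map (\<lambda>G. con_clause c G (formula_pred \<phi>)) (formula_bodies c \<phi>)) (constants \<G>))) (formulas A))"

definition con_type :: "nat \<Rightarrow> ctype" where "con_type m = arrows (replicate m Iota) Iota"

definition msl_of_hors :: "hors \<times> automaton \<Rightarrow> msl_instance" where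
  "msl_of_hors p = MSL
     (map (\<lambda>n. (symbol_code (NT (fst n)), snd n)) (nonterminals (fst p)) @
      map (\<lambda>c. (symbol_code (Con (fst c)), con_type (snd c))) (constants (fst p)))
     (remdups (map state_pred (states (snd p)) @ map formula_pred (formulas (snd p))))
     (rule_clauses (fst p) (snd p) @ transition_clauses (fst p) (snd p) @ formula_clauses (fst p) (snd p))
     (GAtom (state_pred (initial (snd p))) (Sym (symbol_code (NT (start (fst p))))))"

section \<open>Computability of this translation\<close>

lemma cfun_symbol_code: "cfun f \<Longrightarrow> cfun (\<lambda>x. symbol_code (f x))"
  unfolding symbol_code_def by (rule cfun_encode)

lemma cfun_apps: "cfun t \<Longrightarrow> cfun ts \<Longrightarrow> cfun (\<lambda>x. apps (t x) (ts x))"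
  unfolding apps_def by (intro cfun_intros)

lemma cfun_con_type: "cfun f \<Longrightarrow> cfun (\<lambda>x. con_type (f x))"
proof -
  have "con_type m = (Arrow Iota ^^ m) Iota" for m
    by (induction m) (simp_all add: con_type_def)
  moreover assume "cfun f"
  then have "cfun (\<lambda>x. (Arrow Iota ^^ f x) Iota)"
    by (intro cfun_funpow cfun_intros)
  ultimately show ?thesis by simp
qed

lemma cfun_msl_of_hors: "cfun msl_of_hors"
proof -
  have children: "cfun pbf_children"
    unfolding pbf_children_def by (intro cfun_intros)
  have formulas: "cfun f \<Longrightarrow> cfun (\<lambda>x. formulas (f x))" for f :: "'a :: encodable \<Rightarrow> automaton"
    unfolding formulas_def by (intro cfun_intros cfun_saturate children)
  have typed: "cfun f \<Longrightarrow> cfun g \<Longrightarrow> cfun (\<lambda>x. typed_params (f x) (g x))"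
    for f :: "'a :: encodable \<Rightarrow> nat list" and g
    unfolding typed_params_def by (intro cfun_intros)
  have sp: "cfun f \<Longrightarrow> cfun (\<lambda>x. state_pred (f x))" for f :: "'a :: encodable \<Rightarrow> nat"
    unfolding state_pred_def by (intro cfun_intros)
  have fp: "cfun f \<Longrightarrow> cfun (\<lambda>x. formula_pred (f x))" for f :: "'a :: encodable \<Rightarrow> pbf"
    unfolding formula_pred_def by (intro cfun_intros)
  have ct: "cfun f \<Longrightarrow> cfun g \<Longrightarrow> cfun (\<lambda>x. con_term (f x) (g x))" for f g :: "'a :: encodable \<Rightarrow> nat"
    unfolding con_term_def by (intro cfun_apps cfun_intros cfun_symbol_code)
  have cc: "cfun f \<Longrightarrow> cfun g \<Longrightarrow> cfun h \<Longrightarrow> cfun (\<lambda>x. con_clause (f x) (g x) (h x))"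
    for f :: "'a :: encodable \<Rightarrow> nat \<times> nat" and g h
    unfolding con_clause_def con_params_def by (intro cfun_intros cfun_symbol_code)
  have "cfun (\<lambda>p. formula_bodies (fst p) (snd p))"
    unfolding formula_bodies_def by (intro cfun_intros cfun_diff sp fp ct)
  note fb = cfun_comp2[OF this]
  have sym: "cfun symbol_code"
    by (intro cfun_symbol_code cfun_intros)
  have t: "cfun f \<Longrightarrow> cfun (\<lambda>x. map_tm symbol_code (f x))" for f :: "'a :: encodable \<Rightarrow> _"
    by (rule cfun_map_tm[OF sym])
  show ?thesis
    unfolding msl_of_hors_def rule_clauses_def transition_clauses_def formula_clauses_def
    by (intro cfun_intros formulas typed sp fp ct cc fb t cfun_symbol_code cfun_con_type)
qed

lemma typed_params_arrows:
  assumes "length \<gamma>s = length ys"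
  shows "typed_params ys (arrows \<gamma>s Iota) = zip ys \<gamma>s"
proof -
  have "length \<gamma>s = length ys \<Longrightarrow>
    foldl (\<lambda>acc y. case snd acc of Iota \<Rightarrow> (fst acc @ [(y, Iota)], Iota)
     | Arrow \<delta> \<delta>' \<Rightarrow> (fst acc @ [(y, \<delta>)], \<delta>')) (zs, arrows \<gamma>s Iota) ys = (zs @ zip ys \<gamma>s, Iota)" for zs
    by (induction \<gamma>s ys arbitrary: zs rule: list_induct2') simp_all
  with assms show ?thesis by (simp add: typed_params_def)
qed

lemma formulas_transition: "(k, \<phi>) \<in> set (transitions A) \<Longrightarrow> \<phi> \<in> set (formulas A)"
  unfolding formulas_def using saturate_self by force

lemma add_le_prod_encode: "a + b \<le> prod_encode (a, b)"
proof -
  have "n \<le> triangle n" for n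
    by (induction n) auto
  from this[of "a + b"] show ?thesis by (simp add: prod_encode_def)
qed

text \<open>Size is the rank for saturation with subformulas: it drops along
  \<open>pbf_children\<close>, and the code bounds it.\<close>

lemma size_le_encode_pbf: "size \<phi> \<le> encode (\<phi> :: pbf)"
proof -
  have "Suc (n + k) \<le> list_encode [i, n, k]" for i n k
    using add_le_prod_encode[of i "list_encode [n, k]"] add_le_prod_encode[of n "list_encode [k]"]
      add_le_prod_encode[of k 0] by simp
  note * = order_trans[OF _ this]
  show ?thesis
    by (induction \<phi>) (auto intro!: * simp del: list_encode.simps)
qed

lemma formulas_children:
  assumes "\<phi> \<in> set (formulas A)" "\<psi> \<in> set (pbf_children \<phi>)"
  shows "\<psi> \<in> set (formulas A)"
proof -
  from assms(1) obtain t where t: "t \<in> set (transitions A)" "\<phi> \<in> set (saturate pbf_children (snd t))"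
    by (auto simp: formulas_def)
  have "\<psi> \<in> set (saturate pbf_children (snd t))"
    by (rule saturate_step[where f = pbf_children and rank = size, OF _ size_le_encode_pbf t(2) assms(2)])
      (auto simp: pbf_children_def split: pbf.splits)
  with t(1) show ?thesis by (auto simp: formulas_def)
qed

text \<open>Carries the well-formedness of transition formulas over to their subformulas, so that
  every state they mention belongs to the automaton.\<close>

lemma formulas_atoms:
  assumes "\<phi> \<in> set (formulas A)"
  shows "\<exists>k \<psi>. (k, \<psi>) \<in> set (transitions A) \<and> atoms \<phi> \<subseteq> atoms \<psi>"
proof -
  from assms obtain k \<psi> where *: "(k, \<psi>) \<in> set (transitions A)" "\<phi> \<in> set (saturate pbf_children \<psi>)"
    by (auto simp: formulas_def)
  from *(2) have "atoms \<phi> \<subseteq> atoms \<psi>"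
    by (induction rule: saturate_induct) (auto simp: pbf_children_def split: pbf.splits)
  with *(1) show ?thesis by blast
qed

lemma has_type_apps_params:
  assumes "\<Sigma> c = Some (arrows (map snd ys) Iota)" "distinct (map fst ys)"
  shows "has_type \<Sigma> (map_of ys) (apps (Sym c) (map (Var \<circ> fst) ys)) Iota"
  unfolding has_type_apps
  by (rule exI[of _ "map snd ys"]) (use assms in \<open>auto simp: list_all2_conv_all_nth\<close>)

lemma in_concat_map: "x \<in> set xs \<Longrightarrow> y \<in> set (f x) \<Longrightarrow> y \<in> set (concat (map f xs))"
  by auto

section \<open>Acceptance is equivalent to provability of the translated query\<close>

locale hors_to_msl = model_checking +
  assumes wf_hors: "wf_hors \<G>" and wf_automaton: "wf_automaton (constants \<G>) A"
begin

abbreviation "I \<equiv> msl_of_hors (\<G>, A)"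
abbreviation "\<Sigma> \<equiv> map_of (signature I)"
abbreviation "D \<equiv> set (definite I)"
abbreviation "tr \<equiv> map_tm symbol_code"

text \<open>The codes of nonterminals and constants are disjoint, so neither block of the joint
  signature shadows the other.\<close>

lemma signature_symbol_code: "\<Sigma> (symbol_code h) = hsig \<G> h"
proof -
  have *: "map_of (map (\<lambda>n. (f (fst n), g (snd n))) xs) (f k) = map_option g (map_of xs k)"
    if "inj f" for f :: "nat \<Rightarrow> nat" and g :: "'a \<Rightarrow> ctype" and xs k
    using that by (induction xs) (auto dest: injD)
  have "map_of (map (\<lambda>n. (f (fst n), g (snd n))) xs) c = None" if "\<And>k. f k \<noteq> c"
    for f :: "nat \<Rightarrow> nat" and g :: "'a \<Rightarrow> ctype" and xs c
    using that by (induction xs) auto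
  note * = * this
  show ?thesis
    using *(1)[of "\<lambda>f. symbol_code (NT f)" "\<lambda>\<gamma>. \<gamma>" "nonterminals \<G>"]
      *(1)[of "\<lambda>a. symbol_code (Con a)" con_type "constants \<G>"]
      *(2)[of "\<lambda>f. symbol_code (NT f)" "symbol_code (Con a)" "\<lambda>\<gamma>. \<gamma>" "nonterminals \<G>" for a]
      *(2)[of "\<lambda>a. symbol_code (Con a)" "symbol_code (NT f)" con_type "constants \<G>" for f]
    by (cases h) (simp_all add: msl_of_hors_def map_add_def inj_def con_type_def[abs_def] option.map_ident split: option.split)
qed

lemma distinct_signature: "distinct (map fst (signature I))"
  using wf_hors
  by (auto simp: msl_of_hors_def wf_hors_def distinct_map comp_def inj_on_def split: prod.splits)

lemma has_type_tr: "has_type (hsig \<G>) \<Gamma> t \<gamma> \<Longrightarrow> has_type \<Sigma> \<Gamma> (tr t) \<gamma>"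
  by (erule has_type_map_tm) (simp add: signature_symbol_code)

lemma wf_rule:
  assumes "(f, ys, t) \<in> set (rules \<G>)"
  obtains \<gamma>s where "distinct ys" "length \<gamma>s = length ys" "hsig \<G> (NT f) = Some (arrows \<gamma>s Iota)"
    "has_type (hsig \<G>) (map_of (zip ys \<gamma>s)) t Iota"
  using wf_hors assms unfolding wf_hors_def by fast

lemma clause_cases:
  assumes "C \<in> D"
  obtains (Rule) f ys t \<gamma>s q where "(f, ys, t) \<in> set (rules \<G>)" "distinct ys" "length \<gamma>s = length ys"
      "hsig \<G> (NT f) = Some (arrows \<gamma>s Iota)" "has_type (hsig \<G>) (map_of (zip ys \<gamma>s)) t Iota"
      "q \<in> set (states A)"
      "C = ConClause (symbol_code (NT f)) (zip ys \<gamma>s) (GAtom (state_pred q) (tr t)) (state_pred q)"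
  | (Transition) q a \<phi> m where "((q, a), \<phi>) \<in> set (transitions A)" "(a, m) \<in> set (constants \<G>)"
      "C = con_clause (a, m) (GAtom (formula_pred \<phi>) (con_term a m)) (state_pred q)"
  | (Formula) \<phi> a m G where "\<phi> \<in> set (formulas A)" "(a, m) \<in> set (constants \<G>)"
      "G \<in> set (formula_bodies (a, m) \<phi>)" "C = con_clause (a, m) G (formula_pred \<phi>)"
proof -
  from assms consider "C \<in> set (rule_clauses \<G> A)" | "C \<in> set (transition_clauses \<G> A)"
    | "C \<in> set (formula_clauses \<G> A)"
    by (auto simp: msl_of_hors_def)
  then show thesis
  proof cases
    case 1
    then obtain f \<gamma> ys t q where *: "(f, \<gamma>) \<in> set (nonterminals \<G>)" "(f, ys, t) \<in> set (rules \<G>)"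
      "q \<in> set (states A)" "C = ConClause (symbol_code (NT f)) (typed_params ys \<gamma>)
        (GAtom (state_pred q) (tr t)) (state_pred q)"
      by (auto simp: rule_clauses_def split: if_splits)
    from wf_rule[OF *(2)] obtain \<gamma>s where \<gamma>s: "distinct ys" "length \<gamma>s = length ys"
      "hsig \<G> (NT f) = Some (arrows \<gamma>s Iota)" "has_type (hsig \<G>) (map_of (zip ys \<gamma>s)) t Iota" .
    moreover from *(1) wf_hors have "map_of (nonterminals \<G>) f = Some \<gamma>"
      by (simp add: wf_hors_def)
    ultimately have "typed_params ys \<gamma> = zip ys \<gamma>s"
      by (simp add: typed_params_arrows)
    with * \<gamma>s show ?thesis by (intro Rule) auto
  next
    case 2
    with Transition show ?thesis by (auto simp: transition_clauses_def split: if_splits)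
  next
    case 3
    with Formula show ?thesis by (auto simp: formula_clauses_def)
  qed
qed

lemma rule_clause:
  assumes "(f, ys, t) \<in> set (rules \<G>)" "length \<gamma>s = length ys"
    "hsig \<G> (NT f) = Some (arrows \<gamma>s Iota)" "q \<in> set (states A)"
  shows "ConClause (symbol_code (NT f)) (zip ys \<gamma>s) (GAtom (state_pred q) (tr t)) (state_pred q) \<in> D"
proof -
  have n: "(f, arrows \<gamma>s Iota) \<in> set (nonterminals \<G>)"
    using assms(3) by (simp add: map_of_SomeD)
  have "ConClause (symbol_code (NT f)) (zip ys \<gamma>s) (GAtom (state_pred q) (tr t)) (state_pred q)
      \<in> set (rule_clauses \<G> A)"
    unfolding rule_clauses_def
    by (rule in_concat_map[OF n], rule in_concat_map[OF assms(1)])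
      (simp add: assms typed_params_arrows)
  then show ?thesis by (simp add: msl_of_hors_def)
qed

lemma transition_clause:
  assumes "((q, a), \<phi>) \<in> set (transitions A)" "(a, m) \<in> set (constants \<G>)"
  shows "con_clause (a, m) (GAtom (formula_pred \<phi>) (con_term a m)) (state_pred q) \<in> D"
proof -
  have "con_clause (a, m) (GAtom (formula_pred \<phi>) (con_term a m)) (state_pred q)
      \<in> set (transition_clauses \<G> A)"
    unfolding transition_clauses_def
    by (rule in_concat_map[OF assms(1)], rule in_concat_map[OF assms(2)]) simp
  then show ?thesis by (simp add: msl_of_hors_def)
qed

lemma formula_clause:
  assumes "\<phi> \<in> set (formulas A)" "(a, m) \<in> set (constants \<G>)" "G \<in> set (formula_bodies (a, m) \<phi>)"
  shows "con_clause (a, m) G (formula_pred \<phi>) \<in> D"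
proof -
  have "con_clause (a, m) G (formula_pred \<phi>) \<in> set (formula_clauses \<G> A)"
    unfolding formula_clauses_def
    by (rule in_concat_map[OF assms(1)], rule in_concat_map[OF assms(2)]) (simp add: assms(3))
  then show ?thesis by (simp add: msl_of_hors_def)
qed

lemma distinct_transitions: "distinct (map fst (transitions A))"
  using wf_automaton by (simp only: wf_automaton_def)

lemma domain_transitions: "fst ` set (transitions A) = set (states A) \<times> fst ` set (constants \<G>)"
  using wf_automaton by (simp only: wf_automaton_def)

lemma transition_atoms:
  assumes "((q, a), \<phi>) \<in> set (transitions A)" "map_of (constants \<G>) a = Some m"
  shows "atoms \<phi> \<subseteq> {1..m} \<times> set (states A)"
proof -
  have "\<forall>((q, a), \<phi>) \<in> set (transitions A). \<forall>m. map_of (constants \<G>) a = Some m \<longrightarrow>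
      atoms \<phi> \<subseteq> {1..m} \<times> set (states A)"
    using wf_automaton unfolding wf_automaton_def by (elim conjE)
  from bspec[OF this assms(1)] assms(2) show ?thesis by simp
qed

lemma transition_eq: "((q, a), \<phi>) \<in> set (transitions A) \<Longrightarrow> transition A q (Const a) = \<phi>"
  by (simp add: distinct_transitions)

text \<open>The transition list is total on states and constants, so the \<open>the\<close> in
  \<open>transition\<close> is applied to an actual entry here.\<close>

lemma ex_transition:
  assumes "q \<in> set (states A)" "(a, m) \<in> set (constants \<G>)"
  shows "((q, a), transition A q (Const a)) \<in> set (transitions A)"
proof -
  have "(q, a) \<in> fst ` set (transitions A)"
    unfolding domain_transitions using assms by (metis SigmaI fst_conv image_eqI)
  then obtain \<phi> where "((q, a), \<phi>) \<in> set (transitions A)" by auto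
  with transition_eq show ?thesis by metis
qed

lemma con_params [simp]:
  "map (Var \<circ> fst) (con_params m) = map Var [0..<m]"
  "map fst (con_params m) = [0..<m]" "map snd (con_params m) = replicate m Iota"
  by (simp_all add: con_params_def comp_def map_replicate_const)

lemma provable_con_clause:
  assumes "con_clause (a, m) G P \<in> D" "list_all2 (closed_term \<Sigma>) ss (replicate m Iota)"
    "provable \<Sigma> D (subst_goal (map_of (zip [0..<m] ss)) G)"
  shows "provable \<Sigma> D (GAtom P (apps (Sym (symbol_code (Con a))) ss))"
  by (rule provable_ConClause[OF assms(1)[unfolded con_clause_def fst_conv snd_conv]])
    (use assms in simp_all)

lemma subst_con_term:
  "length ss = m \<Longrightarrow> subst (map_of (zip [0..<m] ss)) (con_term a m) = apps (Sym (symbol_code (Con a))) ss"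
  using map_subst_Var[of "[0..<m]" ss] by (simp add: con_term_def comp_def del: subst.simps(1))

lemma subst_param:
  "length ss = m \<Longrightarrow> i < m \<Longrightarrow> subst (map_of (zip [0..<m] ss)) (Var i) = ss ! i"
  using map_of_zip_nth[of "[0..<m]" ss i] by simp

text \<open>\<open>Y\<close> is an arbitrary set of child atoms with provable translations. In its
  use, \<open>Y\<close> contains the children accepted with smaller height, for which the outer
  induction supplies provability.\<close>

lemma provable_formula:
  assumes "list_all2 (closed_term \<Sigma>) (map tr ts) (replicate m Iota)" "(a, m) \<in> set (constants \<G>)"
    and Y: "\<And>i q. (i, q) \<in> Y \<Longrightarrow> 1 \<le> i \<and> i \<le> length ts \<and> provable \<Sigma> D (GAtom (state_pred q) (tr (ts ! (i - 1))))"
  shows "\<phi> \<in> set (formulas A) \<Longrightarrow> sat Y \<phi> \<Longrightarrow>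
    provable \<Sigma> D (GAtom (formula_pred \<phi>) (apps (Sym (symbol_code (Con a))) (map tr ts)))"
proof (induction \<phi>)
  case PTrue
  show ?case
    by (rule provable_con_clause[OF formula_clause[OF PTrue(1) assms(2), of GTrue] assms(1)])
      (auto simp: formula_bodies_def intro: provable.intros)
next
  case (PAtom i q)
  have len: "length ts = m" using assms(1) by (auto dest: list_all2_lengthD)
  with Y[of i q] PAtom have i: "1 \<le> i" "i \<le> m" "provable \<Sigma> D (GAtom (state_pred q) (tr (ts ! (i - 1))))"
    by auto
  show ?case
    by (rule provable_con_clause[OF formula_clause[OF PAtom(1) assms(2),
            of "GAtom (state_pred q) (Var (i - 1))"] assms(1)])
      (use i len in \<open>auto simp: formula_bodies_def subst_param simp del: subst.simps\<close>)
next
  case (PAnd \<phi> \<psi>)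
  have len: "length ts = m" using assms(1) by (auto dest: list_all2_lengthD)
  have "\<phi> \<in> set (formulas A)" "\<psi> \<in> set (formulas A)"
    using formulas_children[OF PAnd(3)] by (auto simp: pbf_children_def)
  with PAnd show ?case
    by (intro provable_con_clause[OF formula_clause[OF PAnd(3) assms(2)] assms(1)])
      (auto simp: formula_bodies_def subst_con_term len intro: provable.intros)
next
  case (POr \<phi> \<psi>)
  have len: "length ts = m" using assms(1) by (auto dest: list_all2_lengthD)
  have *: "\<phi> \<in> set (formulas A)" "\<psi> \<in> set (formulas A)"
    using formulas_children[OF POr(3)] by (auto simp: pbf_children_def)
  show ?case
  proof (cases "sat Y \<phi>")
    case True
    with POr * show ?thesis
      by (intro provable_con_clause[OF formula_clause[OF POr(3) assms(2),
            of "GAtom (formula_pred \<phi>) (con_term a m)"] assms(1)])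
        (auto simp: formula_bodies_def subst_con_term len)
  next
    case False
    with POr * show ?thesis
      by (intro provable_con_clause[OF formula_clause[OF POr(3) assms(2),
            of "GAtom (formula_pred \<psi>) (con_term a m)"] assms(1)])
        (auto simp: formula_bodies_def subst_con_term len)
  qed
qed simp

text \<open>Typing is carried through the induction because a clause may be instantiated only with
  closed terms of the types of its binders. The heights play the role of derivation depth.\<close>

lemma accepts_provable:
  "accepts n q t \<Longrightarrow> closed_term (hsig \<G>) t Iota \<Longrightarrow> q \<in> set (states A) \<Longrightarrow>
    provable \<Sigma> D (GAtom (state_pred q) (tr t))"
proof (induction n arbitrary: q t)
  case (Suc n)
  from Suc.prems(1) consider t' where "head_step \<G> t t'" "accepts n q t'"
    | a ts where "t = apps (Sym (Con a)) ts"
      "sat (accepted_children (accepts n) ts) (transition A q (Const a))"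
    by auto
  then show ?case
  proof cases
    case 1
    from head_step_closed[OF wf_hors 1(1) Suc.prems(2)] obtain f ys b ss \<gamma>s where
      r: "(f, ys, b) \<in> set (rules \<G>)" "t = apps (Sym (NT f)) ss" "t' = subst (map_of (zip ys ss)) b"
      "hsig \<G> (NT f) = Some (arrows \<gamma>s Iota)" "length \<gamma>s = length ys"
      "list_all2 (closed_term (hsig \<G>)) ss \<gamma>s" "closed_term (hsig \<G>) t' Iota"
      by blast
    have "distinct ys" using wf_rule[OF r(1)] by blast
    have "provable \<Sigma> D (GAtom (state_pred q) (apps (Sym (symbol_code (NT f))) (map tr ss)))"
    proof (rule provable_ConClause[OF rule_clause[OF r(1,5,4) Suc.prems(3)]])
      show "list_all2 (closed_term \<Sigma>) (map tr ss) (map snd (zip ys \<gamma>s))"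
        using r(5,6) by (auto simp: list_all2_conv_all_nth intro: has_type_tr)
      show "provable \<Sigma> D (subst_goal (map_of (zip (map fst (zip ys \<gamma>s)) (map tr ss)))
          (GAtom (state_pred q) (tr b)))"
        using Suc.IH[OF 1(2) r(7) Suc.prems(3)] r(3,5) by (simp add: map_tm_subst_zip)
    qed (use \<open>distinct ys\<close> r(5) in simp)
    with r(2) show ?thesis by simp
  next
    case 2
    from Suc.prems(2) 2(1) obtain m where m: "(a, m) \<in> set (constants \<G>)"
      "list_all2 (closed_term (hsig \<G>)) ts (replicate m Iota)"
      by (auto simp: has_type_apps dest!: map_of_SomeD)
    then have ty: "list_all2 (closed_term \<Sigma>) (map tr ts) (replicate m Iota)"
      by (auto simp: list_all2_conv_all_nth intro: has_type_tr)
    have \<phi>: "((q, a), transition A q (Const a)) \<in> set (transitions A)"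
      using Suc.prems(3) m(1) by (rule ex_transition)
    have "provable \<Sigma> D (GAtom (formula_pred (transition A q (Const a)))
        (apps (Sym (symbol_code (Con a))) (map tr ts)))"
      by (rule provable_formula[OF ty m(1) _ formulas_transition[OF \<phi>] 2(2)])
        (use m(2) in \<open>auto intro!: Suc.IH simp: list_all2_conv_all_nth\<close>)
    with ty have "provable \<Sigma> D (GAtom (state_pred q) (apps (Sym (symbol_code (Con a))) (map tr ts)))"
      by (intro provable_con_clause[OF transition_clause[OF \<phi> m(1)]])
        (auto simp: subst_con_term dest: list_all2_lengthD)
    with 2(1) show ?thesis by simp
  qed
qed simp

text \<open>The intended model, used as an invariant of derivations: state predicates mean
  acceptance, formula predicates mean that the accepted children satisfy the formula. The truth of a
  formula depends on the arguments alone, so the constant \<open>a\<close> is arbitrary. Quantified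
  goals do not occur in the translated clauses or the query.\<close>

fun holds :: "goal \<Rightarrow> bool" where
  "holds (GAtom P s) \<longleftrightarrow>
     (\<forall>q t. P = state_pred q \<longrightarrow> s = tr t \<longrightarrow> accepted q t) \<and>
     (\<forall>\<phi> a ts. P = formula_pred \<phi> \<longrightarrow> s = tr (apps (Sym (Con a)) ts) \<longrightarrow>
        sat (accepted_children accepted ts) \<phi>)"
| "holds (GAnd G H) \<longleftrightarrow> holds G \<and> holds H"
| "holds _ \<longleftrightarrow> True"

lemma formula_atom_states: "PAtom i q \<in> set (formulas A) \<Longrightarrow> q \<in> set (states A)"
proof -
  assume "PAtom i q \<in> set (formulas A)"
  from formulas_atoms[OF this] obtain p a \<psi> where \<psi>: "((p, a), \<psi>) \<in> set (transitions A)" "(i, q) \<in> atoms \<psi>"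
    by auto
  from \<psi>(1) have "(p, a) \<in> fst ` set (transitions A)" by force
  then have "a \<in> fst ` set (constants \<G>)"
    unfolding domain_transitions by blast
  then obtain m where "map_of (constants \<G>) a = Some m"
    by (metis domD dom_map_of_conv_image_fst)
  from transition_atoms[OF \<psi>(1) this] \<psi>(2) show ?thesis by blast
qed

lemma provable_holds: "provable \<Sigma> D G \<Longrightarrow> holds G"
proof (induction rule: provable.induct)
  case (4 C ss \<sigma>)
  \<comment> \<open>Transition and formula clauses share the shape of their heads. Pulling the spine
    of the instantiated head back along \<open>tr\<close> recovers the arguments \<open>ts\<close>,
    and only a claim about these is left for each kind of clause.\<close>
  have con: "holds (subst_goal \<sigma> (head C))" if C: "C = con_clause (a, m) G P" and
    *: "\<And>ts. ss = map tr ts \<Longrightarrow> length ts = m \<Longrightarrow>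
      (\<forall>q. P = state_pred q \<longrightarrow> accepted q (apps (Sym (Con a)) ts)) \<and>
      (\<forall>\<phi>. P = formula_pred \<phi> \<longrightarrow>
        sat (accepted_children accepted ts) \<phi>)"
    for a m G P
  proof -
    have len: "length ss = m"
      using 4(2) by (auto simp: C con_clause_def dest: list_all2_lengthD)
    have "subst_goal \<sigma> (head C) = GAtom P (apps (Sym (symbol_code (Con a))) ss)"
      using len by (simp add: C con_clause_def 4(3) map_subst_Var)
    moreover have "accepted q t" if t: "P = state_pred q" "apps (Sym (symbol_code (Con a))) ss = tr t" for q t
    proof -
      from map_tm_eq_apps_Sym[OF t(2)[symmetric]] obtain ts
        where "t = apps (Sym (Con a)) ts" "ss = map tr ts" by auto
      with *[of ts] len t(1) show ?thesis by simp
    qed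
    moreover have "sat (accepted_children accepted ts) \<phi>"
      if t: "P = formula_pred \<phi>" "apps (Sym (symbol_code (Con a))) ss = tr (apps (Sym (Con b)) ts)" for \<phi> b ts
    proof -
      from t(2) have "ss = map tr ts" by simp
      with *[of ts] len t(1) show ?thesis by simp
    qed
    ultimately show ?thesis by (simp only: holds.simps) blast
  qed
  from 4(1) show ?case
  proof (cases rule: clause_cases)
    case (Rule f ys t \<gamma>s q)
    have len: "length ss = length ys"
      using 4(2) Rule(3) by (auto simp: Rule(7) dest: list_all2_lengthD)
    have \<sigma>: "\<sigma> = map_of (zip ys ss)"
      using 4(3) Rule(3) by (simp add: Rule(7))
    have "subst_goal \<sigma> (head C) = GAtom (state_pred q) (apps (Sym (symbol_code (NT f))) ss)"
      using len map_subst_Var_fst[of "zip ys \<gamma>s" ss] Rule(2,3)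
      by (simp add: Rule(7) \<sigma> comp_def del: subst.simps(1))
    moreover have "accepted q t'" if t': "apps (Sym (symbol_code (NT f))) ss = tr t'" for t'
    proof -
      from map_tm_eq_apps_Sym[OF t'[symmetric]] obtain ts
        where ts: "t' = apps (Sym (NT f)) ts" "ss = map tr ts" by auto
      with 4(5) have "accepted q (subst (map_of (zip ys ts)) t)"
        by (auto simp: Rule(7) \<sigma> map_tm_subst_zip)
      moreover have "head_step \<G> t' (subst (map_of (zip ys ts)) t)"
        unfolding ts(1) by (rule head_step.unfold[OF Rule(1)]) (use len ts(2) in simp)
      ultimately show ?thesis by (rule accepted_step[rotated])
    qed
    ultimately show ?thesis by auto
  next
    case (Transition q a \<phi> m)
    show ?thesis
    proof (rule con[OF Transition(3)])
      fix ts assume ts: "ss = map tr ts" "length ts = m"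
      with 4(5) have "sat (accepted_children accepted ts) \<phi>"
        by (auto simp: Transition(3) con_clause_def 4(3) subst_con_term)
      then show "(\<forall>q'. state_pred q = state_pred q' \<longrightarrow> accepted q' (apps (Sym (Con a)) ts)) \<and>
        (\<forall>\<phi>. state_pred q = formula_pred \<phi> \<longrightarrow>
          sat (accepted_children accepted ts) \<phi>)"
        using transition_eq[OF Transition(1)] accepted_Con[of ts q a] by simp
    qed
  next
    case (Formula \<phi> a m G)
    show ?thesis
    proof (rule con[OF Formula(4)])
      fix ts assume ts: "ss = map tr ts" "length ts = m"
      have \<sigma>: "\<sigma> = map_of (zip [0..<m] (map tr ts))"
        by (simp add: 4(3) Formula(4) con_clause_def ts)
      have "holds (subst_goal \<sigma> G)"
        using 4(5) by (simp add: Formula(4) con_clause_def)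
      then have "sat (accepted_children accepted ts) \<phi>"
        using Formula(1,3) ts(2) unfolding formula_bodies_def \<sigma>
        by (cases \<phi>) (auto simp: subst_con_term subst_param formula_atom_states simp del: subst.simps(1) split: if_splits)
      then show "(\<forall>q'. formula_pred \<phi> = state_pred q' \<longrightarrow> accepted q' (apps (Sym (Con a)) ts)) \<and>
        (\<forall>\<psi>. formula_pred \<phi> = formula_pred \<psi> \<longrightarrow>
          sat (accepted_children accepted ts) \<psi>)"
        by simp
    qed
  qed
qed auto

section \<open>Well-formedness of the translated instance\<close>

lemma set_predicates:
  "set (predicates I) = state_pred ` set (states A) \<union> formula_pred ` set (formulas A)"
  by (simp add: msl_of_hors_def)

lemma signature_type: "hsig \<G> h = Some \<gamma> \<Longrightarrow> \<Sigma> (symbol_code h) = Some \<gamma>"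
  by (simp add: signature_symbol_code)

lemma has_type_con_term:
  assumes "(a, m) \<in> set (constants \<G>)"
  shows "has_type \<Sigma> (map_of (con_params m)) (con_term a m) Iota"
proof -
  have "map_of (constants \<G>) a = Some m"
    using wf_hors assms by (simp add: wf_hors_def)
  then have "\<Sigma> (symbol_code (Con a)) = Some (arrows (replicate m Iota) Iota)"
    by (simp add: signature_symbol_code)
  with has_type_apps_params[of \<Sigma> "symbol_code (Con a)" "con_params m"] show ?thesis
    by (simp add: con_term_def)
qed

lemma wf_con_clause:
  assumes "(a, m) \<in> set (constants \<G>)" "P \<in> set (predicates I)"
    "wf_goal \<Sigma> (set (predicates I)) (map_of (con_params m)) G"
  shows "wf_clause \<Sigma> (set (predicates I)) (con_clause (a, m) G P)"
  using assms has_type_con_term[OF assms(1)] by (simp add: wf_clause_def con_clause_def con_term_def)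

lemma wf_clauses:
  assumes "C \<in> D" shows "wf_clause \<Sigma> (set (predicates I)) C"
  using assms
proof (cases rule: clause_cases)
  case (Rule f ys t \<gamma>s q)
  have "\<Sigma> (symbol_code (NT f)) = Some (arrows (map snd (zip ys \<gamma>s)) Iota)"
    using signature_type[OF Rule(4)] Rule(3) by simp
  then have "has_type \<Sigma> (map_of (zip ys \<gamma>s))
      (apps (Sym (symbol_code (NT f))) (map (Var \<circ> fst) (zip ys \<gamma>s))) Iota"
    by (rule has_type_apps_params) (simp add: Rule(2,3))
  then show ?thesis
    using Rule(2,3,6) has_type_tr[OF Rule(5)]
    by (simp add: Rule(7) wf_clause_def set_predicates del: map_map)
next
  case (Transition q a \<phi> m)
  have "q \<in> set (states A)"
    using Transition(1) domain_transitions by force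
  with Transition(2) formulas_transition[OF Transition(1)] show ?thesis
    unfolding Transition(3)
    by (intro wf_con_clause) (simp_all add: set_predicates has_type_con_term)
next
  case (Formula \<phi> a m G)
  have children: "formula_pred \<psi> \<in> set (predicates I)" if "\<psi> \<in> set (pbf_children \<phi>)" for \<psi>
    using formulas_children[OF Formula(1) that] by (simp add: set_predicates)
  have "wf_goal \<Sigma> (set (predicates I)) (map_of (con_params m)) G"
  proof (cases \<phi>)
    case (PAtom i q)
    then have "q \<in> set (states A)" "1 \<le> i" "i \<le> m" "G = GAtom (state_pred q) (Var (i - 1))"
      using Formula(1,3) formula_atom_states by (auto simp: formula_bodies_def split: if_splits)
    moreover from this have "map_of (con_params m) (i - 1) = Some Iota"
      by (intro map_of_is_SomeI) (auto simp: con_params_def comp_def)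
    ultimately show ?thesis by (simp add: set_predicates)
  qed (use Formula(2,3) children has_type_con_term[OF Formula(2)] in
      \<open>auto simp: formula_bodies_def pbf_children_def\<close>)
  then show ?thesis
    unfolding Formula(4) using Formula(1,2) by (intro wf_con_clause) (simp_all add: set_predicates)
qed

lemma initial_state: "initial A \<in> set (states A)"
  using wf_automaton by (simp only: wf_automaton_def)

lemma start_type: "hsig \<G> (NT (start \<G>)) = Some Iota"
  using wf_hors by (simp only: wf_hors_def)

lemma query_eq: "query I = GAtom (state_pred (initial A)) (tr (Sym (NT (start \<G>))))"
  by (simp add: msl_of_hors_def)

lemma wf_msl_of_hors: "wf_msl I"
  unfolding wf_msl_def
proof (intro conjI ballI)
  show "distinct (predicates I)" by (simp add: msl_of_hors_def)
  show "wf_goal \<Sigma> (set (predicates I)) Map.empty (query I)"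
    using initial_state signature_type[OF start_type] by (simp add: query_eq set_predicates)
qed (use distinct_signature wf_clauses in auto)

lemma msl_provable_iff: "msl_provable I \<longleftrightarrow> cotrivially_accepts A (value_tree \<G>)"
proof
  assume "msl_provable I"
  then have "holds (query I)"
    unfolding msl_provable_def by (rule provable_holds)
  then show "cotrivially_accepts A (value_tree \<G>)"
    unfolding cotrivially_accepts_iff[OF initial_state] query_eq holds.simps by blast
next
  assume "cotrivially_accepts A (value_tree \<G>)"
  then obtain n where "accepts n (initial A) (Sym (NT (start \<G>)))"
    unfolding cotrivially_accepts_iff[OF initial_state] accepted_def by blast
  then show "msl_provable I"
    unfolding msl_provable_def query_eq
    by (rule accepts_provable) (use start_type initial_state in \<open>simp_all del: hsig.simps\<close>)
qed

end

section \<open>Many-one reductions between encoded problems\<close>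

lemma many_one_reducibleI:
  assumes "cfun f" "\<And>x. P x \<Longrightarrow> Q (f x) \<and> (P' x \<longleftrightarrow> Q' (f x))"
  shows "Problem {encode x | x. P x} {encode x | x. P x \<and> P' x} \<le>\<^sub>m
    Problem {encode y | y. Q y} {encode y | y. Q y \<and> Q' y}"
  unfolding many_one_reducible_def
  by (rule exI[of _ "realizer f"]) (use assms realizer[OF assms(1)] in auto)

lemma msl_problem_eq:
  "msl_omega_provability = Problem {encode I | I. wf_msl I} {encode I | I. wf_msl I \<and> msl_provable I}"
  by (simp add: msl_omega_provability_def encode_msl_instance_def)

lemma hors_problem_eq:
  "hors_cotrivial_model_checking = Problem
     {encode p | p. wf_hors (fst p) \<and> wf_automaton (constants (fst p)) (snd p)}
     {encode p | p. (wf_hors (fst p) \<and> wf_automaton (constants (fst p)) (snd p)) \<and>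
        cotrivially_accepts (snd p) (value_tree (fst p))}"
  by (simp add: hors_cotrivial_model_checking_def encode_prod_def encode_hors_def
      encode_automaton_def)

theorem hors_reducible_to_msl: "hors_cotrivial_model_checking \<le>\<^sub>m msl_omega_provability"
  unfolding msl_problem_eq hors_problem_eq
proof (rule many_one_reducibleI[OF cfun_msl_of_hors])
  fix p assume p: "wf_hors (fst p) \<and> wf_automaton (constants (fst p)) (snd p)"
  then have "distinct (map fst (rules (fst p)))"
    by (simp only: wf_hors_def)
  with p interpret hors_to_msl "fst p" "snd p"
    by unfold_locales blast+
  show "wf_msl (msl_of_hors p) \<and>
      (cotrivially_accepts (snd p) (value_tree (fst p)) \<longleftrightarrow> msl_provable (msl_of_hors p))"
    using wf_msl_of_hors msl_provable_iff by simp
qed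

section \<open>From MSL to recursion schemes\<close>

text \<open>The first component separates the families of nonterminals, and the second determines
  the member. A goal is named together with its context, because the context supplies the parameters
  of the nonterminal.\<close>

definition sym_nt :: "nat \<Rightarrow> nat" where "sym_nt c = prod_encode (0, c)"
definition goal_nt :: "(nat \<times> ctype) list \<Rightarrow> goal \<Rightarrow> nat" where "goal_nt vs G = prod_encode (1, encode (vs, G))"
definition ex_nt :: "ctype \<Rightarrow> nat" where "ex_nt \<gamma> = prod_encode (2, encode \<gamma>)"
definition fun_nt :: "ctype \<Rightarrow> ctype \<Rightarrow> nat" where "fun_nt \<delta> \<gamma> = prod_encode (3, encode (\<delta>, \<gamma>))"
definition arg_nt :: "ctype \<Rightarrow> ctype \<Rightarrow> nat" where "arg_nt \<delta> \<gamma> = prod_encode (4, encode (\<delta>, \<gamma>))"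

lemmas nt_defs = sym_nt_def goal_nt_def ex_nt_def fun_nt_def arg_nt_def

abbreviation nt :: "nat \<Rightarrow> hsym tm" where "nt n \<equiv> Sym (NT n)"

section \<open>The alphabet and the automaton that evaluates goals\<close>

definition true_tm :: "hsym tm" where "true_tm = Sym (Con (prod_encode (0, 0)))"
definition end_tm :: "hsym tm" where "end_tm = Sym (Con (prod_encode (1, 0)))"
definition and_tm :: "hsym tm \<Rightarrow> hsym tm \<Rightarrow> hsym tm" where
  "and_tm s t = App (App (Sym (Con (prod_encode (2, 0)))) s) t"
definition or_tm :: "hsym tm \<Rightarrow> hsym tm \<Rightarrow> hsym tm" where
  "or_tm s t = App (App (Sym (Con (prod_encode (3, 0)))) s) t"
definition clause_tm :: "nat \<Rightarrow> hsym tm \<Rightarrow> hsym tm \<Rightarrow> hsym tm" where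
  "clause_tm P s t = App (App (Sym (Con (prod_encode (4, P)))) s) t"
definition test_tm :: "nat \<Rightarrow> hsym tm \<Rightarrow> hsym tm" where
  "test_tm P s = App (Sym (Con (prod_encode (5, P)))) s"

definition msl_constants :: "nat list \<Rightarrow> (nat \<times> nat) list" where
  "msl_constants \<Pi> = [(prod_encode (0, 0), 0), (prod_encode (1, 0), 0), (prod_encode (2, 0), 2),
     (prod_encode (3, 0), 2)] @ map (\<lambda>P. (prod_encode (4, P), 2)) \<Pi> @ map (\<lambda>P. (prod_encode (5, P), 1)) \<Pi>"

text \<open>The first component of \<open>a\<close> is the kind of constant: 0 truth, 1 end of a
  chain, 2 conjunction, 3 disjunction, 4 a clause body with its predicate, 5 a test of a predicate.
  State 0 evaluates goals. State \<open>Suc P\<close> walks along a clause chain and may enter a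
  body tagged \<open>P\<close>, going back to state 0. A constant of the wrong kind for the state is
  rejected.\<close>

definition msl_transition :: "nat \<Rightarrow> nat \<Rightarrow> pbf" where
  "msl_transition q a =
     (if q = 0 then
        if fst (prod_decode a) = 0 then PTrue
        else if fst (prod_decode a) = 2 then PAnd (PAtom 1 0) (PAtom 2 0)
        else if fst (prod_decode a) = 3 then POr (PAtom 1 0) (PAtom 2 0)
        else if fst (prod_decode a) = 5 then PAtom 1 (Suc (snd (prod_decode a)))
        else PFalse
      else if fst (prod_decode a) = 4 then
        if q = Suc (snd (prod_decode a)) then POr (PAtom 1 0) (PAtom 2 q) else PAtom 2 q
      else PFalse)"

definition msl_automaton :: "nat list \<Rightarrow> automaton" where
  "msl_automaton \<Pi> = Automaton (0 # map Suc \<Pi>) 0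
     (concat (map (\<lambda>q. map (\<lambda>c. ((q, fst c), msl_transition q (fst c))) (msl_constants \<Pi>)) (0 # map Suc \<Pi>)))"

definition hors_tm :: "nat tm \<Rightarrow> hsym tm" where "hors_tm = map_tm (\<lambda>c. NT (sym_nt c))"

text \<open>A new binding removes the one it shadows, as the parameters of a definition have to be distinct.\<close>

definition extend :: "(nat \<times> ctype) list \<Rightarrow> nat \<Rightarrow> ctype \<Rightarrow> (nat \<times> ctype) list" where
  "extend vs x \<gamma> = filter (\<lambda>v. fst v \<noteq> x) vs @ [(x, \<gamma>)]"

section \<open>The definitions of the scheme\<close>

definition goal_call :: "(nat \<times> ctype) list \<Rightarrow> goal \<Rightarrow> hsym tm list \<Rightarrow> hsym tm" where
  "goal_call vs G ts = apps (nt (goal_nt vs G)) ts"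

definition vars :: "(nat \<times> ctype) list \<Rightarrow> 'f tm list" where "vars vs = map (\<lambda>v. Var (fst v)) vs"

text \<open>For a quantified goal, \<open>extend\<close> puts the bound variable last, so the call
  with the remaining variables is a partial application of type \<open>Arrow \<gamma> Iota\<close>:
  just the predicate on witnesses that the enumerator expects as its continuation.\<close>

definition goal_body :: "(nat \<times> ctype) list \<Rightarrow> goal \<Rightarrow> hsym tm" where
  "goal_body vs G = (case G of
     GTrue \<Rightarrow> true_tm
   | GAtom P s \<Rightarrow> test_tm P (hors_tm s)
   | GAnd G H \<Rightarrow> and_tm (goal_call vs G (vars vs)) (goal_call vs H (vars vs))
   | GEx x \<gamma> G \<Rightarrow> App (nt (ex_nt \<gamma>)) (goal_call (extend vs x \<gamma>) G (vars (filter (\<lambda>v. fst v \<noteq> x) vs))))"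

definition clause_chain :: "(nat \<times> hsym tm) list \<Rightarrow> hsym tm" where
  "clause_chain us = foldr (\<lambda>u. clause_tm (fst u) (snd u)) us end_tm"

text \<open>The parameters of a symbol are numbered \<open>0\<close> to \<open>n - 1\<close>, and
  the binders of a clause for that symbol are matched to them by position. A
  \<open>VarClause\<close> applies to every symbol and needs the whole term, which is rebuilt from
  the symbol and its parameters.\<close>

definition clause_call :: "nat \<Rightarrow> nat \<Rightarrow> clause \<Rightarrow> (nat \<times> hsym tm) list" where
  "clause_call c n C = (case C of
     VarClause y G P \<Rightarrow> [(P, goal_call [(y, Iota)] G [apps (nt (sym_nt c)) (map Var [0..<n])])]
   | ConClause d ys G P \<Rightarrow> if d = c then [(P, goal_call ys G (map Var [0..<n]))] else [])"

definition clause_calls :: "clause list \<Rightarrow> nat \<Rightarrow> nat \<Rightarrow> (nat \<times> hsym tm) list" where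
  "clause_calls Cs c n = concat (map (clause_call c n) Cs)"

definition or_chain :: "hsym tm list \<Rightarrow> hsym tm" where
  "or_chain us = foldr or_tm us end_tm"

definition ex_choices :: "(nat \<times> ctype) list \<Rightarrow> ctype list \<Rightarrow> ctype \<Rightarrow> hsym tm list" where
  "ex_choices \<Sigma> \<tau>s \<gamma> =
     map (\<lambda>c. App (Var 0) (nt (sym_nt (fst c)))) (filter (\<lambda>c. snd c = \<gamma>) \<Sigma>) @
     concat (map (\<lambda>\<tau>. case \<tau> of Iota \<Rightarrow> [] | Arrow \<delta> \<gamma>' \<Rightarrow>
       if \<gamma>' = \<gamma> then [App (nt (ex_nt (Arrow \<delta> \<gamma>))) (App (nt (fun_nt \<delta> \<gamma>)) (Var 0))] else []) \<tau>s)"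

fun arity :: "ctype \<Rightarrow> nat" where
  "arity Iota = 0"
| "arity (Arrow \<gamma> \<delta>) = Suc (arity \<delta>)"

definition ctype_children :: "ctype \<Rightarrow> ctype list" where
  "ctype_children \<tau> = (case \<tau> of Iota \<Rightarrow> [] | Arrow \<gamma> \<delta> \<Rightarrow> [\<gamma>, \<delta>])"

definition goal_children :: "(nat \<times> ctype) list \<times> goal \<Rightarrow> ((nat \<times> ctype) list \<times> goal) list" where
  "goal_children g = (case snd g of GTrue \<Rightarrow> [] | GAtom P s \<Rightarrow> [] | GAnd G H \<Rightarrow> [(fst g, G), (fst g, H)]
     | GEx x \<gamma> G \<Rightarrow> [(extend (fst g) x \<gamma>, G)])"

definition ex_types :: "goal \<Rightarrow> ctype list" where
  "ex_types G = (case G of GTrue \<Rightarrow> [] | GAtom P s \<Rightarrow> [] | GAnd G H \<Rightarrow> [] | GEx x \<gamma> G \<Rightarrow> [\<gamma>])"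

definition msl_goals :: "msl_instance \<Rightarrow> ((nat \<times> ctype) list \<times> goal) list" where
  "msl_goals I = concat (map (saturate goal_children)
     (([], query I) # map (\<lambda>C. (binders C, body C)) (definite I)))"

definition msl_types :: "msl_instance \<Rightarrow> ctype list" where
  "msl_types I = concat (map (saturate ctype_children)
     (map snd (signature I) @ concat (map (\<lambda>g. ex_types (snd g)) (msl_goals I))))"

type_synonym entry = "nat \<times> ctype \<times> nat list \<times> hsym tm"

definition sym_entry :: "clause list \<Rightarrow> nat \<Rightarrow> ctype \<Rightarrow> entry" where
  "sym_entry Cs c \<gamma> = (sym_nt c, \<gamma>, [0..<arity \<gamma>], clause_chain (clause_calls Cs c (arity \<gamma>)))"

definition goal_entry :: "(nat \<times> ctype) list \<Rightarrow> goal \<Rightarrow> entry" where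
  "goal_entry vs G = (goal_nt vs G, arrows (map snd vs) Iota, map fst vs, goal_body vs G)"

definition ex_entry :: "(nat \<times> ctype) list \<Rightarrow> ctype list \<Rightarrow> ctype \<Rightarrow> entry" where
  "ex_entry \<Sigma> \<tau>s \<gamma> = (ex_nt \<gamma>, Arrow (Arrow \<gamma> Iota) Iota, [0], or_chain (ex_choices \<Sigma> \<tau>s \<gamma>))"

text \<open>The two lifted abstractions of the enumerator: \<open>fun_nt\<close> is the outer
  function of \<open>s\<close>, with \<open>F\<close> as an added parameter, and
  \<open>arg_nt\<close> the inner function of \<open>t\<close>, with \<open>F\<close> and
  \<open>s\<close> added.\<close>

definition fun_entry :: "ctype \<Rightarrow> ctype \<Rightarrow> entry" where
  "fun_entry \<delta> \<gamma> = (fun_nt \<delta> \<gamma>, Arrow (Arrow \<gamma> Iota) (Arrow (Arrow \<delta> \<gamma>) Iota), [0, 1],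
     App (nt (ex_nt \<delta>)) (App (App (nt (arg_nt \<delta> \<gamma>)) (Var 0)) (Var 1)))"

definition arg_entry :: "ctype \<Rightarrow> ctype \<Rightarrow> entry" where
  "arg_entry \<delta> \<gamma> = (arg_nt \<delta> \<gamma>, Arrow (Arrow \<gamma> Iota) (Arrow (Arrow \<delta> \<gamma>) (Arrow \<delta> Iota)), [0, 1, 2],
     App (Var 0) (App (Var 1) (Var 2)))"

text \<open>Names derive from contents, so a goal that occurs twice gives the same entry twice;
  \<open>remdups\<close> merges the copies and keeps the names distinct.\<close>

definition entries :: "msl_instance \<Rightarrow> entry list" where
  "entries I = remdups
     (map (\<lambda>c. sym_entry (definite I) (fst c) (snd c)) (signature I) @
      map (\<lambda>g. goal_entry (fst g) (snd g)) (msl_goals I) @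
      map (\<lambda>\<tau>. ex_entry (signature I) (msl_types I) \<tau>) (msl_types I) @
      concat (map (\<lambda>\<tau>. case \<tau> of Iota \<Rightarrow> [] | Arrow \<delta> \<gamma> \<Rightarrow> [fun_entry \<delta> \<gamma>, arg_entry \<delta> \<gamma>]) (msl_types I)))"

definition hors_of_msl :: "msl_instance \<Rightarrow> hors \<times> automaton" where
  "hors_of_msl I = (HORS (map (\<lambda>e. (fst e, fst (snd e))) (entries I)) (msl_constants (predicates I))
     (map (\<lambda>e. (fst e, snd (snd e))) (entries I)) (goal_nt [] (query I)), msl_automaton (predicates I))"

section \<open>Computability of the scheme and the automaton\<close>

lemma cfun_arity: "cfun f \<Longrightarrow> cfun (\<lambda>x. arity (f x))"
proof -
  assume f: "cfun f"
  \<comment> \<open>Each round strips one argument type and counts it. \<open>Iota\<close> is left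
    alone, so any number of rounds that is at least the arity will do, and the code of the type is
    such a number.\<close>
  let ?step = "\<lambda>p. case fst p of Iota \<Rightarrow> (Iota, snd p) | Arrow \<gamma> \<delta> \<Rightarrow> (\<delta>, Suc (snd p))"
  have "cfun (\<lambda>x. snd ((?step ^^ encode (f x)) (f x, 0)))"
    by (intro cfun_funpow cfun_intros f)
  moreover have "arity \<gamma> \<le> m \<Longrightarrow> snd ((?step ^^ m) (\<gamma>, k)) = k + arity \<gamma>" for m k \<gamma>
  proof (induction m arbitrary: \<gamma> k)
    case (Suc m)
    then show ?case by (cases \<gamma>) (simp_all add: funpow_Suc_right del: funpow.simps)
  qed simp
  moreover have "arity \<gamma> \<le> encode \<gamma>" for \<gamma>
    by (induction \<gamma>) (auto intro: order_trans[OF _ le_prod_encode_2])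
  ultimately show ?thesis by simp
qed

lemma cfun_hors_of_msl: "cfun hors_of_msl"
proof -
  have nts: "cfun f \<Longrightarrow> cfun (\<lambda>x. sym_nt (f x))" "cfun g \<Longrightarrow> cfun (\<lambda>x. ex_nt (g x))"
    "cfun g \<Longrightarrow> cfun g' \<Longrightarrow> cfun (\<lambda>x. fun_nt (g x) (g' x))"
    "cfun g \<Longrightarrow> cfun g' \<Longrightarrow> cfun (\<lambda>x. arg_nt (g x) (g' x))"
    "cfun h \<Longrightarrow> cfun h' \<Longrightarrow> cfun (\<lambda>x. goal_nt (h x) (h' x))"
    for f :: "'a :: encodable \<Rightarrow> nat" and g g' :: "'a \<Rightarrow> ctype" and h h'
    unfolding nt_defs by (intro cfun_intros; assumption)+
  have tms: "cfun s \<Longrightarrow> cfun t \<Longrightarrow> cfun (\<lambda>x. and_tm (s x) (t x))"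
    "cfun s \<Longrightarrow> cfun t \<Longrightarrow> cfun (\<lambda>x. or_tm (s x) (t x))"
    "cfun P \<Longrightarrow> cfun s \<Longrightarrow> cfun t \<Longrightarrow> cfun (\<lambda>x. clause_tm (P x) (s x) (t x))"
    "cfun P \<Longrightarrow> cfun s \<Longrightarrow> cfun (\<lambda>x. test_tm (P x) (s x))"
    for P :: "'a :: encodable \<Rightarrow> nat" and s t
    unfolding and_tm_def or_tm_def clause_tm_def test_tm_def by (intro cfun_intros; assumption)+
  have constants: "cfun f \<Longrightarrow> cfun (\<lambda>x. msl_constants (f x))" for f :: "'a :: encodable \<Rightarrow> _"
    unfolding msl_constants_def by (intro cfun_intros)
  have transition: "cfun f \<Longrightarrow> cfun g \<Longrightarrow> cfun (\<lambda>x. msl_transition (f x) (g x))" for f g :: "'a :: encodable \<Rightarrow> _"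
    unfolding msl_transition_def by (intro cfun_intros)
  have "cfun msl_automaton"
    unfolding msl_automaton_def by (intro cfun_intros constants transition)
  note automaton = cfun_comp[OF this]
  have "cfun (\<lambda>c. NT (sym_nt c))"
    by (intro cfun_intros nts)
  then have tm: "cfun f \<Longrightarrow> cfun (\<lambda>x. hors_tm (f x))" for f :: "'a :: encodable \<Rightarrow> _"
    unfolding hors_tm_def by (rule cfun_map_tm)
  have "cfun (\<lambda>p. extend (fst p) (fst (snd p)) (snd (snd p)))"
    unfolding extend_def by (intro cfun_intros)
  note extend = cfun_comp[OF this cfun_Pair[OF _ cfun_Pair], simplified]
  have call: "cfun f \<Longrightarrow> cfun g \<Longrightarrow> cfun h \<Longrightarrow> cfun (\<lambda>x. goal_call (f x) (g x) (h x))"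
    for f :: "'a :: encodable \<Rightarrow> _" and g h
    unfolding goal_call_def by (intro cfun_apps cfun_intros nts)
  have vars: "cfun f \<Longrightarrow> cfun (\<lambda>x. vars (f x) :: hsym tm list)" for f :: "'a :: encodable \<Rightarrow> _"
    unfolding vars_def by (intro cfun_intros)
  have "cfun (\<lambda>p. goal_body (fst p) (snd p))"
    unfolding goal_body_def by (intro cfun_intros tms nts call vars extend tm)
  note goal_body = cfun_comp2[OF this]
  have clause_chain: "cfun f \<Longrightarrow> cfun (\<lambda>x. clause_chain (f x))" for f :: "'a :: encodable \<Rightarrow> _"
    unfolding clause_chain_def by (intro cfun_intros tms)
  have "cfun (\<lambda>p. clause_calls (fst p) (fst (snd p)) (snd (snd p)))"
    unfolding clause_calls_def clause_call_def by (intro cfun_intros call nts cfun_apps)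
  note clause_calls = cfun_comp[OF this cfun_Pair[OF _ cfun_Pair], simplified]
  have or_chain: "cfun f \<Longrightarrow> cfun (\<lambda>x. or_chain (f x))" for f :: "'a :: encodable \<Rightarrow> _"
    unfolding or_chain_def by (intro cfun_intros tms)
  have "cfun (\<lambda>p. ex_choices (fst p) (fst (snd p)) (snd (snd p)))"
    unfolding ex_choices_def by (intro cfun_intros nts)
  note ex_choices = cfun_comp[OF this cfun_Pair[OF _ cfun_Pair], simplified]
  have ctype_children: "cfun ctype_children"
    unfolding ctype_children_def by (intro cfun_intros)
  have goal_children: "cfun goal_children"
    unfolding goal_children_def by (intro cfun_intros extend)
  have ex_types: "cfun f \<Longrightarrow> cfun (\<lambda>x. ex_types (f x))" for f :: "'a :: encodable \<Rightarrow> _"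
    unfolding ex_types_def by (intro cfun_intros)
  have binders: "cfun f \<Longrightarrow> cfun (\<lambda>x. binders (f x))" "cfun f \<Longrightarrow> cfun (\<lambda>x. body (f x))"
    for f :: "'a :: encodable \<Rightarrow> _"
  proof -
    have "binders C = (case C of VarClause y G P \<Rightarrow> [(y, Iota)] | ConClause c ys G P \<Rightarrow> ys)"
      "body C = (case C of VarClause y G P \<Rightarrow> G | ConClause c ys G P \<Rightarrow> G)" for C
      by (cases C; simp)+
    then show "cfun f \<Longrightarrow> cfun (\<lambda>x. binders (f x))" "cfun f \<Longrightarrow> cfun (\<lambda>x. body (f x))"
      by (simp_all only:) (intro cfun_intros; assumption)+
  qed
  have goals: "cfun f \<Longrightarrow> cfun (\<lambda>x. msl_goals (f x))" for f :: "'a :: encodable \<Rightarrow> _"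
    unfolding msl_goals_def by (intro cfun_intros cfun_saturate goal_children binders)
  have types: "cfun f \<Longrightarrow> cfun (\<lambda>x. msl_types (f x))" for f :: "'a :: encodable \<Rightarrow> _"
    unfolding msl_types_def by (intro cfun_intros cfun_saturate ctype_children goals ex_types)
  have arrows: "cfun f \<Longrightarrow> cfun (\<lambda>x. arrows (f x) Iota)" for f :: "'a :: encodable \<Rightarrow> _"
    unfolding arrows_def by (intro cfun_intros)
  have entries: "cfun entries"
    unfolding entries_def sym_entry_def goal_entry_def ex_entry_def fun_entry_def arg_entry_def
    by (intro cfun_intros nts goal_body clause_chain clause_calls or_chain ex_choices goals types
        arrows cfun_arity)
  show ?thesis
    unfolding hors_of_msl_def
    by (intro cfun_intros cfun_comp[OF entries] constants automaton nts)
qed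

section \<open>Closure of the collected goals and types\<close>

lemma size_goal_children: "h \<in> set (goal_children g) \<Longrightarrow> size (snd h) < size (snd g)"
  by (auto simp: goal_children_def split: goal.splits)

lemma size_le_encode_goal: "size G \<le> encode (G :: goal)"
proof -
  have "Suc (n + k) \<le> list_encode [i, n, k]" for i n k
    using add_le_prod_encode[of i "list_encode [n, k]"] add_le_prod_encode[of n "list_encode [k]"]
      add_le_prod_encode[of k 0] by simp
  note 1 = order_trans[OF _ this]
  have "Suc k \<le> list_encode [i, n, m, k]" for i n m k
    using add_le_prod_encode[of i "list_encode [n, m, k]"] add_le_prod_encode[of n "list_encode [m, k]"]
      add_le_prod_encode[of m "list_encode [k]"] add_le_prod_encode[of k 0] by simp
  note 2 = order_trans[OF _ this]
  show ?thesis
    by (induction G) (auto intro!: 1 2 simp del: list_encode.simps)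
qed

lemma size_le_encode_ctype: "size \<gamma> \<le> encode (\<gamma> :: ctype)"
proof (induction \<gamma>)
  case (Arrow \<gamma> \<delta>)
  then show ?case using add_le_prod_encode[of "encode \<gamma>" "encode \<delta>"] by simp
qed simp

lemma concat_saturate_self: "x \<in> set xs \<Longrightarrow> x \<in> set (concat (map (saturate f) xs))"
  by (rule in_concat_map[where f = "saturate f", OF _ saturate_self])

lemma concat_saturate_step:
  assumes "\<And>y z. z \<in> set (f y) \<Longrightarrow> rank z < (rank y :: nat)" "\<And>x. rank x \<le> encode x"
    and "y \<in> set (concat (map (saturate f) xs))" "z \<in> set (f y)"
  shows "z \<in> set (concat (map (saturate f) xs))"
  using assms(3) saturate_step[where f = f and rank = rank, OF assms(1,2) _ assms(4)] by auto

lemma msl_goals_children: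
  assumes "g \<in> set (msl_goals I)" "h \<in> set (goal_children g)"
  shows "h \<in> set (msl_goals I)"
proof -
  have "size (snd x) \<le> encode x" for x :: "(nat \<times> ctype) list \<times> goal"
    using le_prod_encode_2[of "encode (snd x)" "encode (fst x)"] size_le_encode_goal[of "snd x"]
    by (cases x) simp
  from concat_saturate_step[where f = goal_children and rank = "\<lambda>g. size (snd g)",
      OF size_goal_children this] assms
  show ?thesis unfolding msl_goals_def by blast
qed

lemma size_ctype_children: "\<tau>' \<in> set (ctype_children \<tau>) \<Longrightarrow> size \<tau>' < size \<tau>"
  by (auto simp: ctype_children_def split: ctype.splits)

lemma msl_types_children:
  "\<tau> \<in> set (msl_types I) \<Longrightarrow> \<tau>' \<in> set (ctype_children \<tau>) \<Longrightarrow> \<tau>' \<in> set (msl_types I)"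
  unfolding msl_types_def
  by (rule concat_saturate_step[where f = ctype_children and rank = size, OF size_ctype_children
        size_le_encode_ctype])

lemma Arrow_msl_types:
  assumes "Arrow \<delta> \<gamma> \<in> set (msl_types I)"
  shows "\<delta> \<in> set (msl_types I)" "\<gamma> \<in> set (msl_types I)"
  using msl_types_children[OF assms] by (auto simp: ctype_children_def)

lemma signature_msl_types: "(c, \<gamma>) \<in> set (signature I) \<Longrightarrow> \<gamma> \<in> set (msl_types I)"
  unfolding msl_types_def by (rule concat_saturate_self) force

lemma ex_msl_types: "(vs, GEx x \<gamma> G) \<in> set (msl_goals I) \<Longrightarrow> \<gamma> \<in> set (msl_types I)"
  unfolding msl_types_def by (rule concat_saturate_self) (force simp: ex_types_def)

lemma map_of_extend: "map_of (extend vs x \<gamma>) = (map_of vs)(x \<mapsto> \<gamma>)"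
proof
  fix y
  show "map_of (extend vs x \<gamma>) y = ((map_of vs)(x \<mapsto> \<gamma>)) y"
    by (induction vs) (auto simp: extend_def map_add_def)
qed

lemma distinct_extend: "distinct (map fst vs) \<Longrightarrow> distinct (map fst (extend vs x \<gamma>))"
  by (auto simp: extend_def distinct_map intro: inj_on_subset)

lemma arity_arrows: "arity (arrows \<gamma>s Iota) = length \<gamma>s"
  by (induction \<gamma>s) auto

lemma ctype_cases: obtains \<gamma>s where "\<gamma> = arrows \<gamma>s Iota"
proof -
  have "\<exists>\<gamma>s. \<gamma> = arrows \<gamma>s Iota"
  proof (induction \<gamma>)
    case Iota
    show ?case by (rule exI[of _ "[]"]) simp
  next
    case (Arrow \<gamma> \<delta>)
    then obtain \<delta>s where "\<delta> = arrows \<delta>s Iota" by blast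
    then show ?case by (intro exI[of _ "\<gamma> # \<delta>s"]) simp
  qed
  with that show thesis by blast
qed

text \<open>The head of a clause is typed under the declared binders, which forces the argument
  types of its symbol. This is what allows binders and parameters to be matched by position.\<close>

lemma has_type_apps_paramsD:
  assumes "has_type \<Sigma> (map_of ys) (apps (Sym c) (map (Var \<circ> fst) ys)) Iota" "distinct (map fst ys)"
  shows "\<Sigma> c = Some (arrows (map snd ys) Iota)"
proof -
  from assms(1) obtain \<gamma>s where \<gamma>s: "\<Sigma> c = Some (arrows \<gamma>s Iota)"
    "list_all2 (has_type \<Sigma> (map_of ys)) (map (Var \<circ> fst) ys) \<gamma>s"
    by (auto simp: has_type_apps)
  have "\<gamma>s ! i = snd (ys ! i)" if "i < length ys" for i
  proof -
    have "map_of ys (fst (ys ! i)) = Some (\<gamma>s ! i)"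
      using \<gamma>s(2) that by (auto simp: list_all2_conv_all_nth)
    moreover have "map_of ys (fst (ys ! i)) = Some (snd (ys ! i))"
      using assms(2) that by (intro map_of_is_SomeI) auto
    ultimately show ?thesis by simp
  qed
  then have "\<gamma>s = map snd ys"
    using \<gamma>s(2) by (intro nth_equalityI) (auto dest: list_all2_lengthD)
  with \<gamma>s(1) show ?thesis by simp
qed

lemma subst_subst:
  assumes "\<And>s. s \<in> ran \<sigma> \<Longrightarrow> subst \<tau> s = s"
  shows "subst \<tau> (subst \<sigma> t) = subst (\<tau> ++ \<sigma>) t"
  by (induction t) (auto simp: assms ranI map_add_def split: option.split)

text \<open>The premise ranges over every \<open>\<tau>\<close> because the outer substitution
  changes to \<open>\<tau>(x := None)\<close> below a quantifier.\<close>

lemma subst_goal_subst_goal: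
  "(\<And>\<tau> s. s \<in> ran \<sigma> \<Longrightarrow> subst \<tau> s = s) \<Longrightarrow>
    subst_goal \<tau> (subst_goal \<sigma> G) = subst_goal (\<tau> ++ \<sigma>) G"
proof (induction G arbitrary: \<sigma> \<tau>)
  case (GEx x \<gamma> G)
  have "(\<tau>(x := None)) ++ (\<sigma>(x := None)) = (\<tau> ++ \<sigma>)(x := None)"
    by (rule ext) (auto simp: map_add_def split: option.split)
  moreover have "subst_goal (\<tau>(x := None)) (subst_goal (\<sigma>(x := None)) G)
      = subst_goal ((\<tau>(x := None)) ++ (\<sigma>(x := None))) G"
    by (rule GEx.IH) (use GEx.prems in \<open>auto simp: ran_def split: if_splits\<close>)
  ultimately show ?case by simp
qed (simp_all add: subst_subst)

section \<open>Well-formedness of the scheme and the automaton\<close>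

locale msl_to_hors =
  fixes I :: msl_instance
  assumes wf_msl: "wf_msl I"
begin

abbreviation "\<Sigma> \<equiv> map_of (signature I)"
abbreviation "\<Pi> \<equiv> set (predicates I)"
abbreviation "D \<equiv> set (definite I)"
abbreviation "goals \<equiv> set (msl_goals I)"
abbreviation "types \<equiv> set (msl_types I)"
definition "\<H> = fst (hors_of_msl I)"
definition "\<A> = snd (hors_of_msl I)"

lemma distinct_signature: "distinct (map fst (signature I))"
  and distinct_predicates: "distinct (predicates I)"
  and wf_definite: "C \<in> D \<Longrightarrow> wf_clause \<Sigma> \<Pi> C"
  and wf_query: "wf_goal \<Sigma> \<Pi> Map.empty (query I)"
  using wf_msl by (simp_all add: wf_msl_def)

lemma in_entries: "e \<in> set (entries I) \<longleftrightarrow>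
    (\<exists>c \<gamma>. (c, \<gamma>) \<in> set (signature I) \<and> e = sym_entry (definite I) c \<gamma>) \<or>
    (\<exists>vs G. (vs, G) \<in> goals \<and> e = goal_entry vs G) \<or>
    (\<exists>\<gamma> \<in> types. e = ex_entry (signature I) (msl_types I) \<gamma>) \<or>
    (\<exists>\<delta> \<gamma>. Arrow \<delta> \<gamma> \<in> types \<and> (e = fun_entry \<delta> \<gamma> \<or> e = arg_entry \<delta> \<gamma>))"
proof -
  define h where "h = (\<lambda>\<tau>. case \<tau> of Iota \<Rightarrow> [] | Arrow \<delta> \<gamma> \<Rightarrow> [fun_entry \<delta> \<gamma>, arg_entry \<delta> \<gamma>])"
  have "e \<in> set (h \<tau>) \<longleftrightarrow> (\<exists>\<delta> \<gamma>. \<tau> = Arrow \<delta> \<gamma> \<and> (e = fun_entry \<delta> \<gamma> \<or> e = arg_entry \<delta> \<gamma>))" for \<tau>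
    by (cases \<tau>) (auto simp: h_def)
  then have "(\<exists>\<tau> \<in> types. e \<in> set (h \<tau>)) \<longleftrightarrow>
      (\<exists>\<delta> \<gamma>. Arrow \<delta> \<gamma> \<in> types \<and> (e = fun_entry \<delta> \<gamma> \<or> e = arg_entry \<delta> \<gamma>))"
    by metis
  moreover have "e \<in> set (entries I) \<longleftrightarrow>
      (\<exists>c \<in> set (signature I). e = sym_entry (definite I) (fst c) (snd c)) \<or>
      (\<exists>g \<in> goals. e = goal_entry (fst g) (snd g)) \<or>
      (\<exists>\<gamma> \<in> types. e = ex_entry (signature I) (msl_types I) \<gamma>) \<or> (\<exists>\<tau> \<in> types. e \<in> set (h \<tau>))"
    unfolding entries_def h_def[symmetric] by (simp add: image_iff)
  ultimately show ?thesis
    by (simp add: Bex_def split_paired_Ex)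
qed

text \<open>Names contain all the data that vary within a family, except that \<open>sym_nt\<close>
  omits the type; for symbols the type is determined by the distinct keys of the signature.\<close>

lemma entries_inj:
  assumes "e \<in> set (entries I)" "e' \<in> set (entries I)" "fst e = fst e'"
  shows "e = e'"
proof -
  have signature: "(c, \<gamma>) \<in> set (signature I) \<Longrightarrow> (c, \<gamma>') \<in> set (signature I) \<Longrightarrow> \<gamma> = \<gamma>'" for c \<gamma> \<gamma>'
    by (rule eq_key_imp_eq_value[OF distinct_signature])
  have names: "fst (sym_entry Cs c \<gamma>) = sym_nt c" "fst (goal_entry vs G) = goal_nt vs G"
    "fst (ex_entry \<Theta> \<tau>s \<gamma>) = ex_nt \<gamma>" "fst (fun_entry \<delta> \<gamma>) = fun_nt \<delta> \<gamma>"
    "fst (arg_entry \<delta> \<gamma>) = arg_nt \<delta> \<gamma>" for Cs c \<gamma> vs G \<Theta> \<tau>s \<delta>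
    by (simp_all add: sym_entry_def goal_entry_def ex_entry_def fun_entry_def arg_entry_def)
  show ?thesis
    using assms unfolding in_entries
    by (elim disjE exE conjE bexE) (simp_all add: names nt_defs, blast dest: signature)
qed

lemma distinct_entries: "distinct (map fst (entries I))"
  unfolding distinct_map
proof
  show "distinct (entries I)" by (simp add: entries_def)
qed (rule inj_onI, rule entries_inj)

lemma rule_entry: "(n, \<gamma>, ys, t) \<in> set (entries I) \<Longrightarrow> (n, ys, t) \<in> set (rules \<H>)"
  by (force simp: \<H>_def hors_of_msl_def)

lemma hsig_entry:
  assumes "(n, \<gamma>, ys, t) \<in> set (entries I)"
  shows "hsig \<H> (NT n) = Some \<gamma>"
proof -
  have "map_of (map (\<lambda>e. (fst e, fst (snd e))) (entries I)) n = Some \<gamma>"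
    by (rule map_of_is_SomeI) (use assms distinct_entries in \<open>force simp: comp_def\<close>)+
  then show ?thesis by (simp add: \<H>_def hors_of_msl_def)
qed

lemma distinct_constants: "distinct (map fst (msl_constants (predicates I)))"
  using distinct_predicates by (auto simp: msl_constants_def distinct_map inj_on_def comp_def)

lemma hsig_Con: "(a, m) \<in> set (msl_constants (predicates I)) \<Longrightarrow>
    hsig \<H> (Con a) = Some (arrows (replicate m Iota) Iota)"
  using distinct_constants by (simp add: \<H>_def hors_of_msl_def)

lemma hsig_constants:
  "hsig \<H> (Con (prod_encode (0, 0))) = Some Iota"
  "hsig \<H> (Con (prod_encode (1, 0))) = Some Iota"
  "hsig \<H> (Con (prod_encode (2, 0))) = Some (Arrow Iota (Arrow Iota Iota))"
  "hsig \<H> (Con (prod_encode (3, 0))) = Some (Arrow Iota (Arrow Iota Iota))"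
  "P \<in> \<Pi> \<Longrightarrow> hsig \<H> (Con (prod_encode (4, P))) = Some (Arrow Iota (Arrow Iota Iota))"
  "P \<in> \<Pi> \<Longrightarrow> hsig \<H> (Con (prod_encode (5, P))) = Some (Arrow Iota Iota)"
proof -
  show "hsig \<H> (Con (prod_encode (0, 0))) = Some Iota"
    using hsig_Con[of "prod_encode (0, 0)" 0] by (simp add: msl_constants_def del: hsig.simps)
  have "(prod_encode (1, 0), 0) \<in> set (msl_constants (predicates I))"
    by (simp add: msl_constants_def)
  from hsig_Con[OF this] show "hsig \<H> (Con (prod_encode (1, 0))) = Some Iota"
    by (simp only: replicate_0 arrows_Nil)
  show "hsig \<H> (Con (prod_encode (2, 0))) = Some (Arrow Iota (Arrow Iota Iota))"
    "hsig \<H> (Con (prod_encode (3, 0))) = Some (Arrow Iota (Arrow Iota Iota))"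
    using hsig_Con[of "prod_encode (2, 0)" 2] hsig_Con[of "prod_encode (3, 0)" 2]
    by (simp_all add: msl_constants_def numeral_2_eq_2 del: hsig.simps)
  assume "P \<in> \<Pi>"
  then show "hsig \<H> (Con (prod_encode (4, P))) = Some (Arrow Iota (Arrow Iota Iota))"
    "hsig \<H> (Con (prod_encode (5, P))) = Some (Arrow Iota Iota)"
    using hsig_Con[of "prod_encode (4, P)" 2] hsig_Con[of "prod_encode (5, P)" 1]
    by (simp_all add: msl_constants_def numeral_2_eq_2 image_iff del: hsig.simps)
qed

lemma types_constants [simp]:
  "has_type (hsig \<H>) \<Gamma> true_tm Iota" "has_type (hsig \<H>) \<Gamma> end_tm Iota"
  "has_type (hsig \<H>) \<Gamma> (and_tm s t) Iota \<longleftrightarrow> has_type (hsig \<H>) \<Gamma> s Iota \<and> has_type (hsig \<H>) \<Gamma> t Iota"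
  "has_type (hsig \<H>) \<Gamma> (or_tm s t) Iota \<longleftrightarrow> has_type (hsig \<H>) \<Gamma> s Iota \<and> has_type (hsig \<H>) \<Gamma> t Iota"
  "P \<in> \<Pi> \<Longrightarrow> has_type (hsig \<H>) \<Gamma> (clause_tm P s t) Iota \<longleftrightarrow>
     has_type (hsig \<H>) \<Gamma> s Iota \<and> has_type (hsig \<H>) \<Gamma> t Iota"
  "P \<in> \<Pi> \<Longrightarrow> has_type (hsig \<H>) \<Gamma> (test_tm P s) Iota \<longleftrightarrow> has_type (hsig \<H>) \<Gamma> s Iota"
  by (simp_all add: true_tm_def end_tm_def and_tm_def or_tm_def clause_tm_def test_tm_def has_type_App
      hsig_constants del: hsig.simps One_nat_def)

lemma hsig_sym_nt: "\<Sigma> c = Some \<gamma> \<Longrightarrow> hsig \<H> (NT (sym_nt c)) = Some \<gamma>"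
  by (rule hsig_entry[of _ _ "[0..<arity \<gamma>]" "clause_chain (clause_calls (definite I) c (arity \<gamma>))"])
    (auto simp: in_entries sym_entry_def dest: map_of_SomeD)

lemma hsig_goal_nt: "(vs, G) \<in> goals \<Longrightarrow> hsig \<H> (NT (goal_nt vs G)) = Some (arrows (map snd vs) Iota)"
  by (rule hsig_entry[of _ _ "map fst vs" "goal_body vs G"]) (auto simp: in_entries goal_entry_def)

lemma hsig_ex_nt: "\<gamma> \<in> types \<Longrightarrow> hsig \<H> (NT (ex_nt \<gamma>)) = Some (Arrow (Arrow \<gamma> Iota) Iota)"
  by (rule hsig_entry[of _ _ "[0]" "or_chain (ex_choices (signature I) (msl_types I) \<gamma>)"])
    (auto simp: in_entries ex_entry_def)

lemma hsig_fun_nt: "Arrow \<delta> \<gamma> \<in> types \<Longrightarrow>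
    hsig \<H> (NT (fun_nt \<delta> \<gamma>)) = Some (Arrow (Arrow \<gamma> Iota) (Arrow (Arrow \<delta> \<gamma>) Iota))"
  using hsig_entry[of "fun_nt \<delta> \<gamma>"] in_entries[of "fun_entry \<delta> \<gamma>"] unfolding fun_entry_def by blast

lemma hsig_arg_nt: "Arrow \<delta> \<gamma> \<in> types \<Longrightarrow>
    hsig \<H> (NT (arg_nt \<delta> \<gamma>)) = Some (Arrow (Arrow \<gamma> Iota) (Arrow (Arrow \<delta> \<gamma>) (Arrow \<delta> Iota)))"
  using hsig_entry[of "arg_nt \<delta> \<gamma>"] in_entries[of "arg_entry \<delta> \<gamma>"] unfolding arg_entry_def by blast

lemma has_type_hors_tm: "has_type \<Sigma> \<Gamma> t \<gamma> \<Longrightarrow> has_type (hsig \<H>) \<Gamma> (hors_tm t) \<gamma>"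
  unfolding hors_tm_def by (erule has_type_map_tm) (rule hsig_sym_nt)

lemma goals_wf: "g \<in> goals \<Longrightarrow> distinct (map fst (fst g)) \<and> wf_goal \<Sigma> \<Pi> (map_of (fst g)) (snd g)"
proof -
  assume "g \<in> goals"
  then obtain g0 where g0: "g0 = ([], query I) \<or> (\<exists>C \<in> D. g0 = (binders C, body C))"
    "g \<in> set (saturate goal_children g0)"
    by (auto simp: msl_goals_def)
  from g0(2) show ?thesis
  proof (induction rule: saturate_induct)
    case base
    with g0(1) show ?case using wf_query wf_definite by (auto simp: wf_clause_def)
  next
    case (step g h)
    then show ?case
      by (auto simp: goal_children_def map_of_extend distinct_extend simp del: fun_upd_apply split: goal.splits)
  qed
qed

lemma query_goal: "([], query I) \<in> goals"
  unfolding msl_goals_def by (rule concat_saturate_self) simp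

lemma body_goal: "C \<in> D \<Longrightarrow> (binders C, body C) \<in> goals"
  unfolding msl_goals_def by (rule concat_saturate_self) simp

lemma has_type_goal_call:
  assumes "(vs, G) \<in> goals" "list_all2 (has_type (hsig \<H>) \<Gamma>) ts (map snd vs)"
  shows "has_type (hsig \<H>) \<Gamma> (goal_call vs G ts) Iota"
  unfolding goal_call_def has_type_apps using assms hsig_goal_nt by (auto simp del: hsig.simps)

lemma has_type_vars:
  assumes "\<And>x \<gamma>. (x, \<gamma>) \<in> set vs \<Longrightarrow> \<Gamma> x = Some \<gamma>"
  shows "list_all2 (has_type \<Theta> \<Gamma>) (vars vs) (map snd vs)"
  using assms by (auto simp: vars_def list_all2_conv_all_nth)

lemma goal_body_type:
  assumes "(vs, G) \<in> goals"
  shows "has_type (hsig \<H>) (map_of vs) (goal_body vs G) Iota"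
proof -
  from goals_wf[OF assms] have wf: "distinct (map fst vs)" "wf_goal \<Sigma> \<Pi> (map_of vs) G" by auto
  have vars: "list_all2 (has_type (hsig \<H>) (map_of vs)) (vars (filter P vs)) (map snd (filter P vs))" for P
    using wf(1) by (intro has_type_vars) auto
  show ?thesis
  proof (cases G)
    case (GAtom P s)
    with wf show ?thesis by (simp add: goal_body_def has_type_hors_tm)
  next
    case (GAnd G1 G2)
    then have "(vs, G1) \<in> goals" "(vs, G2) \<in> goals"
      using msl_goals_children[OF assms] by (auto simp: goal_children_def)
    with vars[of "\<lambda>_. True"] GAnd show ?thesis
      by (simp add: goal_body_def has_type_goal_call)
  next
    case (GEx x \<gamma> G')
    then have "(extend vs x \<gamma>, G') \<in> goals"
      using msl_goals_children[OF assms] by (auto simp: goal_children_def)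
    from hsig_goal_nt[OF this] vars[of "\<lambda>v. fst v \<noteq> x"]
    have "has_type (hsig \<H>) (map_of vs)
        (goal_call (extend vs x \<gamma>) G' (vars (filter (\<lambda>v. fst v \<noteq> x) vs))) (Arrow \<gamma> Iota)"
      unfolding goal_call_def has_type_apps
      by (intro exI[of _ "map snd (filter (\<lambda>v. fst v \<noteq> x) vs)"])
        (simp add: extend_def arrows_append del: hsig.simps)
    moreover have "hsig \<H> (NT (ex_nt \<gamma>)) = Some (Arrow (Arrow \<gamma> Iota) Iota)"
      using ex_msl_types assms GEx by (intro hsig_ex_nt) blast
    ultimately show ?thesis
      by (auto simp: goal_body_def GEx has_type_App simp del: hsig.simps)
  qed (simp add: goal_body_def)
qed

lemma clause_chain_type:
  "(\<And>P u. (P, u) \<in> set us \<Longrightarrow> P \<in> \<Pi> \<and> has_type (hsig \<H>) \<Gamma> u Iota) \<Longrightarrow>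
    has_type (hsig \<H>) \<Gamma> (clause_chain us) Iota"
proof (induction us)
  case (Cons u us)
  have "has_type (hsig \<H>) \<Gamma> (clause_chain us) Iota"
    by (rule Cons.IH) (use Cons.prems in auto)
  with Cons.prems[of "fst u" "snd u"] show ?case
    by (simp add: clause_chain_def)
qed (simp add: clause_chain_def)

lemma or_chain_type:
  "(\<And>u. u \<in> set us \<Longrightarrow> has_type (hsig \<H>) \<Gamma> u Iota) \<Longrightarrow> has_type (hsig \<H>) \<Gamma> (or_chain us) Iota"
  by (induction us) (auto simp: or_chain_def)

lemma params_type:
  "list_all2 (has_type \<Theta> (map_of (zip [0..<length \<gamma>s] \<gamma>s))) (map Var [0..<length \<gamma>s]) \<gamma>s"
  unfolding list_all2_conv_all_nth
proof (intro conjI allI impI)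
  fix i assume "i < length (map Var [0..<length \<gamma>s])"
  then show "has_type \<Theta> (map_of (zip [0..<length \<gamma>s] \<gamma>s)) (map Var [0..<length \<gamma>s] ! i) (\<gamma>s ! i)"
    using map_of_zip_nth[of "[0..<length \<gamma>s]" \<gamma>s i] by simp
qed simp

lemma ConClause_type:
  assumes "ConClause c ys G P \<in> D"
  shows "\<Sigma> c = Some (arrows (map snd ys) Iota)" "distinct (map fst ys)"
  using wf_definite[OF assms] has_type_apps_paramsD[of \<Sigma> ys c] by (auto simp: wf_clause_def)

lemma clause_predicate: "C \<in> D \<Longrightarrow> head C = GAtom P s \<Longrightarrow> P \<in> \<Pi>"
  using wf_definite[of C] by (auto simp: wf_clause_def)

lemma clause_calls_type:
  assumes c: "\<Sigma> c = Some (arrows \<gamma>s Iota)"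
    and u: "(P, u) \<in> set (clause_calls (definite I) c (length \<gamma>s))"
  shows "P \<in> \<Pi> \<and> has_type (hsig \<H>) (map_of (zip [0..<length \<gamma>s] \<gamma>s)) u Iota"
proof -
  from u obtain C where C: "C \<in> D" "(P, u) \<in> set (clause_call c (length \<gamma>s) C)"
    unfolding clause_calls_def by auto
  show ?thesis
  proof (cases C)
    case (VarClause y G Q)
    with C have "P = Q" "u = goal_call [(y, Iota)] G [apps (nt (sym_nt c)) (map Var [0..<length \<gamma>s])]"
      "([(y, Iota)], G) \<in> goals" using body_goal[OF C(1)] by (auto simp: clause_call_def)
    moreover have "has_type (hsig \<H>) (map_of (zip [0..<length \<gamma>s] \<gamma>s))
        (apps (nt (sym_nt c)) (map Var [0..<length \<gamma>s])) Iota"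
      unfolding has_type_apps using hsig_sym_nt[OF c] params_type by (auto simp del: hsig.simps)
    ultimately show ?thesis
      using clause_predicate[OF C(1)] VarClause by (auto intro!: has_type_goal_call)
  next
    case (ConClause d ys G Q)
    with C(2) have *: "P = Q" "d = c" "u = goal_call ys G (map Var [0..<length \<gamma>s])"
      by (auto simp: clause_call_def split: if_splits)
    with ConClause C(1) ConClause_type[of c ys G Q] c have "\<gamma>s = map snd ys" by simp
    with * ConClause C(1) body_goal[OF C(1)] clause_predicate[OF C(1)] show ?thesis
      using params_type[of "hsig \<H>" \<gamma>s] by (auto intro!: has_type_goal_call)
  qed
qed

lemma ex_choices_type:
  assumes "\<gamma> \<in> types" "u \<in> set (ex_choices (signature I) (msl_types I) \<gamma>)"
  shows "has_type (hsig \<H>) [0 \<mapsto> Arrow \<gamma> Iota] u Iota"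
proof -
  from assms(2) consider c where "(c, \<gamma>) \<in> set (signature I)" "u = App (Var 0) (nt (sym_nt c))"
    | \<delta> where "Arrow \<delta> \<gamma> \<in> types" "u = App (nt (ex_nt (Arrow \<delta> \<gamma>))) (App (nt (fun_nt \<delta> \<gamma>)) (Var 0))"
    unfolding ex_choices_def by (force split: ctype.splits if_splits)
  then show ?thesis
  proof cases
    case 1
    then have "\<Sigma> c = Some \<gamma>" using distinct_signature by simp
    with 1 show ?thesis by (auto simp: has_type_App hsig_sym_nt simp del: hsig.simps)
  next
    case 2
    with hsig_fun_nt hsig_ex_nt show ?thesis by (auto simp: has_type_App simp del: hsig.simps)
  qed
qed

lemma entry_type:
  assumes "(n, \<gamma>, ys, t) \<in> set (entries I)"
  shows "distinct ys \<and> (\<exists>\<gamma>s. length \<gamma>s = length ys \<and> \<gamma> = arrows \<gamma>s Iota \<and>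
    has_type (hsig \<H>) (map_of (zip ys \<gamma>s)) t Iota)"
  using assms unfolding in_entries
proof (elim disjE exE conjE bexE)
  fix c \<delta> assume c: "(c, \<delta>) \<in> set (signature I)" "(n, \<gamma>, ys, t) = sym_entry (definite I) c \<delta>"
  obtain \<gamma>s where \<gamma>s: "\<delta> = arrows \<gamma>s Iota" by (rule ctype_cases)
  have "\<Sigma> c = Some (arrows \<gamma>s Iota)" using c(1) distinct_signature \<gamma>s by simp
  then show ?thesis
    using c(2) by (intro conjI exI[of _ \<gamma>s])
      (auto simp: sym_entry_def \<gamma>s arity_arrows intro!: clause_chain_type clause_calls_type)
next
  fix vs G assume g: "(vs, G) \<in> goals" "(n, \<gamma>, ys, t) = goal_entry vs G"
  with goals_wf[OF g(1)] goal_body_type[OF g(1)] show ?thesis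
    by (intro conjI exI[of _ "map snd vs"]) (auto simp: goal_entry_def zip_map_fst_snd)
next
  fix \<delta> assume "\<delta> \<in> types" "(n, \<gamma>, ys, t) = ex_entry (signature I) (msl_types I) \<delta>"
  then show ?thesis
    by (intro conjI exI[of _ "[Arrow \<delta> Iota]"])
      (auto simp: ex_entry_def intro!: or_chain_type ex_choices_type)
next
  fix \<delta> \<delta>' assume e: "Arrow \<delta> \<delta>' \<in> types" "(n, \<gamma>, ys, t) = fun_entry \<delta> \<delta>'"
  then show ?thesis
    using hsig_arg_nt[OF e(1)] hsig_ex_nt[OF Arrow_msl_types(1)[OF e(1)]]
    by (intro conjI exI[of _ "[Arrow \<delta>' Iota, Arrow \<delta> \<delta>']"])
      (auto simp: fun_entry_def has_type_App simp del: hsig.simps)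
next
  fix \<delta> \<delta>' assume e: "Arrow \<delta> \<delta>' \<in> types" "(n, \<gamma>, ys, t) = arg_entry \<delta> \<delta>'"
  then show ?thesis
    by (intro conjI exI[of _ "[Arrow \<delta>' Iota, Arrow \<delta> \<delta>', \<delta>]"])
      (auto simp: arg_entry_def has_type_App)
qed

lemma wf_hors_of_msl: "wf_hors \<H>"
proof -
  have "\<exists>\<gamma>s. distinct ys \<and> length \<gamma>s = length ys \<and> hsig \<H> (NT f) = Some (arrows \<gamma>s Iota) \<and>
      has_type (hsig \<H>) (map_of (zip ys \<gamma>s)) t Iota" if rule: "(f, ys, t) \<in> set (rules \<H>)" for f ys t
  proof -
    from rule obtain \<gamma> where "(f, \<gamma>, ys, t) \<in> set (entries I)"
      by (auto simp: \<H>_def hors_of_msl_def)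
    from entry_type[OF this] hsig_entry[OF this] show ?thesis by auto
  qed
  moreover have "hsig \<H> (NT (start \<H>)) = Some Iota"
    using hsig_goal_nt[OF query_goal] by (simp add: \<H>_def hors_of_msl_def)
  moreover have "distinct (map fst (nonterminals \<H>))" "distinct (map fst (constants \<H>))"
    "distinct (map fst (rules \<H>))" "fst ` set (rules \<H>) = fst ` set (nonterminals \<H>)"
    using distinct_entries distinct_constants by (simp_all add: \<H>_def hors_of_msl_def comp_def image_image)
  ultimately show ?thesis unfolding wf_hors_def by blast
qed

lemma constants_eq: "constants \<H> = msl_constants (predicates I)"
  and states_eq: "states \<A> = 0 # map Suc (predicates I)"
  and initial_eq: "initial \<A> = 0"
  and start_eq: "start \<H> = goal_nt [] (query I)"
  by (simp_all add: \<H>_def \<A>_def hors_of_msl_def msl_automaton_def)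

lemma transitions_eq: "transitions \<A> =
    concat (map (\<lambda>q. map (\<lambda>c. ((q, fst c), msl_transition q (fst c))) (constants \<H>)) (states \<A>))"
  by (simp only: constants_eq states_eq) (simp add: \<A>_def hors_of_msl_def msl_automaton_def)

lemma map_fst_transitions: "map fst (transitions \<A>) = List.product (states \<A>) (map fst (constants \<H>))"
  unfolding transitions_eq by (simp add: product_concat_map map_concat comp_def)

lemma distinct_transitions: "distinct (map fst (transitions \<A>))"
  unfolding map_fst_transitions constants_eq states_eq
  using distinct_constants distinct_predicates
  by (intro distinct_product) (auto simp: distinct_map)

lemma transition_atoms: "(a, m) \<in> set (constants \<H>) \<Longrightarrow> q \<in> set (states \<A>) \<Longrightarrow>
    atoms (msl_transition q a) \<subseteq> {1..m} \<times> set (states \<A>)"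
  unfolding constants_eq states_eq by (auto simp: msl_constants_def msl_transition_def)

lemma wf_automaton_of_msl: "wf_automaton (constants \<H>) \<A>"
  unfolding wf_automaton_def
proof (intro conjI)
  show "distinct (states \<A>)"
    using distinct_predicates by (auto simp: states_eq distinct_map)
  show "fst ` set (transitions \<A>) = set (states \<A>) \<times> fst ` set (constants \<H>)"
    unfolding set_map[symmetric] map_fst_transitions by simp
  show "\<forall>((q, a), \<phi>) \<in> set (transitions \<A>). \<forall>m. map_of (constants \<H>) a = Some m \<longrightarrow>
      atoms \<phi> \<subseteq> {1..m} \<times> set (states \<A>)"
  proof (clarify del: subsetI)
    fix q a \<phi> m assume "((q, a), \<phi>) \<in> set (transitions \<A>)" "map_of (constants \<H>) a = Some m"
    moreover from this have "\<phi> = msl_transition q a" "q \<in> set (states \<A>)"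
      by (auto simp: transitions_eq)
    ultimately show "atoms \<phi> \<subseteq> {1..m} \<times> set (states \<A>)"
      using transition_atoms by (auto dest!: map_of_SomeD)
  qed
qed (use distinct_transitions in \<open>simp_all add: states_eq initial_eq\<close>)

lemma transition_eq:
  assumes "q \<in> set (states \<A>)" "(a, m) \<in> set (constants \<H>)"
  shows "transition \<A> q (Const a) = msl_transition q a"
proof -
  have "((q, a), msl_transition q a) \<in> set (transitions \<A>)"
    unfolding transitions_eq by (rule in_concat_map[OF assms(1)]) (use assms(2) in force)
  with distinct_transitions show ?thesis by simp
qed

sublocale model_checking \<H> \<A>
  by unfold_locales (use wf_hors_of_msl in \<open>simp only: wf_hors_def\<close>)

lemma states_iff [simp]: "0 \<in> set (states \<A>)" "Suc P \<in> set (states \<A>) \<longleftrightarrow> P \<in> \<Pi>"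
  by (auto simp: states_eq)

section \<open>Unfolding of entries and acceptance of the constants\<close>

lemma head_step_entry:
  "(n, \<gamma>, ys, t) \<in> set (entries I) \<Longrightarrow> length ss = length ys \<Longrightarrow>
    head_step \<H> (apps (nt n) ss) (subst (map_of (zip ys ss)) t)"
  by (intro head_step.unfold rule_entry)

text \<open>A term with a head step has no constant at its head, so its acceptance must come from
  that step, which is unique. Each unfolding therefore costs one unit of height.\<close>

lemma accepts_head_stepD:
  assumes "accepts n q t" "head_step \<H> t t'"
  obtains m where "n = Suc m" "accepts m q t'"
  using assms head_step_deterministic by (cases n) auto

lemma accepts_Con:
  assumes "q \<in> set (states \<A>)" "(a, m) \<in> set (msl_constants (predicates I))"
  shows "accepts n q (apps (Sym (Con a)) ts) \<longleftrightarrow> (\<exists>k. n = Suc k \<and>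
    sat (accepted_children (accepts k) ts) (msl_transition q a))"
  using transition_eq[of q a m] assms by (cases n) (simp_all add: constants_eq del: transition.simps)

lemma const_in_constants:
  "(prod_encode (0, 0), 0) \<in> set (msl_constants (predicates I))"
  "(prod_encode (1, 0), 0) \<in> set (msl_constants (predicates I))"
  "(prod_encode (2, 0), 2) \<in> set (msl_constants (predicates I))"
  "(prod_encode (3, 0), 2) \<in> set (msl_constants (predicates I))"
  "P \<in> \<Pi> \<Longrightarrow> (prod_encode (4, P), 2) \<in> set (msl_constants (predicates I))"
  "P \<in> \<Pi> \<Longrightarrow> (prod_encode (5, P), 1) \<in> set (msl_constants (predicates I))"
  by (simp_all add: msl_constants_def)

lemma accepts_true: "accepts n 0 true_tm \<longleftrightarrow> n \<noteq> 0"
  using accepts_Con[OF states_iff(1) const_in_constants(1), of n "[]"]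
  by (cases n) (auto simp: true_tm_def msl_transition_def simp del: accepts.simps)

lemma accepts_end: "q \<in> set (states \<A>) \<Longrightarrow> \<not> accepts n q end_tm"
  using accepts_Con[OF _ const_in_constants(2), of q n "[]"]
  by (cases n) (auto simp: end_tm_def msl_transition_def simp del: accepts.simps)

lemma accepts_and: "accepts n 0 (and_tm s t) \<longleftrightarrow> (\<exists>m. n = Suc m \<and> accepts m 0 s \<and> accepts m 0 t)"
  using accepts_Con[OF states_iff(1) const_in_constants(3), of n "[s, t]"]
  by (auto simp: and_tm_def msl_transition_def apps_def simp del: accepts.simps)

lemma accepts_or: "accepts n 0 (or_tm s t) \<longleftrightarrow> (\<exists>m. n = Suc m \<and> (accepts m 0 s \<or> accepts m 0 t))"
  using accepts_Con[OF states_iff(1) const_in_constants(4), of n "[s, t]"]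
  by (auto simp: or_tm_def msl_transition_def apps_def simp del: accepts.simps)

lemma accepts_clause:
  "P \<in> \<Pi> \<Longrightarrow> Q \<in> \<Pi> \<Longrightarrow> accepts n (Suc P) (clause_tm Q s t) \<longleftrightarrow>
    (\<exists>m. n = Suc m \<and> (P = Q \<and> accepts m 0 s \<or> accepts m (Suc P) t))"
  using accepts_Con[OF _ const_in_constants(5), of "Suc P" Q n "[s, t]"]
  by (auto simp: clause_tm_def msl_transition_def apps_def simp del: accepts.simps)

lemma accepts_test: "P \<in> \<Pi> \<Longrightarrow> accepts n 0 (test_tm P s) \<longleftrightarrow> (\<exists>m. n = Suc m \<and> accepts m (Suc P) s)"
  using accepts_Con[OF states_iff(1) const_in_constants(6), of P n "[s]"]
  by (auto simp: test_tm_def msl_transition_def apps_def simp del: accepts.simps)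

lemma accepts_or_chainD:
  "accepts n 0 (or_chain us) \<Longrightarrow> \<exists>u \<in> set us. \<exists>m < n. accepts m 0 u"
proof (induction us arbitrary: n)
  case (Cons u us)
  then obtain m where m: "n = Suc m" "accepts m 0 u \<or> accepts m 0 (or_chain us)"
    by (auto simp: or_chain_def accepts_or)
  from m(2) show ?case
  proof
    assume "accepts m 0 (or_chain us)"
    from Cons.IH[OF this] m(1) show ?thesis by (auto intro: less_SucI)
  qed (use m(1) in auto)
qed (simp add: or_chain_def accepts_end)

lemma accepted_or_chain: "u \<in> set us \<Longrightarrow> accepted 0 u \<Longrightarrow> accepted 0 (or_chain us)"
  by (induction us) (auto simp: accepted_def or_chain_def accepts_or)

lemma accepts_clause_chainD:
  "accepts n (Suc P) (clause_chain us) \<Longrightarrow> P \<in> \<Pi> \<Longrightarrow> fst ` set us \<subseteq> \<Pi> \<Longrightarrow>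
    \<exists>u. (P, u) \<in> set us \<and> (\<exists>m < n. accepts m 0 u)"
proof (induction us arbitrary: n)
  case (Cons u us)
  then obtain m where m: "n = Suc m" "P = fst u \<and> accepts m 0 (snd u) \<or> accepts m (Suc P) (clause_chain us)"
    by (auto simp: clause_chain_def accepts_clause)
  from m(2) show ?case
  proof
    assume "accepts m (Suc P) (clause_chain us)"
    from Cons.IH[OF this] Cons.prems m(1) show ?thesis by (auto intro: less_SucI)
  next
    assume "P = fst u \<and> accepts m 0 (snd u)"
    with m(1) show ?thesis by (intro exI[of _ "snd u"]) auto
  qed
qed (simp add: clause_chain_def accepts_end)

lemma accepted_clause_chain:
  "(P, u) \<in> set us \<Longrightarrow> accepted 0 u \<Longrightarrow> P \<in> \<Pi> \<Longrightarrow> fst ` set us \<subseteq> \<Pi> \<Longrightarrow> accepted (Suc P) (clause_chain us)"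
  by (induction us) (auto simp: accepted_def clause_chain_def accepts_clause)

lemma subst_constants [simp]:
  "subst \<sigma> true_tm = true_tm" "subst \<sigma> end_tm = end_tm"
  "subst \<sigma> (and_tm s t) = and_tm (subst \<sigma> s) (subst \<sigma> t)"
  "subst \<sigma> (or_tm s t) = or_tm (subst \<sigma> s) (subst \<sigma> t)"
  "subst \<sigma> (clause_tm P s t) = clause_tm P (subst \<sigma> s) (subst \<sigma> t)"
  "subst \<sigma> (test_tm P s) = test_tm P (subst \<sigma> s)"
  by (simp_all add: true_tm_def end_tm_def and_tm_def or_tm_def clause_tm_def test_tm_def)

lemma subst_or_chain: "subst \<sigma> (or_chain us) = or_chain (map (subst \<sigma>) us)"
  by (induction us) (simp_all add: or_chain_def)

lemma subst_clause_chain: "subst \<sigma> (clause_chain us) = clause_chain (map (\<lambda>u. (fst u, subst \<sigma> (snd u))) us)"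
  by (induction us) (simp_all add: clause_chain_def)

text \<open>\<open>ex_nt \<gamma>\<close> applied to \<open>F\<close> searches for a closed term \<open>t : \<gamma>\<close> such that \<open>F t\<close> is accepted.\<close>

definition choices :: "ctype \<Rightarrow> hsym tm \<Rightarrow> hsym tm list" where
  "choices \<gamma> F = map (subst [0 \<mapsto> F]) (ex_choices (signature I) (msl_types I) \<gamma>)"

lemma set_choices: "u \<in> set (choices \<gamma> F) \<longleftrightarrow>
    (\<exists>c. \<Sigma> c = Some \<gamma> \<and> u = App F (nt (sym_nt c))) \<or>
    (\<exists>\<delta>. Arrow \<delta> \<gamma> \<in> types \<and> u = App (nt (ex_nt (Arrow \<delta> \<gamma>))) (App (nt (fun_nt \<delta> \<gamma>)) F))"
proof -
  define h where "h = (\<lambda>\<tau>. case \<tau> of Iota \<Rightarrow> [] | Arrow \<delta> \<gamma>' \<Rightarrow>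
       if \<gamma>' = \<gamma> then [App (nt (ex_nt (Arrow \<delta> \<gamma>))) (App (nt (fun_nt \<delta> \<gamma>)) (Var 0))] else [])"
  have h: "u' \<in> set (h \<tau>) \<longleftrightarrow> (\<exists>\<delta>. \<tau> = Arrow \<delta> \<gamma> \<and>
      u' = App (nt (ex_nt (Arrow \<delta> \<gamma>))) (App (nt (fun_nt \<delta> \<gamma>)) (Var 0)))" for u' \<tau>
    by (cases \<tau>) (auto simp: h_def)
  define X where "X c = App (Var 0) (nt (sym_nt c))" for c
  define Y where "Y \<delta> = App (nt (ex_nt (Arrow \<delta> \<gamma>))) (App (nt (fun_nt \<delta> \<gamma>)) (Var 0))" for \<delta>
  have ex_choices: "v \<in> set (ex_choices (signature I) (msl_types I) \<gamma>) \<longleftrightarrow>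
      (\<exists>c. \<Sigma> c = Some \<gamma> \<and> v = X c) \<or> (\<exists>\<tau> \<in> types. v \<in> set (h \<tau>))" for v
    unfolding ex_choices_def h_def[symmetric] X_def
    by (simp add: image_iff Bex_def split_paired_Ex distinct_signature) blast
  have "u \<in> set (choices \<gamma> F) \<longleftrightarrow>
      (\<exists>c. \<Sigma> c = Some \<gamma> \<and> u = subst [0 \<mapsto> F] (X c)) \<or> (\<exists>\<delta>. Arrow \<delta> \<gamma> \<in> types \<and> u = subst [0 \<mapsto> F] (Y \<delta>))"
    unfolding choices_def set_map image_iff Bex_def ex_choices h Y_def[symmetric] by metis
  then show ?thesis by (simp add: X_def Y_def)
qed

lemma head_step_ex:
  assumes "\<gamma> \<in> types"
  shows "head_step \<H> (App (nt (ex_nt \<gamma>)) F) (or_chain (choices \<gamma> F))"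
proof -
  have "ex_entry (signature I) (msl_types I) \<gamma> \<in> set (entries I)"
    using assms in_entries by blast
  from head_step_entry[OF this[unfolded ex_entry_def], of "[F]"] show ?thesis
    by (simp add: apps_def subst_or_chain choices_def)
qed

lemma head_step_fun:
  assumes "Arrow \<delta> \<gamma> \<in> types"
  shows "head_step \<H> (App (App (nt (fun_nt \<delta> \<gamma>)) F) s)
    (App (nt (ex_nt \<delta>)) (App (App (nt (arg_nt \<delta> \<gamma>)) F) s))"
proof -
  have "fun_entry \<delta> \<gamma> \<in> set (entries I)"
    using assms in_entries by blast
  from head_step_entry[OF this[unfolded fun_entry_def], of "[F, s]"] show ?thesis
    by (simp add: apps_def)
qed

lemma head_step_arg:
  assumes "Arrow \<delta> \<gamma> \<in> types"
  shows "head_step \<H> (App (App (App (nt (arg_nt \<delta> \<gamma>)) F) s) t) (App F (App s t))"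
proof -
  have "arg_entry \<delta> \<gamma> \<in> set (entries I)"
    using assms in_entries by blast
  from head_step_entry[OF this[unfolded arg_entry_def], of "[F, s, t]"] show ?thesis
    by (simp add: apps_def)
qed

text \<open>Every closed term gets its type from a symbol of the signature by dropping arguments,
  and \<open>types\<close> contains the signature and is closed under components. This is why a
  finite set of types suffices for the enumeration.\<close>

lemma closed_term_types: "closed_term \<Sigma> t \<gamma> \<Longrightarrow> \<gamma> \<in> types"
proof (induction t arbitrary: \<gamma>)
  case (Sym c)
  then show ?case by (auto dest: map_of_SomeD signature_msl_types)
next
  case (App s t)
  then show ?case by (auto simp: has_type_App intro: Arrow_msl_types)
qed simp

text \<open>Induction on the witness with an arbitrary continuation. For \<open>App s t\<close> the
  search is read from the inside out: the continuation \<open>arg_nt\<close> accepts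
  \<open>t\<close>, hence the search over \<delta> succeeds, hence \<open>fun_nt\<close> accepts
  \<open>s\<close>, hence the search over the function type succeeds.\<close>

lemma accepted_ex:
  "closed_term \<Sigma> t \<gamma> \<Longrightarrow> accepted 0 (App F (hors_tm t)) \<Longrightarrow> accepted 0 (App (nt (ex_nt \<gamma>)) F)"
proof (induction t arbitrary: \<gamma> F)
  case (Sym c)
  have "App F (nt (sym_nt c)) \<in> set (choices \<gamma> F)"
    using Sym by (auto simp: set_choices)
  from accepted_or_chain[OF this] Sym(2) accepted_step[OF head_step_ex[OF closed_term_types[OF Sym(1)]]]
  show ?case by (simp add: hors_tm_def)
next
  case (App s t)
  then obtain \<delta> where \<delta>: "closed_term \<Sigma> s (Arrow \<delta> \<gamma>)" "closed_term \<Sigma> t \<delta>"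
    by (auto simp: has_type_App)
  note arrow = closed_term_types[OF \<delta>(1)]
  have "accepted 0 (App F (App (hors_tm s) (hors_tm t)))"
    using App.prems(2) by (simp add: hors_tm_def)
  then have "accepted 0 (App (App (App (nt (arg_nt \<delta> \<gamma>)) F) (hors_tm s)) (hors_tm t))"
    by (rule accepted_step[OF head_step_arg[OF arrow]])
  then have "accepted 0 (App (nt (ex_nt \<delta>)) (App (App (nt (arg_nt \<delta> \<gamma>)) F) (hors_tm s)))"
    by (rule App.IH(2)[OF \<delta>(2)])
  then have "accepted 0 (App (App (nt (fun_nt \<delta> \<gamma>)) F) (hors_tm s))"
    by (rule accepted_step[OF head_step_fun[OF arrow]])
  then have "accepted 0 (App (nt (ex_nt (Arrow \<delta> \<gamma>))) (App (nt (fun_nt \<delta> \<gamma>)) F))"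
    by (rule App.IH(1)[OF \<delta>(1)])
  moreover have "App (nt (ex_nt (Arrow \<delta> \<gamma>))) (App (nt (fun_nt \<delta> \<gamma>)) F) \<in> set (choices \<gamma> F)"
    using arrow by (auto simp: set_choices)
  ultimately show ?case
    using accepted_or_chain accepted_step[OF head_step_ex[OF closed_term_types[OF App.prems(1)]]] by blast
qed simp

text \<open>Neither the type nor the continuation gets smaller, since the search for an application
  first moves on to a larger type; only the height decreases. The induction hypothesis is used
  twice: for \<open>s\<close> at the function type, then for \<open>t\<close> inside the
  continuation of that search. The height of the result is kept strictly smaller, so that the
  induction on goals can continue below the quantifier.\<close>

lemma accepts_exD:
  "accepts n 0 (App (nt (ex_nt \<gamma>)) F) \<Longrightarrow> \<gamma> \<in> types \<Longrightarrow>
    \<exists>t m. m < n \<and> closed_term \<Sigma> t \<gamma> \<and> accepts m 0 (App F (hors_tm t))"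
proof (induction n arbitrary: \<gamma> F rule: less_induct)
  case (less n)
  from accepts_head_stepD[OF less.prems(1) head_step_ex[OF less.prems(2)]] obtain k where
    k: "n = Suc k" "accepts k 0 (or_chain (choices \<gamma> F))" .
  from accepts_or_chainD[OF k(2)] obtain u m where u: "u \<in> set (choices \<gamma> F)" "m < k" "accepts m 0 u"
    by blast
  from u(1)[unfolded set_choices] show ?case
  proof (elim disjE exE conjE)
    fix c assume "\<Sigma> c = Some \<gamma>" "u = App F (nt (sym_nt c))"
    with u k(1) show ?thesis by (intro exI[of _ "Sym c"] exI[of _ m]) (simp add: hors_tm_def)
  next
    fix \<delta> assume arrow: "Arrow \<delta> \<gamma> \<in> types"
      and u': "u = App (nt (ex_nt (Arrow \<delta> \<gamma>))) (App (nt (fun_nt \<delta> \<gamma>)) F)"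
    from less.IH[OF _ u(3)[unfolded u'] arrow] u(2) k(1) obtain s m1 where
      s: "m1 < m" "closed_term \<Sigma> s (Arrow \<delta> \<gamma>)" "accepts m1 0 (App (App (nt (fun_nt \<delta> \<gamma>)) F) (hors_tm s))"
      by auto
    from accepts_head_stepD[OF s(3) head_step_fun[OF arrow]] obtain m2 where
      m2: "m1 = Suc m2" "accepts m2 0 (App (nt (ex_nt \<delta>)) (App (App (nt (arg_nt \<delta> \<gamma>)) F) (hors_tm s)))" .
    from less.IH[OF _ m2(2) Arrow_msl_types(1)[OF arrow]] u(2) k(1) s(1) m2(1) obtain t m3 where
      t: "m3 < m2" "closed_term \<Sigma> t \<delta>"
        "accepts m3 0 (App (App (App (nt (arg_nt \<delta> \<gamma>)) F) (hors_tm s)) (hors_tm t))"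
      by auto
    from accepts_head_stepD[OF t(3) head_step_arg[OF arrow]] obtain m4 where
      m4: "m3 = Suc m4" "accepts m4 0 (App F (App (hors_tm s) (hors_tm t)))" .
    with s t m2 u(2) k(1) show ?thesis
      by (intro exI[of _ "App s t"] exI[of _ m4]) (auto simp: hors_tm_def has_type_App)
  qed
qed

section \<open>Goals under environments of closed terms\<close>

definition env_ok :: "(nat \<times> ctype) list \<Rightarrow> (nat \<rightharpoonup> nat tm) \<Rightarrow> bool" where
  "env_ok vs \<rho> \<longleftrightarrow> dom \<rho> = fst ` set vs \<and>
     (\<forall>x \<gamma>. (x, \<gamma>) \<in> set vs \<longrightarrow> (\<exists>s. \<rho> x = Some s \<and> closed_term \<Sigma> s \<gamma>))"

definition env_args :: "(nat \<times> ctype) list \<Rightarrow> (nat \<rightharpoonup> nat tm) \<Rightarrow> nat tm list" where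
  "env_args vs \<rho> = map (\<lambda>v. the (\<rho> (fst v))) vs"

text \<open>The term that represents \<open>subst_goal \<rho> G\<close>. A substituted goal has no
  nonterminal of its own; the closed terms are passed as arguments to the nonterminal of the
  original goal.\<close>

definition call :: "(nat \<times> ctype) list \<Rightarrow> goal \<Rightarrow> (nat \<rightharpoonup> nat tm) \<Rightarrow> hsym tm" where
  "call vs G \<rho> = goal_call vs G (map hors_tm (env_args vs \<rho>))"

definition partial_call :: "(nat \<times> ctype) list \<Rightarrow> nat \<Rightarrow> ctype \<Rightarrow> goal \<Rightarrow> (nat \<rightharpoonup> nat tm) \<Rightarrow> hsym tm" where
  "partial_call vs x \<gamma> G \<rho> =
     goal_call (extend vs x \<gamma>) G (map hors_tm (env_args (filter (\<lambda>v. fst v \<noteq> x) vs) \<rho>))"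

lemma length_env_args [simp]: "length (env_args vs \<rho>) = length vs"
  by (simp add: env_args_def)

lemma map_of_env_args:
  assumes "dom \<rho> = fst ` set vs"
  shows "map_of (zip (map fst vs) (env_args vs \<rho>)) = \<rho>"
proof
  fix x
  have "map_of (zip (map fst vs) (env_args vs \<rho>)) x = (if x \<in> fst ` set vs then Some (the (\<rho> x)) else None)"
    unfolding env_args_def by (induction vs) auto
  moreover have "x \<in> fst ` set vs \<longleftrightarrow> \<rho> x \<noteq> None"
    unfolding assms[symmetric] by (rule domIff)
  ultimately show "map_of (zip (map fst vs) (env_args vs \<rho>)) x = \<rho> x"
    by (cases "\<rho> x") simp_all
qed

lemma env_args_typed: "env_ok vs \<rho> \<Longrightarrow> list_all2 (closed_term \<Sigma>) (env_args vs \<rho>) (map snd vs)"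
  unfolding list_all2_conv_all_nth
proof (intro conjI allI impI)
  fix i assume "env_ok vs \<rho>" "i < length (env_args vs \<rho>)"
  then have "(fst (vs ! i), snd (vs ! i)) \<in> set vs" "i < length vs" by simp_all
  with \<open>env_ok vs \<rho>\<close> show "closed_term \<Sigma> (env_args vs \<rho> ! i) (map snd vs ! i)"
    unfolding env_ok_def env_args_def by fastforce
qed simp

lemma env_ok_zip:
  assumes "list_all2 (closed_term \<Sigma>) ss (map snd vs)" "distinct (map fst vs)"
  shows "env_ok vs (map_of (zip (map fst vs) ss))" "env_args vs (map_of (zip (map fst vs) ss)) = ss"
proof -
  have len: "length ss = length vs" using assms(1) by (auto dest: list_all2_lengthD)
  show "env_ok vs (map_of (zip (map fst vs) ss))"
    unfolding env_ok_def
  proof (intro conjI allI impI)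
    show "dom (map_of (zip (map fst vs) ss)) = fst ` set vs"
      using len by (simp add: dom_map_of_zip)
    fix x \<gamma> assume "(x, \<gamma>) \<in> set vs"
    then have "map_of (zip (map fst vs) (map snd vs)) x = Some \<gamma>"
      using assms(2) by (simp add: zip_map_fst_snd)
    with assms(1) show "\<exists>s. map_of (zip (map fst vs) ss) x = Some s \<and> closed_term \<Sigma> s \<gamma>"
      by (rule map_of_zip_list_all2)
  qed
  show "env_args vs (map_of (zip (map fst vs) ss)) = ss"
  proof (rule nth_equalityI)
    fix i assume "i < length (env_args vs (map_of (zip (map fst vs) ss)))"
    then have i: "i < length vs" by simp
    have "map_of (zip (map fst vs) ss) (map fst vs ! i) = Some (ss ! i)"
      by (rule map_of_zip_nth) (use len assms(2) i in simp_all)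
    with i show "env_args vs (map_of (zip (map fst vs) ss)) ! i = ss ! i"
      by (simp add: env_args_def)
  qed (simp add: len)
qed

lemma env_ok_closed: "env_ok vs \<rho> \<Longrightarrow> s \<in> ran \<rho> \<Longrightarrow> subst \<tau> s = s"
  unfolding env_ok_def ran_def by (force intro: subst_closed)

lemma env_ok_extend:
  assumes "env_ok vs \<rho>" "closed_term \<Sigma> t \<gamma>"
  shows "env_ok (extend vs x \<gamma>) (\<rho>(x \<mapsto> t))"
  using assms unfolding env_ok_def extend_def by (auto simp: image_iff)

lemma partial_call_App: "App (partial_call vs x \<gamma> G \<rho>) (hors_tm t) = call (extend vs x \<gamma>) G (\<rho>(x \<mapsto> t))"
proof -
  have "env_args (extend vs x \<gamma>) (\<rho>(x \<mapsto> t)) = env_args (filter (\<lambda>v. fst v \<noteq> x) vs) \<rho> @ [t]"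
    by (simp add: env_args_def extend_def)
  then show ?thesis
    by (simp add: partial_call_def call_def goal_call_def)
qed

lemma subst_hors_tm: "subst (map_option hors_tm \<circ> \<rho>) (hors_tm s) = hors_tm (subst \<rho> s)"
  by (simp add: hors_tm_def map_tm_subst)

lemma subst_vars:
  "(\<And>v. v \<in> set vs \<Longrightarrow> fst v \<in> dom \<rho>) \<Longrightarrow>
    map (subst (map_option hors_tm \<circ> \<rho>)) (vars vs) = map hors_tm (env_args vs \<rho>)"
proof -
  assume dom: "\<And>v. v \<in> set vs \<Longrightarrow> fst v \<in> dom \<rho>"
  have "subst (map_option hors_tm \<circ> \<rho>) (Var (fst v)) = hors_tm (the (\<rho> (fst v)))" if "v \<in> set vs" for v
    using dom[OF that] by (cases "\<rho> (fst v)") (auto simp: domIff)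
  then show ?thesis by (simp add: vars_def env_args_def del: subst.simps)
qed

lemma subst_goal_call [simp]: "subst \<sigma> (goal_call vs G ts) = goal_call vs G (map (subst \<sigma>) ts)"
  by (simp add: goal_call_def)

lemma head_step_call:
  assumes "(vs, G) \<in> goals" "env_ok vs \<rho>"
  shows "head_step \<H> (call vs G \<rho>) (subst (map_option hors_tm \<circ> \<rho>) (goal_body vs G))"
proof -
  have "goal_entry vs G \<in> set (entries I)"
    using assms(1) in_entries by blast
  from head_step_entry[OF this[unfolded goal_entry_def], of "map hors_tm (env_args vs \<rho>)"] show ?thesis
    using map_of_env_args[of \<rho> vs] assms(2) map_of_zip_map[of hors_tm "map fst vs" "env_args vs \<rho>"]
    by (simp add: call_def goal_call_def env_ok_def)
qed

lemma head_step_GTrue: "(vs, GTrue) \<in> goals \<Longrightarrow> env_ok vs \<rho> \<Longrightarrow> head_step \<H> (call vs GTrue \<rho>) true_tm"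
  using head_step_call[of vs GTrue \<rho>] by (simp add: goal_body_def)

lemma head_step_GAtom: "(vs, GAtom P s) \<in> goals \<Longrightarrow> env_ok vs \<rho> \<Longrightarrow>
    head_step \<H> (call vs (GAtom P s) \<rho>) (test_tm P (hors_tm (subst \<rho> s)))"
  using head_step_call[of vs "GAtom P s" \<rho>] by (simp add: goal_body_def subst_hors_tm)

lemma env_ok_dom: "env_ok vs \<rho> \<Longrightarrow> v \<in> set vs \<Longrightarrow> fst v \<in> dom \<rho>"
  by (simp add: env_ok_def)

lemma head_step_GAnd: "(vs, GAnd G H) \<in> goals \<Longrightarrow> env_ok vs \<rho> \<Longrightarrow>
    head_step \<H> (call vs (GAnd G H) \<rho>) (and_tm (call vs G \<rho>) (call vs H \<rho>))"
  using head_step_call[of vs "GAnd G H" \<rho>] subst_vars[of vs \<rho>, OF env_ok_dom]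
  by (simp add: goal_body_def call_def)

lemma head_step_GEx: "(vs, GEx x \<gamma> G) \<in> goals \<Longrightarrow> env_ok vs \<rho> \<Longrightarrow>
    head_step \<H> (call vs (GEx x \<gamma> G) \<rho>) (App (nt (ex_nt \<gamma>)) (partial_call vs x \<gamma> G \<rho>))"
  using head_step_call[of vs "GEx x \<gamma> G" \<rho>] subst_vars[of "filter (\<lambda>v. fst v \<noteq> x) vs" \<rho>] env_ok_dom[of vs \<rho>]
  by (simp add: goal_body_def partial_call_def)

lemma GAnd_goals: "(vs, GAnd G H) \<in> goals \<Longrightarrow> (vs, G) \<in> goals \<and> (vs, H) \<in> goals"
  using msl_goals_children[of "(vs, GAnd G H)"] by (auto simp: goal_children_def)

lemma GEx_goals: "(vs, GEx x \<gamma> G) \<in> goals \<Longrightarrow> (extend vs x \<gamma>, G) \<in> goals"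
  using msl_goals_children[of "(vs, GEx x \<gamma> G)"] by (auto simp: goal_children_def)

lemma GAtom_goals:
  assumes "(vs, GAtom P s) \<in> goals" "env_ok vs \<rho>"
  shows "P \<in> \<Pi>" "closed_term \<Sigma> (subst \<rho> s) Iota"
proof -
  from goals_wf[OF assms(1)] have wf: "P \<in> \<Pi>" "has_type \<Sigma> (map_of vs) s Iota" by simp_all
  show "P \<in> \<Pi>" by (rule wf)
  show "closed_term \<Sigma> (subst \<rho> s) Iota"
    using wf(2) by (rule has_type_subst) (use assms(2) in \<open>auto simp: env_ok_def dest: map_of_SomeD\<close>)
qed

lemma subst_goal_extend:
  assumes "env_ok vs \<rho>"
  shows "subst_goal [x \<mapsto> t] (subst_goal (\<rho>(x := None)) G) = subst_goal (\<rho>(x \<mapsto> t)) G"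
proof -
  have "subst_goal [x \<mapsto> t] (subst_goal (\<rho>(x := None)) G) = subst_goal ([x \<mapsto> t] ++ \<rho>(x := None)) G"
    by (rule subst_goal_subst_goal) (use env_ok_closed[OF assms] in \<open>auto simp: ran_def split: if_splits\<close>)
  moreover have "[x \<mapsto> t] ++ \<rho>(x := None) = \<rho>(x \<mapsto> t)"
    by (rule ext) (auto simp: map_add_def split: option.split)
  ultimately show ?thesis by simp
qed

lemma distinct_binders: "C \<in> D \<Longrightarrow> distinct (map fst (binders C))"
  using wf_definite by (simp add: wf_clause_def)

lemma provable_clause:
  assumes "C \<in> D" "env_ok (binders C) \<rho>" "provable \<Sigma> D (subst_goal \<rho> (body C))"
  shows "provable \<Sigma> D (subst_goal \<rho> (head C))"
  using assms(1) env_args_typed[OF assms(2)] _ assms(3)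
  by (rule provable.intros(4)) (use assms(2) map_of_env_args in \<open>simp add: env_ok_def\<close>)

section \<open>Clause chains and provability\<close>

definition chain_at :: "nat \<Rightarrow> nat tm list \<Rightarrow> (nat \<times> hsym tm) list" where
  "chain_at c ts = map (\<lambda>u. (fst u, subst (map_of (zip [0..<length ts] (map hors_tm ts))) (snd u)))
     (clause_calls (definite I) c (length ts))"

lemma head_step_sym:
  assumes "closed_term \<Sigma> (apps (Sym c) ts) Iota"
  shows "head_step \<H> (hors_tm (apps (Sym c) ts)) (clause_chain (chain_at c ts))"
proof -
  from assms obtain \<gamma>s where \<gamma>s: "\<Sigma> c = Some (arrows \<gamma>s Iota)" "list_all2 (closed_term \<Sigma>) ts \<gamma>s"
    by (auto simp: has_type_apps)
  then have "arity (arrows \<gamma>s Iota) = length ts"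
    by (auto simp: arity_arrows dest: list_all2_lengthD)
  moreover have "sym_entry (definite I) c (arrows \<gamma>s Iota) \<in> set (entries I)"
    unfolding in_entries using map_of_SomeD[OF \<gamma>s(1)] by (intro disjI1) blast
  ultimately have "(sym_nt c, arrows \<gamma>s Iota, [0..<length ts],
      clause_chain (clause_calls (definite I) c (length ts))) \<in> set (entries I)"
    by (simp add: sym_entry_def)
  from head_step_entry[OF this, of "map hors_tm ts"] show ?thesis
    by (simp add: hors_tm_def chain_at_def subst_clause_chain)
qed

text \<open>The chain at a term lists exactly the clause instances whose head is that atom. In a
  \<open>VarClause\<close> the only possible environment maps the variable to the whole term; in a
  \<open>ConClause\<close> the arguments themselves are the environment, and the type of the symbol
  guarantees that they fit the binders.\<close>

lemma chain_at_iff: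
  assumes "closed_term \<Sigma> (apps (Sym c) ts) Iota"
  shows "(P, u) \<in> set (chain_at c ts) \<longleftrightarrow> (\<exists>C \<in> D. \<exists>\<rho>. env_ok (binders C) \<rho> \<and>
    subst_goal \<rho> (head C) = GAtom P (apps (Sym c) ts) \<and> u = call (binders C) (body C) \<rho>)"
proof -
  let ?\<sigma> = "map_of (zip [0..<length ts] (map hors_tm ts))"
  from assms obtain \<gamma>s where \<gamma>s: "\<Sigma> c = Some (arrows \<gamma>s Iota)" "list_all2 (closed_term \<Sigma>) ts \<gamma>s"
    by (auto simp: has_type_apps)
  have params: "map (subst ?\<sigma> \<circ> Var) [0..<length ts] = map hors_tm ts"
    by (rule map_subst_Var) simp_all
  let ?h = "clause_call c (length ts)"
  have each: "(P, u) \<in> (\<lambda>u. (fst u, subst ?\<sigma> (snd u))) ` set (?h C) \<longleftrightarrow> (\<exists>\<rho>. env_ok (binders C) \<rho> \<and>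
    subst_goal \<rho> (head C) = GAtom P (apps (Sym c) ts) \<and> u = call (binders C) (body C) \<rho>)" if "C \<in> D" for C
  proof (cases C)
    case (VarClause y G Q)
    have "apps (nt (sym_nt c)) (map hors_tm ts) = hors_tm (apps (Sym c) ts)"
      by (simp add: hors_tm_def)
    then have "(P, u) \<in> (\<lambda>u. (fst u, subst ?\<sigma> (snd u))) ` set (?h C) \<longleftrightarrow>
        P = Q \<and> u = goal_call [(y, Iota)] G [hors_tm (apps (Sym c) ts)]"
      using params by (simp add: clause_call_def VarClause del: subst.simps(1))
    also have "\<dots> \<longleftrightarrow> (\<exists>\<rho>. env_ok [(y, Iota)] \<rho> \<and> \<rho> y = Some (apps (Sym c) ts) \<and> P = Q \<and>
        u = call [(y, Iota)] G \<rho>)"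
      using assms by (auto simp: env_ok_def call_def env_args_def intro!: exI[of _ "[y \<mapsto> apps (Sym c) ts]"] split: if_splits)
    also have "\<dots> \<longleftrightarrow> (\<exists>\<rho>. env_ok (binders C) \<rho> \<and>
        subst_goal \<rho> (head C) = GAtom P (apps (Sym c) ts) \<and> u = call (binders C) (body C) \<rho>)"
    proof -
      have "subst_goal \<rho> (head (VarClause y G Q)) = GAtom P (apps (Sym c) ts) \<longleftrightarrow>
          \<rho> y = Some (apps (Sym c) ts) \<and> P = Q" if "env_ok [(y, Iota)] \<rho>" for \<rho>
        using that by (auto simp: env_ok_def)
      then show ?thesis
        by (simp add: VarClause del: head.simps cong: conj_cong)
    qed
    finally show ?thesis .
  next
    case (ConClause d ys G Q)
    have head: "subst_goal \<rho> (head C) = GAtom Q (apps (Sym d) (env_args ys \<rho>))" if env: "env_ok ys \<rho>" for \<rho>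
    proof -
      have "subst \<rho> (Var (fst v)) = the (\<rho> (fst v))" if "v \<in> set ys" for v
        using env_ok_dom[OF env that] by auto
      then show ?thesis by (simp add: ConClause env_args_def del: subst.simps(1))
    qed
    have ys: "distinct (map fst ys)"
      using distinct_binders[OF that] by (simp add: ConClause)
    have typed: "list_all2 (closed_term \<Sigma>) ts (map snd ys)" if "d = c"
      using ConClause_type(1)[of d ys G Q] \<open>C \<in> D\<close> ConClause \<gamma>s that by simp
    have "(P, u) \<in> (\<lambda>u. (fst u, subst ?\<sigma> (snd u))) ` set (?h C) \<longleftrightarrow>
        d = c \<and> P = Q \<and> u = goal_call ys G (map hors_tm ts)"
      using params by (auto simp: clause_call_def ConClause simp del: subst.simps(1))
    also have "\<dots> \<longleftrightarrow> (\<exists>\<rho>. env_ok ys \<rho> \<and> d = c \<and> P = Q \<and> env_args ys \<rho> = ts \<and> u = call ys G \<rho>)"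
      using env_ok_zip[OF typed ys] by (auto simp: call_def)
    also have "\<dots> \<longleftrightarrow> (\<exists>\<rho>. env_ok (binders C) \<rho> \<and>
        subst_goal \<rho> (head C) = GAtom P (apps (Sym c) ts) \<and> u = call (binders C) (body C) \<rho>)"
      using head by (auto simp: ConClause simp del: head.simps)
    finally show ?thesis .
  qed
  have chain: "set (chain_at c ts) = (\<Union>C \<in> D. (\<lambda>u. (fst u, subst ?\<sigma> (snd u))) ` set (?h C))"
    unfolding chain_at_def clause_calls_def
    by (simp add: image_UN)
  show ?thesis
    unfolding chain UN_iff by (rule bex_cong[OF refl each])
qed

lemma chain_predicates:
  "closed_term \<Sigma> (apps (Sym c) ts) Iota \<Longrightarrow> fst ` set (chain_at c ts) \<subseteq> \<Pi>"
proof clarify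
  fix P u assume c: "closed_term \<Sigma> (apps (Sym c) ts) Iota" and "(P, u) \<in> set (chain_at c ts)"
  then obtain C \<rho> where "C \<in> D" "subst_goal \<rho> (head C) = GAtom P (apps (Sym c) ts)"
    by (auto simp: chain_at_iff[OF c])
  then show "fst (P, u) \<in> \<Pi>" using clause_predicate[of C] by (cases C rule: clause.exhaust) auto
qed

text \<open>Two invariants are needed at once. A provable goal may be an instance of several
  collected goals, so the first ranges over all ways to write it as
  \<open>subst_goal \<rho> G\<close>. The clause rule proves a head instance that need not be an
  instance of a collected goal, so the second speaks of the atom alone: its term is accepted from
  the state of its predicate. For atoms, the first then follows from the second through
  \<open>test_tm\<close>.\<close>

lemma provable_accepted:
  "provable \<Sigma> D G' \<Longrightarrow>
    (\<forall>vs G \<rho>. (vs, G) \<in> goals \<longrightarrow> env_ok vs \<rho> \<longrightarrow> G' = subst_goal \<rho> G \<longrightarrow> accepted 0 (call vs G \<rho>)) \<and>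
    (\<forall>P s. G' = GAtom P s \<longrightarrow> P \<in> \<Pi> \<longrightarrow> closed_term \<Sigma> s Iota \<longrightarrow> accepted (Suc P) (hors_tm s))"
proof (induction rule: provable.induct)
  case 1
  have "accepted 0 (call vs G \<rho>)" if g: "(vs, G) \<in> goals" "env_ok vs \<rho>" "GTrue = subst_goal \<rho> G" for vs G \<rho>
  proof -
    from g(3) have G: "G = GTrue" by (cases G) auto
    have "accepted 0 true_tm"
      unfolding accepted_def accepts_true by blast
    then show ?thesis
      unfolding G by (rule accepted_step[OF head_step_GTrue[OF g(1)[unfolded G] g(2)]])
  qed
  then show ?case by simp
next
  case (2 G1 H1)
  have "accepted 0 (call vs G \<rho>)" if g: "(vs, G) \<in> goals" "env_ok vs \<rho>" "GAnd G1 H1 = subst_goal \<rho> G" for vs G \<rho>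
  proof -
    from g(3) obtain G2 H2 where G: "G = GAnd G2 H2" and G12: "G1 = subst_goal \<rho> G2" "H1 = subst_goal \<rho> H2"
      by (cases G) auto
    note goals = GAnd_goals[OF g(1)[unfolded G]]
    have "accepted 0 (call vs G2 \<rho>)" "accepted 0 (call vs H2 \<rho>)"
      using 2(3,4) goals g(2) G12 by blast+
    then obtain n m where "accepts n 0 (call vs G2 \<rho>)" "accepts m 0 (call vs H2 \<rho>)"
      unfolding accepted_def by blast
    then have "accepts (max n m) 0 (call vs G2 \<rho>)" "accepts (max n m) 0 (call vs H2 \<rho>)"
      using accepts_mono[of n _ _ "max n m"] accepts_mono[of m _ _ "max n m"] by simp_all
    then have "accepted 0 (and_tm (call vs G2 \<rho>) (call vs H2 \<rho>))"
      unfolding accepted_def accepts_and by blast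
    then show ?thesis
      unfolding G by (rule accepted_step[OF head_step_GAnd[OF g(1)[unfolded G] g(2)]])
  qed
  then show ?case by simp
next
  case (3 t \<gamma> x G1)
  have "accepted 0 (call vs G \<rho>)" if g: "(vs, G) \<in> goals" "env_ok vs \<rho>" "GEx x \<gamma> G1 = subst_goal \<rho> G" for vs G \<rho>
  proof -
    from g(3) obtain G2 where G: "G = GEx x \<gamma> G2" and G1: "G1 = subst_goal (\<rho>(x := None)) G2"
      by (cases G) auto
    have "subst_goal [x \<mapsto> t] G1 = subst_goal (\<rho>(x \<mapsto> t)) G2"
      unfolding G1 by (rule subst_goal_extend[OF g(2)])
    with 3(3) GEx_goals[OF g(1)[unfolded G]] env_ok_extend[OF g(2) 3(1)]
    have "accepted 0 (call (extend vs x \<gamma>) G2 (\<rho>(x \<mapsto> t)))"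
      by blast
    then have "accepted 0 (App (nt (ex_nt \<gamma>)) (partial_call vs x \<gamma> G2 \<rho>))"
      by (intro accepted_ex[OF 3(1)]) (simp only: partial_call_App)
    then show ?thesis
      unfolding G by (rule accepted_step[OF head_step_GEx[OF g(1)[unfolded G] g(2)]])
  qed
  then show ?case by simp
next
  case (4 C ss \<sigma>)
  obtain P s0 where atom: "subst_goal \<sigma> (head C) = GAtom P s0" by (cases C) auto
  have accept: "accepted (Suc P) (hors_tm s0)" if P: "P \<in> \<Pi>" "closed_term \<Sigma> s0 Iota"
  proof -
    obtain c ts where s0: "s0 = apps (Sym c) ts" using closed_term_headE[OF P(2)] .
    note closed = P(2)[unfolded s0]
    \<comment> \<open>The typing premise of the clause rule makes its substitution an environment
      for the body, to which the induction hypothesis applies.\<close>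
    have "env_ok (binders C) \<sigma>"
      unfolding 4(3) by (rule env_ok_zip(1)[OF 4(2) distinct_binders[OF 4(1)]])
    with 4(5) body_goal[OF 4(1)] have "accepted 0 (call (binders C) (body C) \<sigma>)" by blast
    moreover have "(P, call (binders C) (body C) \<sigma>) \<in> set (chain_at c ts)"
      using 4(1) \<open>env_ok (binders C) \<sigma>\<close> atom s0 chain_at_iff[OF closed] by blast
    ultimately have "accepted (Suc P) (clause_chain (chain_at c ts))"
      using P(1) chain_predicates[OF closed] by (intro accepted_clause_chain)
    then show ?thesis
      unfolding s0 by (rule accepted_step[OF head_step_sym[OF closed]])
  qed
  moreover have "accepted 0 (call vs G \<rho>)" if g: "(vs, G) \<in> goals" "env_ok vs \<rho>" "GAtom P s0 = subst_goal \<rho> G" for vs G \<rho>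
  proof -
    from g(3) obtain s where G: "G = GAtom P s" and s0: "s0 = subst \<rho> s" by (cases G) auto
    note atom = GAtom_goals[OF g(1)[unfolded G] g(2)]
    have "accepted (Suc P) (hors_tm (subst \<rho> s))"
      using accept atom unfolding s0 by blast
    then have "accepted 0 (test_tm P (hors_tm (subst \<rho> s)))"
      unfolding accepted_def accepts_test[OF atom(1)] by blast
    then show ?thesis
      unfolding G by (rule accepted_step[OF head_step_GAtom[OF g(1)[unfolded G] g(2)]])
  qed
  ultimately show ?case unfolding atom by blast
qed

text \<open>Strong induction on the height, for both claims together because evaluation alternates
  between goals and clause chains. Every simulated inference spends at least one head step, so its
  premises have smaller height; for a quantifier, \<open>accepts_exD\<close> supplies the witness
  along with such a height.\<close>

lemma accepts_provable:
  "((vs, G) \<in> goals \<longrightarrow> env_ok vs \<rho> \<longrightarrow> accepts n 0 (call vs G \<rho>) \<longrightarrow> provable \<Sigma> D (subst_goal \<rho> G)) \<and>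
   (P \<in> \<Pi> \<longrightarrow> closed_term \<Sigma> s Iota \<longrightarrow> accepts n (Suc P) (hors_tm s) \<longrightarrow> provable \<Sigma> D (GAtom P s))"
proof (induction n arbitrary: vs G \<rho> P s rule: less_induct)
  case (less n)
  have call_IH: "provable \<Sigma> D (subst_goal \<rho> G)"
    if "m < n" "(vs, G) \<in> goals" "env_ok vs \<rho>" "accepts m 0 (call vs G \<rho>)" for m vs G \<rho>
    using less that by blast
  have atom_IH: "provable \<Sigma> D (GAtom P s)"
    if "m < n" "P \<in> \<Pi>" "closed_term \<Sigma> s Iota" "accepts m (Suc P) (hors_tm s)" for m P s
    using less that by blast
  have "provable \<Sigma> D (subst_goal \<rho> G)"
    if g: "(vs, G) \<in> goals" "env_ok vs \<rho>" "accepts n 0 (call vs G \<rho>)"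
  proof (cases G)
    case GTrue
    then show ?thesis by (simp add: provable.intros)
  next
    case (GAtom P s)
    note atom = GAtom_goals[OF g(1)[unfolded GAtom] g(2)]
    obtain m where m: "n = Suc m" "accepts m 0 (test_tm P (hors_tm (subst \<rho> s)))"
      using accepts_head_stepD[OF g(3)[unfolded GAtom] head_step_GAtom[OF g(1)[unfolded GAtom] g(2)]] .
    then obtain k where "m = Suc k" "accepts k (Suc P) (hors_tm (subst \<rho> s))"
      using accepts_test[OF atom(1)] by blast
    with m(1) show ?thesis
      using atom_IH[of k P "subst \<rho> s"] atom by (simp add: GAtom)
  next
    case (GAnd G1 G2)
    obtain m where m: "n = Suc m" "accepts m 0 (and_tm (call vs G1 \<rho>) (call vs G2 \<rho>))"
      using accepts_head_stepD[OF g(3)[unfolded GAnd] head_step_GAnd[OF g(1)[unfolded GAnd] g(2)]] .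
    then obtain k where "m = Suc k" "accepts k 0 (call vs G1 \<rho>)" "accepts k 0 (call vs G2 \<rho>)"
      using accepts_and by blast
    with m(1) show ?thesis
      using call_IH[of k vs] GAnd_goals[OF g(1)[unfolded GAnd]] g(2)
      by (auto simp: GAnd intro!: provable.intros)
  next
    case (GEx x \<gamma> G1)
    obtain m where m: "n = Suc m" "accepts m 0 (App (nt (ex_nt \<gamma>)) (partial_call vs x \<gamma> G1 \<rho>))"
      using accepts_head_stepD[OF g(3)[unfolded GEx] head_step_GEx[OF g(1)[unfolded GEx] g(2)]] .
    from accepts_exD[OF m(2) ex_msl_types[OF g(1)[unfolded GEx]]] obtain t k where
      t: "k < m" "closed_term \<Sigma> t \<gamma>" "accepts k 0 (call (extend vs x \<gamma>) G1 (\<rho>(x \<mapsto> t)))"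
      by (auto simp: partial_call_App)
    have "provable \<Sigma> D (subst_goal (\<rho>(x \<mapsto> t)) G1)"
      by (rule call_IH[OF _ GEx_goals[OF g(1)[unfolded GEx]] env_ok_extend[OF g(2) t(2)] t(3)])
        (use m(1) t(1) in simp)
    then show ?thesis
      unfolding GEx subst_goal.simps
      by (intro provable.intros(3)[OF t(2)]) (simp add: subst_goal_extend[OF g(2)])
  qed
  moreover have "provable \<Sigma> D (GAtom P s)"
    if P: "P \<in> \<Pi>" "closed_term \<Sigma> s Iota" "accepts n (Suc P) (hors_tm s)"
  proof -
    obtain c ts where s: "s = apps (Sym c) ts" using closed_term_headE[OF P(2)] .
    note closed = P(2)[unfolded s]
    obtain m where m: "n = Suc m" "accepts m (Suc P) (clause_chain (chain_at c ts))"
      using accepts_head_stepD[OF P(3)[unfolded s] head_step_sym[OF closed]] .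
    from accepts_clause_chainD[OF m(2) P(1) chain_predicates[OF closed]] obtain u k where
      u: "(P, u) \<in> set (chain_at c ts)" "k < m" "accepts k 0 u" by blast
    from u(1) obtain C \<rho> where C: "C \<in> D" "env_ok (binders C) \<rho>"
      "subst_goal \<rho> (head C) = GAtom P s" "u = call (binders C) (body C) \<rho>"
      unfolding chain_at_iff[OF closed] s by blast
    have "provable \<Sigma> D (subst_goal \<rho> (body C))"
      by (rule call_IH[OF _ body_goal[OF C(1)] C(2) u(3)[unfolded C(4)]]) (use m(1) u(2) in simp)
    from provable_clause[OF C(1,2) this] C(3) show ?thesis by simp
  qed
  ultimately show ?case by blast
qed

lemma cotrivially_accepts_iff_provable: "cotrivially_accepts \<A> (value_tree \<H>) \<longleftrightarrow> msl_provable I"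
proof -
  have "env_ok [] Map.empty" by (simp add: env_ok_def)
  moreover have "subst_goal Map.empty G = G" for G
  proof (induction G)
    case (GAtom P s)
    have "subst Map.empty s = s" by (induction s) auto
    then show ?case by simp
  qed simp_all
  moreover have "call [] (query I) Map.empty = Sym (NT (start \<H>))"
    by (simp add: call_def goal_call_def env_args_def start_eq)
  ultimately have "accepted 0 (Sym (NT (start \<H>))) \<longleftrightarrow> provable \<Sigma> D (query I)"
    using provable_accepted[of "query I"] accepts_provable[of "[]" "query I" Map.empty] query_goal
    unfolding accepted_def by metis
  then show ?thesis
    using cotrivially_accepts_iff states_iff(1) by (simp add: initial_eq msl_provable_def)
qed

end

theorem msl_reducible_to_hors: "msl_omega_provability \<le>\<^sub>m hors_cotrivial_model_checking"
  unfolding msl_problem_eq hors_problem_eq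
proof (rule many_one_reducibleI[OF cfun_hors_of_msl])
  fix I assume "wf_msl I"
  then interpret msl_to_hors I by unfold_locales
  show "(wf_hors (fst (hors_of_msl I)) \<and>
        wf_automaton (constants (fst (hors_of_msl I))) (snd (hors_of_msl I))) \<and>
      (msl_provable I \<longleftrightarrow>
        cotrivially_accepts (snd (hors_of_msl I)) (value_tree (fst (hors_of_msl I))))"
    using wf_hors_of_msl wf_automaton_of_msl cotrivially_accepts_iff_provable
    unfolding \<H>_def \<A>_def by blast
qed

theorem theorem5p13:
  shows "msl_omega_provability \<le>\<^sub>m hors_cotrivial_model_checking \<and>
         hors_cotrivial_model_checking \<le>\<^sub>m msl_omega_provability"
  using msl_reducible_to_hors hors_reducible_to_msl by (rule conjI)

end
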